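(* Let $\xi(t)=\beta^{2}\sum_{p\geq2}\beta_{p}^{2}t^{p}$ satisfy $\xi(1+\epsilon)<\infty$ for some $\epsilon>0$, and let $h\ge 0$. Then $$\min_{\mu\in\Pr([0,1])}P_{\xi,h}(\mu)=\max_{\eta\in\Lambda_{\xi,h}}D_{\xi,h}(\eta).$$ Furthermore, there is a unique optimal pair $(\mu,\eta)\in\Pr([0,1])\times\Lambda_{\xi,h}$ (that is, a unique pair such that $\mu$ minimizes $P_{\xi,h}$ over $\Pr([0,1])$ and $\eta$ maximizes $D_{\xi,h}$ over $\Lambda_{\xi,h}$), and it is characterized by the relations $$\mu\left(\{s\in[0,1):\eta(s)=\xi(s)\}\right)=1,\qquad \eta''\phi_{\mu}^{2}=1\quad\text{Lebesgue-a.e. on }[0,1];$$ that is, a pair $(\mu,\eta)\in\Pr([0,1])\times\Lambda_{\xi,h}$ is optimal if and only if it satisfies these two relations.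
   Context: Here $\beta$ and $\beta_p$ ($p\ge2$) are real numbers. $\Pr([0,1])$ is the set of Borel probability measures on $[0,1]$. For $\mu\in\Pr([0,1])$, let $\phi_{\mu}(t)=\int_{t}^{1}\mu([0,s])\,ds$ for $t\in[0,1]$; note $0\le\phi_\mu(s)\le 1-s$. The Crisanti-Sommers functional is $$P_{\xi,h}(\mu)=\frac{1}{2}\left(\int_{0}^{1}\xi''\phi_{\mu}\,ds+\int_{0}^{1}\left(\frac{1}{\phi_{\mu}}-\frac{1}{1-s}\right)ds+h^{2}\phi_{\mu}(0)\right)\in(-\infty,+\infty],$$ where the second integrand is non-negative (with $1/0=+\infty$). Let $X=\{\eta:\eta\in C^{1}([0,1)),\ \eta'\in Lip_{\mathrm{loc}}([0,1))\}$, where $\eta$ is real-valued and may blow up at $1$ and $Lip_{\mathrm{loc}}$ denotes locally Lipschitz functions. For $\eta\in X$, the second distributional derivative $\eta''$ is identified with an a.e. unique measurable function, essentially bounded on each $[0,1-\delta]$, $\delta>0$. Let $$\Lambda_{\xi,h}=\left\{ \eta\in X:\ \eta\geq\xi \text{ on } [0,1),\ \eta'(0)=-h^{2},\ \eta''\geq0\ \text{Lebesgue-a.e.}\right\}$$ and define $D_{\xi,h}:\Lambda_{\xi,h}\to[-\infty,\infty)$ by $$D_{\xi,h}(\eta)=\frac{1}{2}\left(\int_{0}^{1}\left(2\sqrt{\eta''(s)}-\eta''(s)(1-s)-\frac{1}{1-s}\right)ds-\eta(0)+h^{2}+\xi(1)\right),$$ where the integrand is non-positive by the arithmetic-geometric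 mean inequality. *)

theory Defs
  imports "HOL-Probability.Probability"
begin

definition cs_xi :: "real \<Rightarrow> (nat \<Rightarrow> real) \<Rightarrow> real \<Rightarrow> real" where
  "cs_xi \<beta> b t = \<beta>\<^sup>2 * (\<Sum>p. (b (p + 2))\<^sup>2 * t ^ (p + 2))"

definition Pr01 :: "real measure set" where
  "Pr01 = {\<mu>. prob_space \<mu> \<and> sets \<mu> = sets (restrict_space borel {0..1})}"

definition phi :: "real measure \<Rightarrow> real \<Rightarrow> real" where
  "phi \<mu> t = (LBINT s:{t..1}. measure \<mu> {0..s})"

text \<open>The second integral lives in the extended nonnegative reals, where
  \<open>1 / 0 = \<infinity>\<close> and the (nonnegative) integrand always has an integral.\<close>

definition cs_primal :: "(real \<Rightarrow> real) \<Rightarrow> real \<Rightarrow> real measure \<Rightarrow> ereal" where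
  "cs_primal \<xi> h \<mu> = ereal (1 / 2) *
     (ereal (LBINT s:{0..1}. deriv (deriv \<xi>) s * phi \<mu> s)
      + enn2ereal (\<integral>\<^sup>+s\<in>{0..1}. (1 / ennreal (phi \<mu> s) - 1 / ennreal (1 - s)) \<partial>lborel)
      + ereal (h\<^sup>2 * phi \<mu> 0))"

text \<open>First derivative on \<open>[0,1)\<close>, one-sided at \<open>0\<close>.\<close>

definition deriv1 :: "(real \<Rightarrow> real) \<Rightarrow> real \<Rightarrow> real" where
  "deriv1 \<eta> t = vector_derivative \<eta> (at t within {0..<1})"

definition locally_lipschitz_on :: "real set \<Rightarrow> (real \<Rightarrow> real) \<Rightarrow> bool" where
  "locally_lipschitz_on S f \<longleftrightarrow>
     (\<forall>t\<in>S. \<exists>u>0. \<exists>L. L-lipschitz_on (cball t u \<inter> S) f)"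

text \<open>Functions on \<open>[0,1)\<close> are represented as elements of \<open>extensional {0..<1}\<close>, so that
  equality in HOL is equality on \<open>[0,1)\<close>.\<close>

definition spaceX :: "(real \<Rightarrow> real) set" where
  "spaceX = {\<eta> \<in> extensional {0..<1}.
     \<eta> differentiable_on {0..<1} \<and>
     continuous_on {0..<1} (deriv1 \<eta>) \<and>
     locally_lipschitz_on {0..<1} (deriv1 \<eta>)}"

definition test_function :: "(real \<Rightarrow> real) \<Rightarrow> bool" where
  "test_function \<psi> \<longleftrightarrow>
     (\<forall>n x. ((deriv ^^ n) \<psi>) field_differentiable (at x)) \<and>
     compact (closure {x. \<psi> x \<noteq> 0}) \<and> closure {x. \<psi> x \<noteq> 0} \<subseteq> {0<..<1}"

definition is_distr_deriv2 :: "(real \<Rightarrow> real) \<Rightarrow> (real \<Rightarrow> real) \<Rightarrow> bool" where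
  "is_distr_deriv2 \<eta> g \<longleftrightarrow>
     g \<in> borel_measurable borel \<and>
     (\<forall>\<delta>>0. \<exists>C. AE s in lborel. s \<in> {0..1 - \<delta>} \<longrightarrow> \<bar>g s\<bar> \<le> C) \<and>
     (\<forall>\<psi>. test_function \<psi> \<longrightarrow>
        (LBINT s:{0<..<1}. \<eta> s * (deriv ^^ 2) \<psi> s) = (LBINT s:{0<..<1}. g s * \<psi> s))"

text \<open>For \<open>\<eta> \<in> spaceX\<close> the distributional second derivative exists and is unique up to
  Lebesgue-null sets; it is only used under integrals and in almost-everywhere statements,
  so the chosen representative is immaterial.\<close>

definition deriv2 :: "(real \<Rightarrow> real) \<Rightarrow> real \<Rightarrow> real" where
  "deriv2 \<eta> = (SOME g. is_distr_deriv2 \<eta> g)"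

definition Lambda :: "(real \<Rightarrow> real) \<Rightarrow> real \<Rightarrow> (real \<Rightarrow> real) set" where
  "Lambda \<xi> h = {\<eta> \<in> spaceX.
     (\<forall>t\<in>{0..<1}. \<eta> t \<ge> \<xi> t) \<and> deriv1 \<eta> 0 = - h\<^sup>2 \<and>
     (AE s in lborel. s \<in> {0..1} \<longrightarrow> deriv2 \<eta> s \<ge> 0)}"

text \<open>The integrand of the dual functional is nonpositive; its integral is expressed as
  minus the integral of its (nonnegative) negative, with values in \<open>[-\<infinity>, 0]\<close>.\<close>

definition cs_dual :: "(real \<Rightarrow> real) \<Rightarrow> real \<Rightarrow> (real \<Rightarrow> real) \<Rightarrow> ereal" where
  "cs_dual \<xi> h \<eta> = ereal (1 / 2) *
     (- enn2ereal (\<integral>\<^sup>+s\<in>{0..1}. ennreal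
          (- (2 * sqrt (deriv2 \<eta> s) - deriv2 \<eta> s * (1 - s) - 1 / (1 - s))) \<partial>lborel)
      + ereal (- \<eta> 0 + h\<^sup>2 + \<xi> 1))"

definition optimal_pair ::
    "(real \<Rightarrow> real) \<Rightarrow> real \<Rightarrow> real measure \<Rightarrow> (real \<Rightarrow> real) \<Rightarrow> bool" where
  "optimal_pair \<xi> h \<mu> \<eta> \<longleftrightarrow>
     is_arg_min (cs_primal \<xi> h) (\<lambda>\<nu>. \<nu> \<in> Pr01) \<mu> \<and>
     is_arg_max (cs_dual \<xi> h) (\<lambda>\<theta>. \<theta> \<in> Lambda \<xi> h) \<eta>"

end

theory Submission
  imports Defs "HOL-Computational_Algebra.Polynomial" "HOL-Real_Asymp.Real_Asymp"
begin

text \<open>The proof pairs \<open>\<mu>\<close> with \<open>\<eta>\<close> through one pointwise identity. Put \<open>g = \<eta>''\<close> and \<open>\<phi> = \<phi>\<^sub>\<mu>\<close>. Completing the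
square gives, for \<open>0 < \<phi>(s) \<le> 1 - s\<close> and \<open>g(s) \<ge> 0\<close>,

\<open>(1/\<phi> - 1/(1-s)) + (g (1-s) + 1/(1-s) - 2 \<surd>g) = g (1 - s - \<phi>) + (1 - \<surd>g \<phi>)\<^sup>2 / \<phi>\<close>.

The two terms on the left are the entropy integrand of the primal functional and the integrand lost
by the dual functional. Since \<open>1 - s - \<phi>(s)\<close> is the mean of \<open>max 0 (r - s)\<close> over \<open>r\<close> distributed as
\<open>\<mu>\<close>, Tonelli turns the integral of \<open>g (1 - s - \<phi>)\<close> into the \<open>\<mu>\<close>-mean of
\<open>\<integral> g(s) max 0 (r - s) ds = \<eta>(r) - \<eta>(0) + h\<^sup>2 r\<close>; the same computation with \<open>\<xi>\<close> in place of \<open>\<eta>\<close>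
handles the term \<open>\<integral> \<xi>'' \<phi>\<close>. Altogether, as long as both values are finite,

\<open>2 P(\<mu>) - 2 D(\<eta>) = \<integral> (\<eta> - \<xi>) d\<mu> + \<integral> (1 - \<surd>g \<phi>)\<^sup>2 / \<phi> ds\<close>,

a sum of two nonnegative terms. This is weak duality (\<open>weak_duality\<close>), and the two terms vanish exactly
when the two relations of the theorem hold (\<open>complementary_if_equal\<close>, \<open>equal_if_complementary\<close>). Because
all integrands involved are nonnegative, the identity is first proved in the extended nonnegative
reals (\<open>duality_identity\<close>), where no integrability has to be checked.

It remains to produce one pair that satisfies the relations. A minimizer \<open>\<mu>\<close> of the primal functional
exists by weak compactness and Fatou's lemma (\<open>exists_primal_minimizer\<close>). Moving a small mass of \<open>\<mu>\<close> to a
point \<open>r < 1\<close> cannot decrease the primal functional; in the limit of vanishing mass this says that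
\<open>\<eta> - \<xi>\<close>, where \<open>\<eta>'' = 1/\<phi>\<^sup>2\<close> and \<open>\<eta>'(0) = - h\<^sup>2\<close>, is at \<open>r\<close> no smaller than its \<open>\<mu>\<close>-mean
(\<open>first_order_condition\<close>). Choosing \<open>\<eta>(0)\<close> such that this mean is zero yields \<open>\<eta> \<ge> \<xi>\<close> with equality
\<open>\<mu>\<close>-almost everywhere.

Uniqueness comes for free. If \<open>(\<mu>, \<eta>)\<close> and \<open>(\<nu>, \<theta>)\<close> are optimal then so is \<open>(\<mu>, \<theta>)\<close>, so
\<open>1/\<phi>\<^sub>\<mu>\<^sup>2 = \<theta>'' = 1/\<phi>\<^sub>\<nu>\<^sup>2\<close>, which determines the measure; and \<open>\<eta>'' = \<theta>''\<close>, so that \<open>\<eta>\<close> and \<open>\<theta>\<close> differ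
by a constant, which is zero because both lie above \<open>\<xi>\<close> and touch it.

Three facts about \<open>\<eta>''\<close> carry the analysis: a distributional second derivative is unique almost
everywhere (\<open>is_distr_deriv2_unique\<close>), a function whose derivative is locally Lipschitz has one
(\<open>spaceX_representation\<close>), and \<open>\<eta>\<close> is its double integral (\<open>spaceX_deriv2\<close>).\<close>

section \<open>Uniqueness of distributional second derivatives\<close>

text \<open>The densities of the positive and of the negative part of \<open>G\<close> are finite measures that agree on
half-lines, hence they are the same measure.\<close>

lemma AE_zero_if_integral_greaterThan_zero:
  fixes G :: "real \<Rightarrow> real"
  assumes G: "integrable lborel G"
    and zero: "\<And>x. (LBINT y:{x<..}. G y) = 0"
  shows "AE x in lborel. G x = 0"
proof -
  have [measurable]: "G \<in> borel_measurable borel" using G by auto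
  define M where "M = density lborel (\<lambda>x. ennreal (G x))"
  define N where "N = density lborel (\<lambda>x. ennreal (- G x))"
  have pm: "integrable lborel (\<lambda>x. max 0 (G x) * indicator A x)"
    "integrable lborel (\<lambda>x. max 0 (- G x) * indicator A x)" if [measurable]: "A \<in> sets borel" for A
    by (rule Bochner_Integration.integrable_bound[OF G]; auto split: split_indicator)+
  have eM: "emeasure M A = ennreal (LINT x|lborel. max 0 (G x) * indicator A x)"
    if [measurable]: "A \<in> sets borel" for A
  proof -
    have "emeasure M A = (\<integral>\<^sup>+x. ennreal (max 0 (G x) * indicator A x) \<partial>lborel)"
      by (auto simp: M_def emeasure_density max_def ennreal_neg intro!: nn_integral_cong split: split_indicator)
    also have "\<dots> = ennreal (LINT x|lborel. max 0 (G x) * indicator A x)"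
      by (rule nn_integral_eq_integral) (auto intro: pm)
    finally show ?thesis .
  qed
  have eN: "emeasure N A = ennreal (LINT x|lborel. max 0 (- G x) * indicator A x)"
    if [measurable]: "A \<in> sets borel" for A
  proof -
    have "emeasure N A = (\<integral>\<^sup>+x. ennreal (max 0 (- G x) * indicator A x) \<partial>lborel)"
      by (auto simp: N_def emeasure_density max_def ennreal_neg intro!: nn_integral_cong split: split_indicator)
    also have "\<dots> = ennreal (LINT x|lborel. max 0 (- G x) * indicator A x)"
      by (rule nn_integral_eq_integral) (auto intro: pm)
    finally show ?thesis .
  qed
  have diff: "(LINT x|lborel. max 0 (G x) * indicator A x) - (LINT x|lborel. max 0 (- G x) * indicator A x)
     = (LBINT y:A. G y)" if "A \<in> sets borel" for A
    unfolding set_lebesgue_integral_def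
    by (subst Bochner_Integration.integral_diff[symmetric, OF pm[OF that]])
      (auto intro!: Bochner_Integration.integral_cong split: split_indicator)
  have MN: "M = N"
  proof (rule measure_eqI_lessThan)
    show "sets M = sets borel" "sets N = sets borel" by (auto simp: M_def N_def)
    show "emeasure M {x<..} < \<infinity>" for x by (simp add: eM)
    show "emeasure M {x<..} = emeasure N {x<..}" for x
      using diff[of "{x<..}"] zero[of x] by (simp add: eM eN)
  qed
  have "AE x in lborel. ennreal (G x) = ennreal (- G x)"
    using MN eM[of UNIV] unfolding M_def N_def
    by (subst (asm) finite_density_unique) (auto simp: emeasure_density)
  thus ?thesis
  proof eventually_elim
    case (elim x)
    show ?case
    proof (rule ccontr)
      assume "G x \<noteq> 0"
      thus False using elim by (cases "G x > 0") (auto simp: ennreal_neg ennreal_eq_0_iff)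
    qed
  qed
qed

lemma AE_zero_if_interval_integrals_zero:
  fixes G :: "real \<Rightarrow> real"
  assumes G: "set_integrable lborel {a<..<b} G"
    and zero: "\<And>c d. a \<le> c \<Longrightarrow> c \<le> d \<Longrightarrow> d \<le> b \<Longrightarrow> (LBINT y:{c<..<d}. G y) = 0"
  shows "AE x in lborel. x \<in> {a<..<b} \<longrightarrow> G x = 0"
proof -
  have "AE x in lborel. indicator {a<..<b} x *\<^sub>R G x = 0"
  proof (rule AE_zero_if_integral_greaterThan_zero)
    show "integrable lborel (\<lambda>x. indicat_real {a<..<b} x *\<^sub>R G x)" using G by (simp add: set_integrable_def)
    fix x
    have "(LBINT y:{x<..}. indicat_real {a<..<b} y *\<^sub>R G y) = (LBINT y:{max a x<..<b}. G y)"
      unfolding set_lebesgue_integral_def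
      by (auto intro!: Bochner_Integration.integral_cong simp: indicator_def)
    also have "\<dots> = 0"
    proof (cases "max a x \<le> b")
      case True thus ?thesis by (intro zero) auto
    next
      case False
      hence "{max a x<..<b} = {}" by auto
      thus ?thesis by (simp add: set_lebesgue_integral_def)
    qed
    finally show "(LBINT y:{x<..}. indicat_real {a<..<b} y *\<^sub>R G y) = 0" .
  qed
  thus ?thesis by eventually_elim (auto simp: indicator_def)
qed

text \<open>The bump functions \<open>exp (- c / ((x - a) (b - x)))\<close> on \<open>(a, b)\<close>, with a rational prefactor: the
prefactor makes the family closed under differentiation, so that differentiability of its members
gives smoothness of all of them. As \<open>c\<close> tends to zero, the plain bump increases to the indicator of
\<open>(a, b)\<close>.\<close>

definition bump_term :: "real \<Rightarrow> real \<Rightarrow> real \<Rightarrow> real poly \<Rightarrow> nat \<Rightarrow> real \<Rightarrow> real" where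
  "bump_term a b c p m x = (if a < x \<and> x < b
     then poly p x / ((x - a) * (b - x)) ^ m * exp (- c / ((x - a) * (b - x))) else 0)"

lemma DERIV_zero_if_quadratic_bound:
  fixes f :: "real \<Rightarrow> real"
  assumes "f x = 0" "\<And>y. \<bar>f y\<bar> \<le> K * (y - x)\<^sup>2"
  shows "(f has_field_derivative 0) (at x)"
proof -
  have "((\<lambda>y. (f y - f x) / (y - x)) \<longlongrightarrow> 0) (at x)"
  proof (rule Lim_null_comparison)
    show "eventually (\<lambda>y. norm ((f y - f x) / (y - x)) \<le> K * \<bar>y - x\<bar>) (at x)"
      using eventually_neq_at_within
    proof (rule eventually_mono)
      fix y assume "y \<noteq> x"
      thus "norm ((f y - f x) / (y - x)) \<le> K * \<bar>y - x\<bar>"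
        using assms(2)[of y] assms(1) by (simp add: divide_le_eq power2_eq_square abs_mult[symmetric] mult.assoc)
    qed
    show "((\<lambda>y. K * \<bar>y - x\<bar>) \<longlongrightarrow> 0) (at x)" by (auto intro!: tendsto_eq_intros)
  qed
  thus ?thesis by (simp add: has_field_derivative_iff)
qed

lemma power_over_fact_le_exp: "0 \<le> x \<Longrightarrow> x ^ n / fact n \<le> exp (x::real)"
proof -
  assume x: "0 \<le> x"
  have "(\<Sum>k\<in>{n}. x ^ k /\<^sub>R fact k) \<le> (\<Sum>k. x ^ k /\<^sub>R fact k)"
    by (rule sum_le_suminf) (use x summable_exp_generic[of x] in auto)
  thus ?thesis by (simp add: exp_def divide_inverse mult.commute)
qed

text \<open>The exponential beats every power of \<open>1/q\<close>, \<open>q = (x - a) (b - x)\<close>; the quadratic bound is what gives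
the derivative zero at the two endpoints.\<close>

lemma bump_term_quadratic_bound:
  assumes "a < b" "c > 0"
  shows "\<exists>K. \<forall>y. \<bar>bump_term a b c p m y\<bar> \<le> K * (y - a)\<^sup>2 \<and> \<bar>bump_term a b c p m y\<bar> \<le> K * (y - b)\<^sup>2"
proof -
  have "compact (poly p ` {a..b})" by (intro compact_continuous_image continuous_intros) auto
  then obtain P where P: "\<And>y. y \<in> {a..b} \<Longrightarrow> \<bar>poly p y\<bar> \<le> P"
    by (metis compact_imp_bounded bounded_iff imageI real_norm_def)
  have P0: "0 \<le> P" using P[of a] assms by auto
  define K0 where "K0 = fact (m + 2) / c ^ (m + 2)"
  have K0: "K0 \<ge> 0" using assms by (simp add: K0_def)
  define K where "K = P * K0 * (b - a)\<^sup>2"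
  have bound: "\<bar>bump_term a b c p m y\<bar> \<le> P * K0 * ((y - a) * (b - y))\<^sup>2" if y: "a < y" "y < b" for y
  proof -
    define q where "q = (y - a) * (b - y)"
    have q: "q > 0" using y by (simp add: q_def)
    define N F where "N = m + 2" and "F = (fact N :: real)"
    have F: "F > 0" by (simp add: F_def)
    have "(c / q) ^ N / F \<le> exp (c / q)"
      unfolding F_def using q assms by (intro power_over_fact_le_exp) auto
    hence "exp (- (c / q)) \<le> F / c ^ N * q ^ N"
      using q assms F by (simp add: exp_minus field_simps)
    hence "exp (- (c / q)) \<le> K0 * q ^ (m + 2)"
      unfolding K0_def F_def N_def .
    hence "exp (- c / q) / q ^ m \<le> K0 * q\<^sup>2"
      using q by (simp add: field_simps power_add power2_eq_square)
    hence "\<bar>poly p y\<bar> * (exp (- c / q) / q ^ m) \<le> P * (K0 * q\<^sup>2)"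
      by (intro mult_mono) (use P[of y] P0 y q K0 in auto)
    moreover have "bump_term a b c p m y = poly p y * (exp (- c / q) / q ^ m)"
      using y by (simp add: bump_term_def q_def)
    ultimately show ?thesis using q by (simp add: abs_mult q_def[symmetric] mult.assoc)
  qed
  have ya: "((y - a) * (b - y))\<^sup>2 \<le> (b - a)\<^sup>2 * (y - a)\<^sup>2" and yb: "((y - a) * (b - y))\<^sup>2 \<le> (b - a)\<^sup>2 * (y - b)\<^sup>2"
    if y: "a < y" "y < b" for y
  proof -
    have "(b - y)\<^sup>2 \<le> (b - a)\<^sup>2" "(y - a)\<^sup>2 \<le> (b - a)\<^sup>2" using y by (intro power_mono; simp)+
    from mult_right_mono[OF this(1), of "(y - a)\<^sup>2"] mult_right_mono[OF this(2), of "(b - y)\<^sup>2"]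
    show "((y - a) * (b - y))\<^sup>2 \<le> (b - a)\<^sup>2 * (y - a)\<^sup>2" "((y - a) * (b - y))\<^sup>2 \<le> (b - a)\<^sup>2 * (y - b)\<^sup>2"
      by (simp_all add: power_mult_distrib mult.commute power2_commute[of y b])
  qed
  have PK: "0 \<le> P * K0" using P0 K0 by simp
  have "\<bar>bump_term a b c p m y\<bar> \<le> K * (y - a)\<^sup>2 \<and> \<bar>bump_term a b c p m y\<bar> \<le> K * (y - b)\<^sup>2" for y
  proof (cases "a < y \<and> y < b")
    case True
    thus ?thesis
      using bound[of y] mult_left_mono[OF ya[of y] PK] mult_left_mono[OF yb[of y] PK]
      by (auto simp: K_def mult.assoc)
  next
    case False
    hence "bump_term a b c p m y = 0" by (auto simp: bump_term_def)
    thus ?thesis using PK by (simp add: K_def)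
  qed
  thus ?thesis by blast
qed

lemma bump_term_DERIV:
  assumes "a < b" "c > 0"
  shows "\<exists>p' m'. \<forall>x. (bump_term a b c p m has_field_derivative bump_term a b c p' m' x) (at x)"
proof -
  define q where "q = [:-a, 1:] * [:b, -1:]"
  define p' where "p' = pderiv p * q ^ 2 - smult (real m) (p * pderiv q * q) + smult c (p * pderiv q)"
  have q: "poly q x = (x - a) * (b - x)" for x by (simp add: q_def algebra_simps)
  obtain K where K: "\<And>y. \<bar>bump_term a b c p m y\<bar> \<le> K * (y - a)\<^sup>2" "\<And>y. \<bar>bump_term a b c p m y\<bar> \<le> K * (y - b)\<^sup>2"
    using bump_term_quadratic_bound[OF assms] by blast
  have "(bump_term a b c p m has_field_derivative bump_term a b c p' (m + 2) x) (at x)" for x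
  proof -
    consider "x = a" | "x = b" | "x < a \<or> x > b" | "a < x" "x < b" by linarith
    thus ?thesis
    proof cases
      case 1
      have e: "bump_term a b c p m a = 0" by (simp add: bump_term_def)
      from 1 have "(bump_term a b c p m has_field_derivative 0) (at x)"
        using K(1) e by (intro DERIV_zero_if_quadratic_bound[of _ _ K]) auto
      thus ?thesis using 1 by (simp add: bump_term_def)
    next
      case 2
      have e: "bump_term a b c p m b = 0" by (simp add: bump_term_def)
      from 2 have "(bump_term a b c p m has_field_derivative 0) (at x)"
        using K(2) e by (intro DERIV_zero_if_quadratic_bound[of _ _ K]) auto
      thus ?thesis using 2 by (simp add: bump_term_def)
    next
      case 3
      have "((\<lambda>x. 0) has_field_derivative 0) (at x)" by simp
      hence "(bump_term a b c p m has_field_derivative 0) (at x)"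
        by (rule has_field_derivative_transform_within_open[where S = "{..<a} \<union> {b<..}"])
          (use 3 assms in \<open>auto simp: bump_term_def\<close>)
      thus ?thesis using 3 by (auto simp: bump_term_def)
    next
      case 4
      have pos: "poly q x > 0" using 4 by (simp add: q)
      have "((\<lambda>x. poly p x / poly q x ^ m * exp (- c / poly q x)) has_field_derivative
          poly p' x / poly q x ^ (m + 2) * exp (- c / poly q x)) (at x)"
        apply (rule derivative_eq_intros refl poly_DERIV | use pos in simp; fail)+
        using pos apply (cases m)
         apply (simp_all add: p'_def field_simps power2_eq_square)
        done
      hence "(bump_term a b c p m has_field_derivative
          poly p' x / poly q x ^ (m + 2) * exp (- c / poly q x)) (at x)"
        by (rule has_field_derivative_transform_within_open[where S = "{a<..<b}"])
          (use 4 in \<open>auto simp: bump_term_def q\<close>)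
      thus ?thesis using 4 by (simp add: bump_term_def q)
    qed
  qed
  thus ?thesis by blast
qed

lemma bump_term_higher_deriv:
  assumes "a < b" "c > 0"
  shows "\<exists>p' m'. (deriv ^^ n) (bump_term a b c p m) = bump_term a b c p' m'"
proof (induction n)
  case 0 show ?case by auto
next
  case (Suc n)
  then obtain p' m' where *: "(deriv ^^ n) (bump_term a b c p m) = bump_term a b c p' m'" by blast
  obtain p'' m'' where "\<And>x. (bump_term a b c p' m' has_field_derivative bump_term a b c p'' m'' x) (at x)"
    using bump_term_DERIV[OF assms] by blast
  hence "deriv (bump_term a b c p' m') = bump_term a b c p'' m''" by (auto intro!: DERIV_imp_deriv)
  thus ?case using * by auto
qed

lemma test_function_bump_term:
  assumes "0 < a" "a < b" "b < 1" "c > 0"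
  shows "test_function (bump_term a b c p m)"
proof -
  have "(deriv ^^ n) (bump_term a b c p m) field_differentiable at x" for n x
    using bump_term_higher_deriv[OF assms(2,4), of n p m] bump_term_DERIV[OF assms(2,4)]
    unfolding field_differentiable_def by metis
  moreover have "closure {x. bump_term a b c p m x \<noteq> 0} \<subseteq> closure {a..b}"
    by (intro closure_mono) (auto simp: bump_term_def)
  hence *: "closure {x. bump_term a b c p m x \<noteq> 0} \<subseteq> {a..b}" by simp
  hence "compact (closure {x. bump_term a b c p m x \<noteq> 0})"
    by (meson bounded_closed_interval bounded_subset closed_closure compact_eq_bounded_closed)
  ultimately show ?thesis unfolding test_function_def using * assms by auto
qed

definition locally_ess_bounded :: "(real \<Rightarrow> real) \<Rightarrow> bool" where
  "locally_ess_bounded g \<longleftrightarrow> (\<forall>\<delta>>0. \<exists>C. AE s in lborel. s \<in> {0..1 - \<delta>} \<longrightarrow> \<bar>g s\<bar> \<le> C)"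

lemma set_integrable_ess_bounded:
  fixes g :: "real \<Rightarrow> real"
  assumes [measurable]: "g \<in> borel_measurable borel" and C: "AE s in lborel. s \<in> {a..b} \<longrightarrow> \<bar>g s\<bar> \<le> C"
    and A[measurable]: "A \<in> sets borel" "A \<subseteq> {a..b}"
  shows "set_integrable lborel A g"
  unfolding set_integrable_def
proof (rule Bochner_Integration.integrable_bound)
  show "integrable lborel (\<lambda>x. indicator {a..b} x *\<^sub>R C)" 
    using borel_integrable_atLeastAtMost'[of a b "\<lambda>_. C"] by (simp add: set_integrable_def)
  show "AE x in lborel. norm (indicat_real A x *\<^sub>R g x) \<le> norm (indicat_real {a..b} x *\<^sub>R C)"
    using C by eventually_elim (use A in \<open>auto simp: indicator_def\<close>)
qed simp

lemma set_integrable_locally_ess_bounded: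
  assumes g: "g \<in> borel_measurable borel" and "locally_ess_bounded g" "b < 1"
    and A: "A \<in> sets borel" "A \<subseteq> {0..b}"
  shows "set_integrable lborel A g"
proof -
  obtain C where "AE s in lborel. s \<in> {0..1 - (1 - b)} \<longrightarrow> \<bar>g s\<bar> \<le> C"
    using assms unfolding locally_ess_bounded_def by (meson diff_gt_0_iff_gt)
  thus ?thesis by (intro set_integrable_ess_bounded[OF g _ A]) simp
qed

lemma bump_term_tendsto_indicator:
  assumes "a < b"
  shows "(\<lambda>n. bump_term a b (1 / Suc n) 1 0 x) \<longlonglongrightarrow> indicator {a<..<b} x"
proof (cases "x \<in> {a<..<b}")
  case True
  have "(\<lambda>n. exp (- (1 / Suc n) / ((x - a) * (b - x)))) \<longlonglongrightarrow> exp (- 0 / ((x - a) * (b - x)))"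
    by (intro tendsto_intros LIMSEQ_Suc[OF lim_1_over_n]) (use True in auto)
  thus ?thesis using True by (simp add: bump_term_def)
next
  case False
  thus ?thesis by (auto simp: bump_term_def indicator_def)
qed

lemma bump_term_measurable [measurable]: "bump_term a b c p m \<in> borel_measurable borel"
proof -
  have [measurable]: "poly p \<in> borel_measurable borel"
    by (intro borel_measurable_continuous_onI continuous_intros)
  show ?thesis unfolding bump_term_def[abs_def] by measurable
qed

lemma bump_term_bounded: "c > 0 \<Longrightarrow> \<bar>bump_term a b c 1 0 x\<bar> \<le> indicator {a<..<b} x"
  by (auto simp: bump_term_def indicator_def)

text \<open>Test with bumps that increase to the indicator of \<open>(a, b)\<close>.\<close>

lemma is_distr_deriv2_interval_integral:
  assumes g: "is_distr_deriv2 \<eta> g" "is_distr_deriv2 \<eta> g'" and ab: "0 < a" "a < b" "b < 1"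
  shows "(LBINT s:{a<..<b}. g s) = (LBINT s:{a<..<b}. g' s)"
proof -
  have lim: "(\<lambda>n. LBINT s:{0<..<1}. h s * bump_term a b (1 / Suc n) 1 0 s) \<longlonglongrightarrow> (LBINT s:{a<..<b}. h s)"
    if h: "is_distr_deriv2 \<eta> h" for h
  proof -
    have [measurable]: "h \<in> borel_measurable borel" using h by (simp add: is_distr_deriv2_def)
    have si: "set_integrable lborel {a<..<b} h"
      using h ab unfolding is_distr_deriv2_def
      by (intro set_integrable_locally_ess_bounded[of _ b]) (auto simp: locally_ess_bounded_def)
    show ?thesis
      unfolding set_lebesgue_integral_def
    proof (rule integral_dominated_convergence[where w = "\<lambda>s. norm (indicator {a<..<b} s *\<^sub>R h s)"])
      show "integrable lborel (\<lambda>x. norm (indicat_real {a<..<b} x *\<^sub>R h x))"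
        using si by (simp add: set_integrable_def)
      show "AE x in lborel. (\<lambda>n. indicat_real {0<..<1} x *\<^sub>R (h x * bump_term a b (1 / Suc n) 1 0 x))
             \<longlonglongrightarrow> indicat_real {a<..<b} x *\<^sub>R h x"
      proof (intro AE_I2)
        fix x
        have "(\<lambda>n. indicat_real {0<..<1} x *\<^sub>R (h x * bump_term a b (1 / Suc n) 1 0 x))
             \<longlonglongrightarrow> indicat_real {0<..<1} x *\<^sub>R (h x * indicator {a<..<b} x)"
          by (intro tendsto_intros bump_term_tendsto_indicator ab)
        also have "indicat_real {0<..<1} x *\<^sub>R (h x * indicator {a<..<b} x) = indicat_real {a<..<b} x *\<^sub>R h x"
          using ab by (auto simp: indicator_def)
        finally show "(\<lambda>n. indicat_real {0<..<1} x *\<^sub>R (h x * bump_term a b (1 / Suc n) 1 0 x))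
             \<longlonglongrightarrow> indicat_real {a<..<b} x *\<^sub>R h x" .
      qed
      show "AE x in lborel. norm (indicat_real {0<..<1} x *\<^sub>R (h x * bump_term a b (1 / Suc n) 1 0 x))
         \<le> norm (indicat_real {a<..<b} x *\<^sub>R h x)" for n
      proof (intro AE_I2)
        fix x
        show "norm (indicat_real {0<..<1} x *\<^sub>R (h x * bump_term a b (1 / Suc n) 1 0 x))
          \<le> norm (indicat_real {a<..<b} x *\<^sub>R h x)"
          using bump_term_bounded[of "1 / Suc n" a b x]
            mult_left_mono[of "\<bar>bump_term a b (1 / Suc n) 1 0 x\<bar>" 1 "\<bar>h x\<bar>"]
          by (auto simp: indicator_def abs_mult split: if_splits)
      qed
    qed simp_all
  qed
  have "test_function (bump_term a b (1 / Suc n) 1 0)" for n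
    using ab by (intro test_function_bump_term) auto
  hence "(LBINT s:{0<..<1}. g s * bump_term a b (1 / Suc n) 1 0 s) =
     (LBINT s:{0<..<1}. g' s * bump_term a b (1 / Suc n) 1 0 s)" for n
    using g unfolding is_distr_deriv2_def by metis
  thus ?thesis using lim[OF g(1)] lim[OF g(2)] LIMSEQ_unique by simp
qed

text \<open>Local essential bounds give integrability only away from the endpoint \<open>1\<close>, so statements on the unit
interval are assembled from an exhaustion by smaller intervals.\<close>

lemma AE_Icc01I:
  fixes P :: "real \<Rightarrow> bool"
  assumes "\<And>n::nat. AE s in lborel. s \<in> {1 / (real n + 2)<..<1 - 1 / (real n + 2)} \<longrightarrow> P s"
  shows "AE s in lborel. s \<in> {0..1} \<longrightarrow> P s"
proof -
  have "AE s in lborel. \<forall>n. s \<in> {1 / (real n + 2)<..<1 - 1 / (real n + 2)} \<longrightarrow> P s"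
    using assms by (subst AE_all_countable) auto
  with AE_lborel_singleton[of 0] AE_lborel_singleton[of 1] show ?thesis
  proof eventually_elim
    case (elim s)
    show ?case
    proof
      assume s: "s \<in> {0..1}"
      have "(\<lambda>n. 1 / (real n + 2)) \<longlonglongrightarrow> 0" by real_asymp
      hence "eventually (\<lambda>n. 1 / (real n + 2) < min s (1 - s)) sequentially"
        using s elim by (intro order_tendstoD(2)[where y = 0]) auto
      then obtain n where "1 / (real n + 2) < min s (1 - s)"
        by (auto simp: eventually_sequentially)
      thus "P s" using elim by auto
    qed
  qed
qed

lemma is_distr_deriv2_unique:
  assumes g: "is_distr_deriv2 \<eta> g" "is_distr_deriv2 \<eta> g'"
  shows "AE s in lborel. s \<in> {0..1} \<longrightarrow> g s = g' s"
proof (rule AE_Icc01I)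
  fix n :: nat
  define a b where "a = 1 / (real n + 2)" and "b = 1 - 1 / (real n + 2)"
  have ab: "0 < a" "b < 1" by (auto simp: a_def b_def)
  have si: "set_integrable lborel A h" if "is_distr_deriv2 \<eta> h" "A \<in> sets borel" "A \<subseteq> {a..b}" for A h
    using that ab unfolding is_distr_deriv2_def
    by (intro set_integrable_locally_ess_bounded[of _ b]) (auto simp: locally_ess_bounded_def)
  have "AE s in lborel. s \<in> {a<..<b} \<longrightarrow> g s - g' s = 0"
  proof (rule AE_zero_if_interval_integrals_zero)
    show "set_integrable lborel {a<..<b} (\<lambda>s. g s - g' s)"
      by (intro set_integral_diff si g) auto
    show "(LBINT y:{c<..<d}. g y - g' y) = 0" if "a \<le> c" "c \<le> d" "d \<le> b" for c d
    proof (cases "c = d")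
      case False
      have "(LBINT y:{c<..<d}. g y - g' y) = (LBINT y:{c<..<d}. g y) - (LBINT y:{c<..<d}. g' y)"
        by (intro set_integral_diff si g) (use that in auto)
      thus ?thesis using is_distr_deriv2_interval_integral[OF g, of c d] that False ab by simp
    qed (simp add: set_lebesgue_integral_def)
  qed
  thus "AE s in lborel. s \<in> {1 / (real n + 2)<..<1 - 1 / (real n + 2)} \<longrightarrow> g s = g' s"
    by (simp add: a_def b_def)
qed

section \<open>Double integrals have a distributional second derivative\<close>

lemma integrable_pair_dominated:
  fixes f :: "real \<times> real \<Rightarrow> real"
  assumes [measurable]: "f \<in> borel_measurable (lborel \<Otimes>\<^sub>M lborel)"
    and u: "integrable lborel (u :: real \<Rightarrow> real)" and v: "integrable lborel (v :: real \<Rightarrow> real)"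
    and le: "\<And>x y. \<bar>f (x, y)\<bar> \<le> u x * v y"
  shows "integrable (lborel \<Otimes>\<^sub>M lborel) f"
proof (rule lborel_pair.Fubini_integrable)
  have [measurable]: "u \<in> borel_measurable borel" "v \<in> borel_measurable borel" using u v by auto
  have i2: "integrable lborel (\<lambda>y. f (x, y))" for x
    by (rule Bochner_Integration.integrable_bound[where f = "\<lambda>y. u x * v y"]) (use u v le in \<open>auto intro!: AE_I2 order.trans[OF le abs_ge_self]\<close>)
  show "AE x in lborel. integrable lborel (\<lambda>y. f (x, y))" using i2 by simp
  show "integrable lborel (\<lambda>x. LBINT y. norm (f (x, y)))"
  proof (rule Bochner_Integration.integrable_bound[where f = "\<lambda>x. u x * (LBINT y. v y)"])
    show "AE x in lborel. norm (LBINT y. norm (f (x, y))) \<le> norm (u x * (LBINT y. v y))"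
    proof (intro AE_I2)
      fix x
      have "(LBINT y. norm (f (x, y))) \<le> (LBINT y. u x * v y)"
        by (intro integral_mono integrable_norm i2) (use v le in auto)
      thus "norm (LBINT y. norm (f (x, y))) \<le> norm (u x * (LBINT y. v y))" by simp
    qed
  qed (use u in auto)
qed fact

lemma test_function_props:
  assumes "test_function \<psi>"
  obtains a b where "0 < a" "a < b" "b < 1"
    "\<And>x. x \<notin> {a..b} \<Longrightarrow> \<psi> x = 0" "\<And>x. x \<notin> {a..b} \<Longrightarrow> deriv \<psi> x = 0" "\<And>x. x \<notin> {a..b} \<Longrightarrow> deriv (deriv \<psi>) x = 0"
    "\<And>x. (\<psi> has_real_derivative deriv \<psi> x) (at x)" "\<And>x. (deriv \<psi> has_real_derivative deriv (deriv \<psi>) x) (at x)"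
    "continuous_on UNIV (deriv (deriv \<psi>))"
proof -
  define K where "K = closure {x. \<psi> x \<noteq> 0}"
  have K: "compact K" "K \<subseteq> {0<..<1}" using assms by (auto simp: test_function_def K_def)
  have fd: "(deriv ^^ n) \<psi> field_differentiable at x" for n x using assms by (auto simp: test_function_def)
  have "\<exists>a b. 0 < a \<and> a < b \<and> b < 1 \<and> K \<subseteq> {a..b}"
  proof (cases "K = {}")
    case True thus ?thesis by (intro exI[of _ "1/3"] exI[of _ "2/3"]) auto
  next
    case False
    then obtain l u where lu: "l \<in> K" "u \<in> K" "\<And>x. x \<in> K \<Longrightarrow> l \<le> x" "\<And>x. x \<in> K \<Longrightarrow> x \<le> u"
      using compact_attains_inf[OF K(1)] compact_attains_sup[OF K(1)] by metis
    hence "l \<le> u" "0 < l" "u < 1" using K(2) by auto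
    thus ?thesis using lu(3,4) by (intro exI[of _ "l/2"] exI[of _ "(1+u)/2"]) (fastforce simp: subset_eq)
  qed
  then obtain a b where ab: "0 < a" "a < b" "b < 1" "K \<subseteq> {a..b}" by blast
  have z0: "\<psi> x = 0" if "x \<notin> {a..b}" for x
    using that ab(4) closure_subset[of "{x. \<psi> x \<noteq> 0}"] unfolding K_def[symmetric] by auto
  have zd: "deriv f x = 0" if "\<And>x. x \<notin> {a..b} \<Longrightarrow> f x = 0" "x \<notin> {a..b}" for f :: "real \<Rightarrow> real" and x
  proof (rule DERIV_imp_deriv)
    have "((\<lambda>x. 0) has_real_derivative 0) (at x)" by simp
    thus "(f has_real_derivative 0) (at x)"
      by (rule has_field_derivative_transform_within_open[where S = "- {a..b}"]) (use that in auto)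
  qed
  show thesis
  proof (rule that[OF ab(1-3)])
    show "\<psi> x = 0" "deriv \<psi> x = 0" "deriv (deriv \<psi>) x = 0" if "x \<notin> {a..b}" for x
      using that z0 by (auto intro!: zd)
    show "(\<psi> has_real_derivative deriv \<psi> x) (at x)" for x
      using fd[of 0] by (simp add: DERIV_deriv_iff_field_differentiable)
    show "(deriv \<psi> has_real_derivative deriv (deriv \<psi>) x) (at x)" for x
      using fd[of 1] by (simp add: DERIV_deriv_iff_field_differentiable)
    show "continuous_on UNIV (deriv (deriv \<psi>))"
      using fd[of 2] by (simp add: continuous_on_eq_continuous_at field_differentiable_imp_continuous_at numeral_2_eq_2)
  qed
qed

text \<open>A single application of Fubini replaces integrations by parts, which would need a Leibniz rule for
functions that are differentiable only almost everywhere: Taylor's formula writes the test function as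
\<open>\<psi>(s) = \<integral>\<^sub>s (r - s) \<psi>''(r) dr\<close>, and exchanging the integrals in \<open>\<integral> g \<psi>\<close> leaves \<open>\<psi>''\<close> against the
double integral of \<open>g\<close>. The affine part of \<open>\<eta>\<close> is orthogonal to \<open>\<psi>''\<close>.\<close>

lemma is_distr_deriv2I:
  assumes g[measurable]: "g \<in> borel_measurable borel" and leb: "locally_ess_bounded g"
    and eta: "\<And>r. r \<in> {0..<1} \<Longrightarrow> \<eta> r = \<alpha> + \<gamma> * r + (LBINT s:{0..r}. (r - s) * g s)"
  shows "is_distr_deriv2 \<eta> g"
  unfolding is_distr_deriv2_def
proof (intro conjI allI impI)
  show "\<exists>C. AE s in lborel. s \<in> {0..1 - \<delta>} \<longrightarrow> \<bar>g s\<bar> \<le> C" if "\<delta> > 0" for \<delta>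
    using leb that by (auto simp: locally_ess_bounded_def)
  fix \<psi> assume "test_function \<psi>"
  then obtain a b where ab: "0 < a" "a < b" "b < 1"
    and z: "\<And>x. x \<notin> {a..b} \<Longrightarrow> \<psi> x = 0" "\<And>x. x \<notin> {a..b} \<Longrightarrow> deriv \<psi> x = 0" "\<And>x. x \<notin> {a..b} \<Longrightarrow> deriv (deriv \<psi>) x = 0"
    and d: "\<And>x. (\<psi> has_real_derivative deriv \<psi> x) (at x)" "\<And>x. (deriv \<psi> has_real_derivative deriv (deriv \<psi>) x) (at x)"
    and c: "continuous_on UNIV (deriv (deriv \<psi>))"
    by (rule test_function_props) (rule that)
  define \<psi>1 where "\<psi>1 = deriv \<psi>"
  define \<psi>2 where "\<psi>2 = deriv (deriv \<psi>)"
  note d = d[folded \<psi>2_def, folded \<psi>1_def] and z = z[folded \<psi>2_def, folded \<psi>1_def] and c = c[folded \<psi>2_def]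
  have [measurable]: "\<psi>2 \<in> borel_measurable borel" using c by (rule borel_measurable_continuous_onI)
  have [measurable]: "\<psi> \<in> borel_measurable borel"
    by (intro borel_measurable_continuous_onI continuous_at_imp_continuous_on ballI DERIV_isCont[OF d(1)])
  note dw = d[THEN has_field_derivative_at_within]
  have cs: "continuous_on S \<psi>2" for S using c continuous_on_subset by blast
  have taylor: "(LBINT r:{s..1}. (r - s) * \<psi>2 r) = \<psi> s" if "s \<le> 1" for s
  proof -
    have "(LBINT r:{s..1}. (r - s) * \<psi>2 r) = ((1 - s) * \<psi>1 1 - \<psi> 1) - ((s - s) * \<psi>1 s - \<psi> s)"
      unfolding set_lebesgue_integral_def
      by (rule integral_FTC_atLeastAtMost)
        (use that in \<open>auto intro!: continuous_intros cs derivative_eq_intros dw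
            simp: has_real_derivative_iff_has_vector_derivative[symmetric]\<close>)
    thus ?thesis using z ab by simp
  qed
  have aff: "(LBINT r:{0..1}. (\<alpha> + \<gamma> * r) * \<psi>2 r) = 0"
  proof -
    have "(LBINT r:{0..1}. (\<alpha> + \<gamma> * r) * \<psi>2 r) = ((\<alpha> + \<gamma> * 1) * \<psi>1 1 - \<gamma> * \<psi> 1) - ((\<alpha> + \<gamma> * 0) * \<psi>1 0 - \<gamma> * \<psi> 0)"
      unfolding set_lebesgue_integral_def
      by (rule integral_FTC_atLeastAtMost)
        (auto intro!: continuous_intros cs derivative_eq_intros dw
            simp: has_real_derivative_iff_has_vector_derivative[symmetric])
    thus ?thesis using z ab by simp
  qed
  obtain M where M: "\<And>x. x \<in> {0..b} \<Longrightarrow> \<bar>\<psi>2 x\<bar> \<le> M"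
    using compact_continuous_image[OF cs[of "{0..b}"] compact_Icc] compact_imp_bounded bounded_iff
    by (metis imageI real_norm_def)
  have M0: "0 \<le> M" using M[of 0] ab by auto
  \<comment> \<open>The integrand of the double integral, cut off at \<open>b < 1\<close> beyond which \<open>\<psi>\<close> vanishes.\<close>
  define F where "F = (\<lambda>(s, r). indicator {0..b} s * g s * (indicator {0..b} r * (if s \<le> r then (r - s) * \<psi>2 r else 0)))"
  have gi: "set_integrable lborel {0..b} g"
    by (intro set_integrable_locally_ess_bounded[OF g leb]) (use ab in auto)
  have Fi: "integrable (lborel \<Otimes>\<^sub>M lborel) F"
  proof (rule integrable_pair_dominated)
    show "integrable lborel (\<lambda>s. \<bar>indicator {0..b} s * g s\<bar>)" using gi by (simp add: set_integrable_def)
    show "integrable lborel (\<lambda>r. indicator {0..b} r * (b * M))"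
      using borel_integrable_atLeastAtMost'[of 0 b "\<lambda>_. b * M"] by (simp add: set_integrable_def)
    show "\<bar>F (s, r)\<bar> \<le> \<bar>indicat_real {0..b} s * g s\<bar> * (indicat_real {0..b} r * (b * M))" for s r
    proof -
      have "\<bar>indicator {0..b} r * (if s \<le> r then (r - s) * \<psi>2 r else 0)\<bar> \<le> indicat_real {0..b} r * (b * M)"
        if "s \<in> {0..b}"
        using that ab M0 M[of r] by (auto simp: indicator_def abs_mult intro!: mult_mono)
      from mult_left_mono[OF this, of "\<bar>indicat_real {0..b} s * g s\<bar>"]
      show ?thesis unfolding F_def prod.case by (cases "s \<in> {0..b}") (simp_all only: abs_mult, auto)
    qed
    show "F \<in> borel_measurable (lborel \<Otimes>\<^sub>M lborel)" unfolding F_def by measurable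
  qed
  have inner: "(LBINT s. F (s, r)) = indicator {0..b} r *\<^sub>R (\<psi>2 r * (\<eta> r - (\<alpha> + \<gamma> * r)))" for r
  proof (cases "r \<in> {0..b}")
    case True
    have "(LBINT s. F (s, r)) = (LBINT s. \<psi>2 r * (indicator {0..r} s *\<^sub>R ((r - s) * g s)))"
      by (rule Bochner_Integration.integral_cong) (use True in \<open>auto simp: F_def indicator_def\<close>)
    also have "\<dots> = \<psi>2 r * (\<eta> r - (\<alpha> + \<gamma> * r))"
      using eta[of r] True ab by (simp add: set_lebesgue_integral_def)
    finally show ?thesis using True by simp
  qed (simp add: F_def)
  have "(LBINT s:{0<..<1}. g s * \<psi> s) = (LBINT s. LBINT r. F (s, r))"
    unfolding set_lebesgue_integral_def
  proof (rule integral_cong_AE)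
    show "AE s in lborel. indicat_real {0<..<1} s *\<^sub>R (g s * \<psi> s) = (LBINT r. F (s, r))"
      using AE_lborel_singleton[of 0]
    proof eventually_elim
      case (elim s)
      show ?case
      proof (cases "s \<in> {0..b}")
        case True
        have "(LBINT r. F (s, r)) = (LBINT r. g s * (indicator {s..1} r *\<^sub>R ((r - s) * \<psi>2 r)))"
          by (rule Bochner_Integration.integral_cong) (use True ab z(3) in \<open>auto simp: F_def indicator_def\<close>)
        also have "\<dots> = g s * \<psi> s"
          using taylor[of s] True ab by (simp add: set_lebesgue_integral_def)
        finally show ?thesis using True elim ab by simp
      next
        case False
        thus ?thesis using z(1)[of s] by (cases "s < 0") (auto simp: F_def indicator_def)
      qed
    qed
    show "(\<lambda>s. LBINT r. F (s, r)) \<in> borel_measurable lborel"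
      unfolding F_def by measurable
  qed simp
  also have "\<dots> = (LBINT r. LBINT s. F (s, r))"
    using lborel_pair.Fubini_integral[of "\<lambda>s r. F (s, r)"] Fi by simp
  also have "\<dots> = (LBINT r. (indicator {0..b} r *\<^sub>R (\<psi>2 r * (\<eta> r - (\<alpha> + \<gamma> * r)))))"
    unfolding inner ..
  finally have 1: "(LBINT s:{0<..<1}. g s * \<psi> s) = (LBINT r. (indicator {0..b} r *\<^sub>R (\<psi>2 r * (\<eta> r - (\<alpha> + \<gamma> * r)))))"
    (is "_ = integral\<^sup>L lborel ?H") .
  have Hi: "integrable lborel ?H"
    using lborel_pair.integrable_snd[of "\<lambda>s r. F (s, r)"] Fi unfolding inner by simp
  have Ai: "integrable lborel (\<lambda>r. indicator {0..1} r *\<^sub>R ((\<alpha> + \<gamma> * r) * \<psi>2 r))"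
    unfolding set_integrable_def[symmetric]
    by (intro borel_integrable_atLeastAtMost' continuous_intros cs)
  have "(LBINT s:{0<..<1}. \<eta> s * \<psi>2 s) = (LBINT r. ?H r + indicator {0..1} r *\<^sub>R ((\<alpha> + \<gamma> * r) * \<psi>2 r))"
    unfolding set_lebesgue_integral_def
    by (rule Bochner_Integration.integral_cong) (use z(3) ab in \<open>auto simp: indicator_def algebra_simps\<close>)
  also have "\<dots> = integral\<^sup>L lborel ?H"
    using aff Hi Ai by (subst Bochner_Integration.integral_add) (auto simp: set_lebesgue_integral_def)
  finally show "(LBINT s:{0<..<1}. \<eta> s * (deriv ^^ 2) \<psi> s) = (LBINT s:{0<..<1}. g s * \<psi> s)"
    using 1 by (simp add: numeral_2_eq_2 \<psi>2_def)
qed fact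

section \<open>Locally Lipschitz functions are integrals\<close>

text \<open>The homeomorphism \<open>F\<close> carries null sets to null sets because it is Lipschitz, so the measure
\<open>A \<mapsto> |F(A)|\<close>, which is the image of Lebesgue measure under the inverse of \<open>F\<close>, has a density by the
Radon-Nikodym theorem. Expansiveness makes the inverse globally defined and continuous.\<close>

lemma expansive_lipschitz_density:
  fixes F :: "real \<Rightarrow> real"
  assumes lo: "\<And>x y. x \<le> y \<Longrightarrow> y - x \<le> F y - F x"
    and up: "\<And>x y. x \<le> y \<Longrightarrow> F y - F x \<le> C * (y - x)"
  shows "\<exists>\<rho>\<in>borel_measurable borel. \<forall>l u. l \<le> u \<longrightarrow>
    emeasure (density lborel \<rho>) {l<..<u} = ennreal (F u - F l)"
proof -
  have lip: "\<bar>F x - F y\<bar> \<le> C * \<bar>x - y\<bar>" for x y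
    using lo[of x y] lo[of y x] up[of x y] up[of y x] by (cases "x \<le> y") (auto simp: abs_if)
  have cont: "continuous_on S F" for S
  proof -
    have "C-lipschitz_on UNIV F"
      using lip lo[of 0 1] up[of 0 1] by (intro lipschitz_onI) (auto simp: dist_real_def)
    thus ?thesis using lipschitz_on_continuous_on continuous_on_subset by blast
  qed
  have less: "F x < F y \<longleftrightarrow> x < y" for x y
    using lo[of x y] lo[of y x] by (cases "x < y"; cases "y < x") auto
  have "\<exists>t. F t = y" for y
  proof -
    have "F (min 0 (y - F 0)) \<le> y" "y \<le> F (max 0 (y - F 0))"
      using lo[of 0 "y - F 0"] lo[of "y - F 0" 0] by (auto simp: min_def max_def)
    thus ?thesis using IVT'[of F "min 0 (y - F 0)" y "max 0 (y - F 0)", OF _ _ _ cont]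
      by (meson max.cobounded1 min.cobounded1 order.trans)
  qed
  then obtain G where FG: "\<And>x. F (G x) = x" by metis
  have inj: "F x = F y \<Longrightarrow> x = y" for x y using less[of x y] less[of y x] by auto
  hence GF: "G (F x) = x" for x using FG by blast
  have "\<bar>G x - G y\<bar> \<le> \<bar>x - y\<bar>" for x y
    using lo[of "G x" "G y"] lo[of "G y" "G x"] FG[of x] FG[of y] by (cases "G x \<le> G y") auto
  hence "1-lipschitz_on UNIV G" by (intro lipschitz_onI) (auto simp: dist_real_def)
  hence Gm[measurable]: "G \<in> borel_measurable borel"
    by (intro borel_measurable_continuous_onI lipschitz_on_continuous_on)
  have vim: "G -` A = F ` A" for A using FG GF by (metis (no_types, opaque_lifting) image_iff set_eq_iff vimage_eq)
  define N where "N = distr lborel borel G"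
  have sN: "sets N = sets lborel" by (simp add: N_def)
  have "absolutely_continuous lborel N"
    unfolding absolutely_continuous_def
  proof
    fix A assume A: "A \<in> null_sets (lborel :: real measure)"
    hence Ab[measurable]: "A \<in> sets borel" by auto
    have "negligible A" using A negligible_iff_null_sets null_sets_completionI by blast
    hence "negligible (F ` A)"
      by (rule negligible_locally_Lipschitz_image[rotated]) (use lip in \<open>auto intro!: exI[of _ UNIV] exI[of _ C]\<close>)
    hence "F ` A \<in> null_sets lebesgue" by (simp add: negligible_iff_null_sets)
    moreover have "F ` A \<in> sets lborel" using measurable_sets_borel[OF Gm Ab] by (simp add: vim)
    ultimately have "F ` A \<in> null_sets lborel" by (simp add: null_sets_completion_iff)
    hence "emeasure N A = 0" by (simp add: N_def emeasure_distr vim null_setsD1)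
    thus "A \<in> null_sets N" using Ab by (simp add: null_sets_def N_def)
  qed
  from sigma_finite_measure.Radon_Nikodym[OF lborel.sigma_finite_measure_axioms this sN] obtain \<rho> where \<rho>: "\<rho> \<in> borel_measurable lborel" "density lborel \<rho> = N" by blast
  have "emeasure N {l<..<u} = ennreal (F u - F l)" if "l \<le> u" for l u
  proof -
    have "G -` {l<..<u} = {F l<..<F u}"
      using FG less by (auto simp: vimage_def set_eq_iff) (metis FG less)+
    moreover have "F l \<le> F u" using lo[OF that] that by simp
    ultimately show ?thesis by (simp add: N_def emeasure_distr)
  qed
  thus ?thesis using \<rho> by auto
qed

text \<open>Both \<open>(L + 1) t + f(t)\<close> and \<open>(L + 1) t - f(t)\<close> are expansive and Lipschitz. Their densities add up to
\<open>2 (L + 1)\<close>, which bounds each of them; a density of \<open>f\<close> is that of the first function minus \<open>L + 1\<close>.\<close>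

lemma lipschitz_density:
  fixes f :: "real \<Rightarrow> real"
  assumes lip: "\<And>x y. \<bar>f x - f y\<bar> \<le> L * \<bar>x - y\<bar>"
  obtains g where "g \<in> borel_measurable borel" "\<And>x. \<bar>g x\<bar> \<le> L + 1"
    "\<And>a b. a \<le> b \<Longrightarrow> (LBINT s:{a..b}. g s) = f b - f a"
proof -
  define D where "D = 2 * (L + 1)"
  have L: "L \<ge> 0" using lip[of 1 0] by simp
  hence D: "D > 0" by (simp add: D_def)
  have lip': "\<bar>f y - f x\<bar> \<le> L * (y - x)" if "x \<le> y" for x y using lip[of y x] that by simp
  define F where "F = (\<lambda>t. (L + 1) * t + f t)"
  define F' where "F' = (\<lambda>t. (L + 1) * t - f t)"
  have "\<exists>\<rho>\<in>borel_measurable borel. \<forall>l u. l \<le> u \<longrightarrow>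
    emeasure (density lborel \<rho>) {l<..<u} = ennreal (F u - F l)"
  proof (rule expansive_lipschitz_density[of _ D])
    fix x y :: real assume xy: "x \<le> y"
    show "y - x \<le> F y - F x" "F y - F x \<le> D * (y - x)"
      using lip'[OF xy] xy by (simp_all add: F_def D_def algebra_simps abs_le_iff)
  qed
  then obtain r where [measurable]: "r \<in> borel_measurable borel"
    and r: "\<And>l u. l \<le> u \<Longrightarrow> (\<integral>\<^sup>+x. r x * indicator {l<..<u} x \<partial>lborel) = ennreal (F u - F l)"
    by (auto simp: emeasure_density)
  have "\<exists>\<rho>\<in>borel_measurable borel. \<forall>l u. l \<le> u \<longrightarrow>
    emeasure (density lborel \<rho>) {l<..<u} = ennreal (F' u - F' l)"
  proof (rule expansive_lipschitz_density[of _ D])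
    fix x y :: real assume xy: "x \<le> y"
    show "y - x \<le> F' y - F' x" "F' y - F' x \<le> D * (y - x)"
      using lip'[OF xy] xy by (simp_all add: F'_def D_def algebra_simps abs_le_iff)
  qed
  then obtain r' where [measurable]: "r' \<in> borel_measurable borel"
    and r': "\<And>l u. l \<le> u \<Longrightarrow> (\<integral>\<^sup>+x. r' x * indicator {l<..<u} x \<partial>lborel) = ennreal (F' u - F' l)"
    by (auto simp: emeasure_density)
  have FF: "F l \<le> F u" "F' l \<le> F' u" if "l \<le> u" for l u
    using lip'[OF that] that by (auto simp: F_def F'_def algebra_simps abs_le_iff)
  \<comment> \<open>The normalized sum is a density of Lebesgue measure itself, hence is \<open>1\<close> almost everywhere.\<close>
  define q where "q = (\<lambda>s. (r s + r' s) * ennreal (1 / D))"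
  have "lborel = density lborel q"
  proof (rule lborel_eqI)
    fix l u :: real assume "\<And>b. b \<in> Basis \<Longrightarrow> l \<bullet> b \<le> u \<bullet> b"
    hence lu: "l \<le> u" by simp
    have "emeasure (density lborel q) (box l u) = (\<integral>\<^sup>+x. (r x * indicator {l<..<u} x + r' x * indicator {l<..<u} x) * ennreal (1 / D) \<partial>lborel)"
      by (simp add: emeasure_density q_def box_real algebra_simps)
    also have "\<dots> = (ennreal (F u - F l) + ennreal (F' u - F' l)) * ennreal (1 / D)"
      by (simp add: nn_integral_multc nn_integral_add r r' lu)
    also have "\<dots> = ennreal ((F u - F l + (F' u - F' l)) * (1 / D))"
      using FF[OF lu] D by (simp add: ennreal_plus[symmetric] ennreal_mult[symmetric] del: ennreal_plus)
    also have "(F u - F l + (F' u - F' l)) * (1 / D) = u - l"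
      using D by (simp add: F_def F'_def D_def field_simps)
    finally show "emeasure (density lborel q) (box l u) = ennreal (\<Prod>b\<in>Basis. (u - l) \<bullet> b)" by simp
  qed (simp add: q_def)
  hence "density lborel (\<lambda>_. 1) = density lborel q" by (simp add: density_1)
  hence "AE x in lborel. 1 = q x"
    by (subst (asm) sigma_finite_measure.density_unique_iff[OF lborel.sigma_finite_measure_axioms]) (auto simp: q_def)
  hence AE: "AE x in lborel. r x \<le> ennreal D"
  proof eventually_elim
    case (elim x)
    have "(r x + r' x) * ennreal (1 / D) * ennreal D = ennreal D" using elim by (simp add: q_def)
    moreover have "ennreal (1 / D) * ennreal D = 1"
      using D by (simp add: ennreal_mult[symmetric])
    ultimately have "r x + r' x = ennreal D" by (simp add: mult.assoc)
    thus ?case by (metis le_iff_add)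
  qed
  \<comment> \<open>The truncation changes the density on a null set only and makes the bound hold everywhere.\<close>
  define g where "g = (\<lambda>s. max (-(L+1)) (min (L+1) (enn2real (r s) - (L + 1))))"
  have geq: "AE x in lborel. g x = enn2real (r x) - (L + 1) \<and> r x = ennreal (enn2real (r x))"
    using AE
  proof eventually_elim
    case (elim x)
    have "enn2real (r x) \<le> 2 * (L + 1)" using elim D by (simp add: enn2real_leI D_def)
    hence "g x = enn2real (r x) - (L + 1)"
      using L enn2real_nonneg[of "r x"] unfolding g_def by (simp add: min_def max_def)
    moreover have "r x < \<infinity>" using elim by (metis ennreal_less_top infinity_ennreal_def le_less_trans)
    ultimately show ?case by simp
  qed
  have int: "(LBINT s:{a..b}. g s) = f b - f a" if ab: "a \<le> b" for a b
  proof -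
    have nn: "(\<integral>\<^sup>+x. ennreal (indicator {a<..<b} x *\<^sub>R enn2real (r x)) \<partial>lborel) = ennreal (F b - F a)"
      unfolding r[OF ab, symmetric]
      by (rule nn_integral_cong_AE) (use geq in eventually_elim, auto simp: indicator_def)
    have i1: "integrable lborel (\<lambda>x. indicator {a<..<b} x *\<^sub>R enn2real (r x))"
      by (rule integrableI_nonneg) (use nn in auto)
    have e1: "(LBINT x. indicator {a<..<b} x *\<^sub>R enn2real (r x)) = F b - F a"
      by (subst integral_eq_nn_integral) (use nn FF[OF ab] in auto)
    have i2: "integrable lborel (\<lambda>x. indicator {a..b} x *\<^sub>R (L + 1))"
      using borel_integrable_atLeastAtMost'[of a b "\<lambda>_. L + 1"] by (simp add: set_integrable_def)
    have "(LBINT s:{a..b}. g s) = (LBINT x. indicator {a<..<b} x *\<^sub>R enn2real (r x) - indicator {a..b} x *\<^sub>R (L + 1))"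
      unfolding set_lebesgue_integral_def
    proof (rule integral_cong_AE)
      show "AE x in lborel. indicat_real {a..b} x *\<^sub>R g x = indicat_real {a<..<b} x *\<^sub>R enn2real (r x) - indicat_real {a..b} x *\<^sub>R (L + 1)"
        using geq AE_lborel_singleton[of a] AE_lborel_singleton[of b]
        by eventually_elim (auto simp: indicator_def)
    qed (simp_all add: g_def)
    also have "\<dots> = (F b - F a) - (LBINT x:{a..b}. L + 1)"
      unfolding set_lebesgue_integral_def by (subst Bochner_Integration.integral_diff[OF i1 i2]) (simp add: e1[simplified real_scaleR_def])
    also have "\<dots> = f b - f a" using ab by (subst set_integral_const) (auto simp: F_def algebra_simps)
    finally show ?thesis .
  qed
  show thesis by (rule that[of g, OF _ _ int]) (use L in \<open>auto simp: g_def abs_le_iff min_def max_def\<close>)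
qed

lemma local_lipschitz_on_compactD:
  fixes f :: "real \<Rightarrow> real"
  assumes "locally_lipschitz_on S f" "compact K" "K \<subseteq> S"
  obtains L where "L-lipschitz_on K f"
proof -
  have "local_lipschitz {0::real} S (\<lambda>_. f)"
    using assms(1) unfolding locally_lipschitz_on_def local_lipschitz_def by simp blast
  hence "local_lipschitz {0::real} K (\<lambda>_. f)" using assms(3) by (rule local_lipschitz_subset[OF _ order.refl])
  from local_lipschitz_compact_implies_lipschitz[OF this assms(2)] that show ?thesis by auto
qed

text \<open>The previous lemma applies to the function that equals \<open>\<eta>'\<close> on \<open>[0, B n]\<close> and is constant outside,
where \<open>B n\<close> increases to \<open>1\<close>. The densities obtained in this way agree almost everywhere where they
overlap, so they glue to one density on \<open>[0, 1)\<close>.\<close>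

lemma spaceX_deriv1_density:
  assumes "\<eta> \<in> spaceX"
  shows "\<exists>g\<in>borel_measurable borel. locally_ess_bounded g \<and>
    (\<forall>t\<in>{0..<1}. deriv1 \<eta> t = deriv1 \<eta> 0 + (LBINT s:{0..t}. g s))"
proof -
  define f where "f = deriv1 \<eta>"
  define B :: "nat \<Rightarrow> real" where "B = (\<lambda>n. 1 - 1 / (real n + 2))"
  have B: "0 < B n" "B n < 1" for n by (auto simp: B_def)
  have Bmono: "B m \<le> B n" if "m \<le> n" for m n
    using that by (auto simp: B_def intro!: divide_left_mono)
  have Bex: "\<exists>n. t < B n" if "t < 1" for t
  proof -
    have "B \<longlonglongrightarrow> 1" unfolding B_def by real_asymp
    from order_tendstoD(1)[OF this that] show ?thesis by (auto simp: eventually_sequentially)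
  qed
  have "\<exists>g L. g \<in> borel_measurable borel \<and> (\<forall>x. \<bar>g x\<bar> \<le> L) \<and>
     (\<forall>a b. 0 \<le> a \<longrightarrow> a \<le> b \<longrightarrow> b \<le> B n \<longrightarrow> (LBINT s:{a..b}. g s) = f b - f a)" for n
  proof -
    have "locally_lipschitz_on {0..<1} f" using assms by (simp add: spaceX_def f_def)
    moreover have "{0..B n} \<subseteq> {0..<1}" using B(2)[of n] by auto
    ultimately obtain L where L: "L-lipschitz_on {0..B n} f"
      using local_lipschitz_on_compactD compact_Icc by blast
    define h where "h = (\<lambda>x. f (max 0 (min (B n) x)))"
    have "\<bar>h x - h y\<bar> \<le> L * \<bar>x - y\<bar>" for x y
    proof -
      have "\<bar>h x - h y\<bar> \<le> L * \<bar>max 0 (min (B n) x) - max 0 (min (B n) y)\<bar>"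
        using lipschitz_onD[OF L, of "max 0 (min (B n) x)" "max 0 (min (B n) y)"] B(1)[of n]
        by (simp add: h_def dist_real_def)
      also have "\<dots> \<le> L * \<bar>x - y\<bar>" using lipschitz_on_nonneg[OF L] by (intro mult_left_mono) auto
      finally show ?thesis .
    qed
    from lipschitz_density[OF this] obtain g where "g \<in> borel_measurable borel" "\<And>x. \<bar>g x\<bar> \<le> L + 1"
      "\<And>a b. a \<le> b \<Longrightarrow> (LBINT s:{a..b}. g s) = h b - h a" by blast
    moreover from this have "\<forall>a b. 0 \<le> a \<longrightarrow> a \<le> b \<longrightarrow> b \<le> B n \<longrightarrow> (LBINT s:{a..b}. g s) = f b - f a"
      by (auto simp: h_def)
    ultimately show ?thesis by blast
  qed
  then obtain G L where G[measurable]: "\<And>n. G n \<in> borel_measurable borel" and L: "\<And>n x. \<bar>G n x\<bar> \<le> L n"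
    and int: "\<And>n a b. 0 \<le> a \<Longrightarrow> a \<le> b \<Longrightarrow> b \<le> B n \<Longrightarrow> (LBINT s:{a..b}. G n s) = f b - f a"
    by metis
  have Gi: "set_integrable lborel A (G n)" if "A \<subseteq> {a..b}" "A \<in> sets borel" for A n a b
    by (rule set_integrable_ess_bounded[of _ a b "L n"]) (use L that in auto)
  have int': "(LBINT s:{a<..<b}. G n s) = f b - f a" if "0 \<le> a" "a \<le> b" "b \<le> B n" for n a b
  proof -
    have "(LBINT s:{a<..<b}. G n s) = (LBINT s:{a..b}. G n s)"
      unfolding set_lebesgue_integral_def
      by (rule integral_cong_AE) (use AE_lborel_singleton[of a] AE_lborel_singleton[of b] in
        \<open>auto elim!: eventually_elim2 simp: indicator_def\<close>)
    thus ?thesis using int[OF that] by simp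
  qed
  have agree: "AE s in lborel. s \<in> {0<..<B m} \<longrightarrow> G m s - G n s = 0" if mn: "m \<le> n" for m n
  proof (rule AE_zero_if_interval_integrals_zero)
    show "set_integrable lborel {0<..<B m} (\<lambda>s. G m s - G n s)"
      by (intro set_integral_diff Gi[of _ 0 "B m"]) auto
    fix c d assume cd: "0 \<le> c" "c \<le> d" "d \<le> B m"
    have "(LBINT y:{c<..<d}. G m y - G n y) = (LBINT y:{c<..<d}. G m y) - (LBINT y:{c<..<d}. G n y)"
      by (intro set_integral_diff Gi[of _ c d]) auto
    thus "(LBINT y:{c<..<d}. G m y - G n y) = 0"
      using int'[OF cd] int'[of c d n] cd Bmono[OF mn] by simp
  qed
  \<comment> \<open>At \<open>s\<close> use the density of the first interval that contains \<open>s\<close>.\<close>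
  define N where "N = (\<lambda>s. LEAST n. s < B n)"
  define g where "g = (\<lambda>s. G (N s) s)"
  have [measurable]: "N \<in> measurable borel (count_space UNIV)"
    unfolding N_def by measurable
  have [measurable]: "g \<in> borel_measurable borel"
    unfolding g_def by (rule measurable_compose_countable[OF _ \<open>N \<in> _\<close>]) simp
  have "AE s in lborel. \<forall>m n. m \<le> n \<longrightarrow> s \<in> {0<..<B m} \<longrightarrow> G m s - G n s = 0"
    using agree by (auto simp: AE_all_countable)
  hence gG: "AE s in lborel. s \<in> {0..B n} \<longrightarrow> g s = G n s" for n
    using AE_lborel_singleton[of 0] AE_lborel_singleton[of "B n"]
  proof eventually_elim
    case (elim s)
    show ?case
    proof
      assume s: "s \<in> {0..B n}"
      hence "s < B n" using elim by auto
      hence "s < B (N s)" "N s \<le> n"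
        unfolding N_def using LeastI[of "\<lambda>n. s < B n" n] Least_le[of "\<lambda>n. s < B n" n] by auto
      thus "g s = G n s" using elim s by (auto simp: g_def)
    qed
  qed
  have "locally_ess_bounded g"
    unfolding locally_ess_bounded_def
  proof (intro allI impI)
    fix \<delta> :: real assume "\<delta> > 0"
    then obtain n where n: "1 - \<delta> < B n" using Bex[of "1 - \<delta>"] by auto
    have "AE s in lborel. s \<in> {0..1 - \<delta>} \<longrightarrow> \<bar>g s\<bar> \<le> L n"
      using gG[of n] by eventually_elim (use L[of n] n in auto)
    thus "\<exists>C. AE s in lborel. s \<in> {0..1 - \<delta>} \<longrightarrow> \<bar>g s\<bar> \<le> C" by blast
  qed
  moreover have "f t = f 0 + (LBINT s:{0..t}. g s)" if t: "t \<in> {0..<1}" for t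
  proof -
    obtain n where n: "t < B n" using Bex[of t] t by auto
    have "(LBINT s:{0..t}. g s) = (LBINT s:{0..t}. G n s)"
      by (rule set_lebesgue_integral_cong_AE) (use gG[of n] n in \<open>auto elim!: eventually_mono\<close>)
    thus ?thesis using int[of 0 t n] t n by simp
  qed
  ultimately show ?thesis
    unfolding f_def by (intro bexI[of _ g] conjI ballI) (assumption | simp)+
qed

lemma iterated_integral_Icc:
  fixes g :: "real \<Rightarrow> real"
  assumes [measurable]: "g \<in> borel_measurable borel" and gi: "set_integrable lborel {0..r} g" and r: "0 \<le> r"
  shows "(LBINT t:{0..r}. (LBINT s:{0..t}. g s)) = (LBINT s:{0..r}. (r - s) * g s)"
    and "set_integrable lborel {0..r} (\<lambda>t. LBINT s:{0..t}. g s)"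
proof -
  define F where "F = (\<lambda>(s, t). indicator {0..r} s * g s * (indicator {0..r} t * (if s \<le> t then 1 else 0 :: real)))"
  have Fi: "integrable (lborel \<Otimes>\<^sub>M lborel) F"
  proof (rule integrable_pair_dominated)
    show "integrable lborel (\<lambda>s. \<bar>indicator {0..r} s * g s\<bar>)" using gi by (simp add: set_integrable_def)
    show "integrable lborel (indicat_real {0..r})"
      using borel_integrable_atLeastAtMost'[of 0 r "\<lambda>_. 1::real"] by (simp add: set_integrable_def)
    show "\<bar>F (s, t)\<bar> \<le> \<bar>indicat_real {0..r} s * g s\<bar> * indicat_real {0..r} t" for s t
      unfolding F_def by (auto simp: indicator_def)
    show "F \<in> borel_measurable (lborel \<Otimes>\<^sub>M lborel)" unfolding F_def by measurable
  qed
  have 1: "(LBINT s. F (s, t)) = indicator {0..r} t *\<^sub>R (LBINT s:{0..t}. g s)" for t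
  proof (cases "t \<in> {0..r}")
    case True
    have "(LBINT s. F (s, t)) = (LBINT s:{0..t}. g s)"
      unfolding set_lebesgue_integral_def
      by (rule Bochner_Integration.integral_cong) (use True in \<open>auto simp: F_def indicator_def\<close>)
    thus ?thesis using True by simp
  qed (simp add: F_def)
  have 2: "(LBINT t. F (s, t)) = indicator {0..r} s *\<^sub>R ((r - s) * g s)" for s
  proof (cases "s \<in> {0..r}")
    case True
    have "(LBINT t. F (s, t)) = (LBINT t:{s..r}. g s)"
      unfolding set_lebesgue_integral_def
      by (rule Bochner_Integration.integral_cong) (use True in \<open>auto simp: F_def indicator_def\<close>)
    also have "\<dots> = (r - s) * g s"
      using True by (subst set_integral_const) auto
    finally show ?thesis using True by simp
  qed (simp add: F_def)
  show "(LBINT t:{0..r}. (LBINT s:{0..t}. g s)) = (LBINT s:{0..r}. (r - s) * g s)"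
    using lborel_pair.Fubini_integral[of "\<lambda>s t. F (s, t)"] Fi by (simp add: 1 2 set_lebesgue_integral_def)
  show "set_integrable lborel {0..r} (\<lambda>t. LBINT s:{0..t}. g s)"
    using lborel_pair.integrable_snd[of "\<lambda>s t. F (s, t)"] Fi by (simp add: 1 set_integrable_def)
qed

lemma spaceX_has_vector_derivative:
  assumes "\<eta> \<in> spaceX" "t \<in> {0..<1}"
  shows "(\<eta> has_vector_derivative deriv1 \<eta> t) (at t within {0..<1})"
  using assms unfolding spaceX_def deriv1_def differentiable_on_def by (auto simp: vector_derivative_works)

text \<open>Integrating \<open>\<eta>'\<close> once more and exchanging the order of integration gives the double integral
representation, and with it a distributional second derivative.\<close>

lemma spaceX_representation:
  assumes eta: "\<eta> \<in> spaceX"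
  shows "\<exists>g. is_distr_deriv2 \<eta> g \<and>
    (\<forall>r\<in>{0..<1}. \<eta> r = \<eta> 0 + deriv1 \<eta> 0 * r + (LBINT s:{0..r}. (r - s) * g s))"
proof -
  obtain g where g[measurable]: "g \<in> borel_measurable borel" and leb: "locally_ess_bounded g"
    and d: "\<And>t. t \<in> {0..<1} \<Longrightarrow> deriv1 \<eta> t = deriv1 \<eta> 0 + (LBINT s:{0..t}. g s)"
    using spaceX_deriv1_density[OF eta] by blast
  have rep: "\<eta> r = \<eta> 0 + deriv1 \<eta> 0 * r + (LBINT s:{0..r}. (r - s) * g s)" if r: "r \<in> {0..<1}" for r
  proof -
    have gi: "set_integrable lborel {0..r} g"
      by (rule set_integrable_locally_ess_bounded[OF g leb, of r]) (use r in auto)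
    have "\<eta> r - \<eta> 0 = (LBINT t:{0..r}. deriv1 \<eta> t)"
      unfolding set_lebesgue_integral_def
    proof (rule integral_FTC_atLeastAtMost[symmetric])
      show "(\<eta> has_vector_derivative deriv1 \<eta> x) (at x within {0..r})" if "0 \<le> x" "x \<le> r" for x
        using spaceX_has_vector_derivative[OF eta, of x] that r
        by (auto intro: has_vector_derivative_within_subset)
      show "continuous_on {0..r} (deriv1 \<eta>)"
        using eta r unfolding spaceX_def by (auto intro: continuous_on_subset)
    qed (use r in simp)
    also have "\<dots> = (LBINT t:{0..r}. deriv1 \<eta> 0 + (LBINT s:{0..t}. g s))"
    proof (rule set_lebesgue_integral_cong)
      show "\<forall>x. x \<in> {0..r} \<longrightarrow> deriv1 \<eta> x = deriv1 \<eta> 0 + (LBINT s:{0..x}. g s)"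
        by (intro allI impI, rule d) (use r in auto)
    qed simp
    also have "\<dots> = (LBINT t:{0..r}. deriv1 \<eta> 0) + (LBINT t:{0..r}. (LBINT s:{0..t}. g s))"
      by (rule set_integral_add)
        (use iterated_integral_Icc(2)[OF g gi] r borel_integrable_atLeastAtMost'[of 0 r "\<lambda>_. deriv1 \<eta> 0"] in auto)
    also have "(LBINT t:{0..r}. deriv1 \<eta> 0) = deriv1 \<eta> 0 * r"
      using r by (subst set_integral_const) auto
    finally show ?thesis using iterated_integral_Icc(1)[OF g gi] r by simp
  qed
  have "is_distr_deriv2 \<eta> g" by (rule is_distr_deriv2I[OF g leb rep])
  thus ?thesis using rep by blast
qed

lemma deriv2_is_distr_deriv2:
  assumes "is_distr_deriv2 \<eta> g"
  shows "is_distr_deriv2 \<eta> (deriv2 \<eta>)" "AE s in lborel. s \<in> {0..1} \<longrightarrow> deriv2 \<eta> s = g s"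
proof -
  show *: "is_distr_deriv2 \<eta> (deriv2 \<eta>)" 
    unfolding deriv2_def by (rule someI[where P = "is_distr_deriv2 \<eta>", OF assms])
  show "AE s in lborel. s \<in> {0..1} \<longrightarrow> deriv2 \<eta> s = g s" by (rule is_distr_deriv2_unique[OF * assms])
qed

lemma spaceX_deriv2:
  assumes eta: "\<eta> \<in> spaceX"
  shows "deriv2 \<eta> \<in> borel_measurable borel" "locally_ess_bounded (deriv2 \<eta>)"
    "\<And>r. r \<in> {0..<1} \<Longrightarrow> \<eta> r = \<eta> 0 + deriv1 \<eta> 0 * r + (LBINT s:{0..r}. (r - s) * deriv2 \<eta> s)"
proof -
  obtain g where g: "is_distr_deriv2 \<eta> g"
    and rep: "\<And>r. r\<in>{0..<1} \<Longrightarrow> \<eta> r = \<eta> 0 + deriv1 \<eta> 0 * r + (LBINT s:{0..r}. (r - s) * g s)"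
    using spaceX_representation[OF eta] by blast
  have [measurable]: "g \<in> borel_measurable borel" using g by (simp add: is_distr_deriv2_def)
  note d2 = deriv2_is_distr_deriv2[OF g]
  show [measurable]: "deriv2 \<eta> \<in> borel_measurable borel" and "locally_ess_bounded (deriv2 \<eta>)"
    using d2(1) by (auto simp: is_distr_deriv2_def locally_ess_bounded_def)
  show "\<eta> r = \<eta> 0 + deriv1 \<eta> 0 * r + (LBINT s:{0..r}. (r - s) * deriv2 \<eta> s)" if r: "r \<in> {0..<1}" for r
  proof -
    have "(LBINT s:{0..r}. (r - s) * deriv2 \<eta> s) = (LBINT s:{0..r}. (r - s) * g s)"
      by (rule set_lebesgue_integral_cong_AE) (use d2(2) r in \<open>auto elim!: eventually_mono\<close>)
    thus ?thesis using rep[OF r] by simp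
  qed
qed

section \<open>Probability measures on the unit interval and the function phi\<close>

lemma Pr01D:
  assumes "\<mu> \<in> Pr01"
  shows "prob_space \<mu>" "sets \<mu> = sets (restrict_space borel {0..1})" "space \<mu> = {0..1}"
  using assms sets_eq_imp_space_eq[of \<mu> "restrict_space borel {0..1}"]
  by (auto simp: Pr01_def space_restrict_space)

lemma Pr01_in_sets: "\<mu> \<in> Pr01 \<Longrightarrow> A \<in> sets borel \<Longrightarrow> A \<subseteq> {0..1} \<Longrightarrow> A \<in> sets \<mu>"
  using Pr01D(2) by (auto simp: sets_restrict_space_iff)

lemma Pr01_measurable: "\<mu> \<in> Pr01 \<Longrightarrow> f \<in> borel_measurable borel \<Longrightarrow> f \<in> borel_measurable \<mu>"
  using measurable_restrict_space1[of f borel _ "{0..1::real}"] measurable_cong_sets[OF Pr01D(2) refl] by blast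

lemma Pr01_measurable_id: "\<mu> \<in> Pr01 \<Longrightarrow> (\<lambda>r. r) \<in> measurable \<mu> borel"
  by (rule Pr01_measurable) auto

lemma Pr01_integrable:
  fixes f :: "real \<Rightarrow> real"
  assumes mu: "\<mu> \<in> Pr01" and f: "f \<in> borel_measurable borel" and B: "\<And>r. r \<in> {0..1} \<Longrightarrow> \<bar>f r\<bar> \<le> B"
  shows "integrable \<mu> f"
proof -
  interpret prob_space \<mu> by (rule Pr01D[OF mu])
  show ?thesis
    by (rule integrable_const_bound[of _ B]) (use Pr01_measurable[OF mu f] B Pr01D(3)[OF mu] in auto)
qed

text \<open>By Fubini, \<open>phi \<mu> t\<close> is the \<open>\<mu>\<close>-mean of \<open>1 - max r t\<close> for \<open>t\<close> in the unit interval. The mean is affine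
in \<open>\<mu>\<close>, is visibly continuous under weak convergence, and is Lipschitz on the whole line, hence
measurable without reference to an interval.\<close>

definition cphi :: "real measure \<Rightarrow> real \<Rightarrow> real" where
  "cphi \<mu> t = (LINT r|\<mu>. 1 - max r t)"

context
  fixes \<mu> assumes mu: "\<mu> \<in> Pr01"
begin

interpretation prob_space \<mu> by (rule Pr01D[OF mu])

lemma cphi_integrable: "integrable \<mu> (\<lambda>r. 1 - max r t)"
  by (rule Pr01_integrable[OF mu, of _ "1 + \<bar>t\<bar>"]) auto

lemma cphi_antimono: "s \<le> t \<Longrightarrow> cphi \<mu> t \<le> cphi \<mu> s"
  unfolding cphi_def by (intro integral_mono cphi_integrable) auto

lemma cphi_lipschitz: "s \<le> t \<Longrightarrow> cphi \<mu> s - cphi \<mu> t \<le> t - s"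
proof -
  assume st: "s \<le> t"
  have "cphi \<mu> s - cphi \<mu> t = (LINT r|\<mu>. (1 - max r s) - (1 - max r t))"
    unfolding cphi_def by (rule Bochner_Integration.integral_diff[symmetric]; rule cphi_integrable)
  also have "\<dots> \<le> (LINT r|\<mu>. t - s)"
    using st by (intro integral_mono Bochner_Integration.integrable_diff cphi_integrable) auto
  finally show ?thesis by (simp add: prob_space)
qed

lemma cphi_continuous: "continuous_on S (cphi \<mu>)"
proof -
  have "\<bar>cphi \<mu> x - cphi \<mu> y\<bar> \<le> \<bar>x - y\<bar>" for x y
    using cphi_antimono[of x y] cphi_antimono[of y x] cphi_lipschitz[of x y] cphi_lipschitz[of y x]
    by (cases "x \<le> y") auto
  hence "1-lipschitz_on UNIV (cphi \<mu>)" by (intro lipschitz_onI) (auto simp: dist_real_def)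
  thus ?thesis using lipschitz_on_continuous_on continuous_on_subset by blast
qed

lemma cphi_measurable [measurable]: "cphi \<mu> \<in> borel_measurable borel"
  using cphi_continuous by (rule borel_measurable_continuous_onI)

lemma cphi_nonneg: "s \<le> 1 \<Longrightarrow> 0 \<le> cphi \<mu> s"
  unfolding cphi_def by (intro Bochner_Integration.integral_nonneg) (auto simp: Pr01D(3)[OF mu])

lemma cphi_le: "cphi \<mu> s \<le> 1 - s"
proof -
  have "cphi \<mu> s \<le> (LINT r|\<mu>. 1 - s)"
    unfolding cphi_def by (intro integral_mono cphi_integrable) auto
  thus ?thesis by (simp add: prob_space)
qed

lemma cphi_complement: "1 - s - cphi \<mu> s = (LINT r|\<mu>. max 0 (r - s))"
proof -
  have "1 - s - cphi \<mu> s = (LINT r|\<mu>. (1 - s) - (1 - max r s))"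
    unfolding cphi_def using cphi_integrable by (subst Bochner_Integration.integral_diff) (auto simp: prob_space)
  also have "\<dots> = (LINT r|\<mu>. max 0 (r - s))" by (rule Bochner_Integration.integral_cong) auto
  finally show ?thesis .
qed

lemma cphi_0: "(LINT r|\<mu>. r) = 1 - cphi \<mu> 0"
proof -
  have "(LINT r|\<mu>. r) = (LINT r|\<mu>. max 0 (r - 0))"
    by (rule Bochner_Integration.integral_cong) (auto simp: Pr01D(3)[OF mu])
  thus ?thesis using cphi_complement[of 0] by simp
qed

lemma measure_Icc_eq: "s \<in> {0..1} \<Longrightarrow> measure \<mu> {0..s} = (LINT r|\<mu>. (if r \<le> s then 1 else 0))"
proof -
  assume s: "s \<in> {0..1}"
  have "{0..s} \<in> sets \<mu>" by (rule Pr01_in_sets[OF mu]) (use s in auto)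
  hence "measure \<mu> {0..s} = (LINT r|\<mu>. indicator {0..s} r)" by simp
  also have "\<dots> = (LINT r|\<mu>. (if r \<le> s then 1 else 0))"
    by (rule Bochner_Integration.integral_cong) (auto simp: Pr01D(3)[OF mu] indicator_def)
  finally show ?thesis .
qed

lemma phi_eq_cphi:
  assumes t: "t \<in> {0..1}"
  shows "phi \<mu> t = cphi \<mu> t"
proof -
  note [measurable] = Pr01_measurable_id[OF mu]
  interpret P: pair_sigma_finite lborel \<mu> by unfold_locales
  define F where "F = (\<lambda>(s, r). indicator {t..1} s * (if r \<le> s then 1 else 0 :: real))"
  have Fm[measurable]: "F \<in> borel_measurable (lborel \<Otimes>\<^sub>M \<mu>)" unfolding F_def by measurable
  have i1: "integrable \<mu> (\<lambda>r. F (s, r))" for s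
    by (rule integrable_const_bound[of _ 1]) (auto simp: F_def indicator_def)
  have "integrable (lborel \<Otimes>\<^sub>M \<mu>) F"
  proof (rule P.Fubini_integrable[OF Fm])
    show "integrable lborel (\<lambda>s. LINT r|\<mu>. norm (F (s, r)))"
    proof (rule Bochner_Integration.integrable_bound)
      show "integrable lborel (\<lambda>s. indicat_real {t..1} s * 1)"
        using borel_integrable_atLeastAtMost'[of t 1 "\<lambda>_. 1::real"] by (simp add: set_integrable_def)
      show "AE s in lborel. norm (LINT r|\<mu>. norm (F (s, r))) \<le> norm (indicat_real {t..1} s * 1)"
      proof (intro AE_I2)
        fix s
        have "(LINT r|\<mu>. norm (F (s, r))) \<le> (LINT r|\<mu>. indicat_real {t..1} s)"
          by (intro integral_mono integrable_norm i1) (auto simp: F_def indicator_def)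
        thus "norm (LINT r|\<mu>. norm (F (s, r))) \<le> norm (indicat_real {t..1} s * 1)" by (simp add: prob_space)
      qed
    qed simp
  qed (use i1 in simp)
  hence fub: "(LINT r|\<mu>. (LBINT s. F (s, r))) = (LBINT s. (LINT r|\<mu>. F (s, r)))"
    using P.Fubini_integral[of "\<lambda>s r. F (s, r)"] by simp
  have "phi \<mu> t = (LBINT s. (LINT r|\<mu>. F (s, r)))"
    unfolding phi_def set_lebesgue_integral_def
  proof (rule Bochner_Integration.integral_cong)
    fix s show "indicat_real {t..1} s *\<^sub>R measure \<mu> {0..s} = (LINT r|\<mu>. F (s, r))"
      using t measure_Icc_eq[of s] by (cases "s \<in> {t..1}") (auto simp: F_def)
  qed simp
  also have "\<dots> = (LINT r|\<mu>. 1 - max r t)"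
    unfolding fub[symmetric]
  proof (rule Bochner_Integration.integral_cong)
    fix r assume "r \<in> space \<mu>"
    hence r: "r \<in> {0..1}" by (simp add: Pr01D(3)[OF mu])
    have "(LBINT s. F (s, r)) = (LBINT s. indicator {max r t..1} s)"
      by (rule Bochner_Integration.integral_cong) (auto simp: F_def indicator_def)
    also have "\<dots> = 1 - max r t" using r t by (simp add: max_def)
    finally show "(LBINT s. F (s, r)) = 1 - max r t" .
  qed simp
  finally show ?thesis by (simp add: cphi_def)
qed

end

text \<open>For \<open>g = \<eta>''\<close> this is the double integral \<open>\<eta>(r) - \<eta>(0) - \<eta>'(0) r\<close>, with the value at \<open>r = 1\<close> possibly
infinite.\<close>

definition wedge :: "(real \<Rightarrow> real) \<Rightarrow> real \<Rightarrow> ennreal" where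
  "wedge g r = (\<integral>\<^sup>+s\<in>{0..1}. ennreal (g s * max 0 (r - s)) \<partial>lborel)"

lemma wedge_measurable [measurable]:
  assumes [measurable]: "g \<in> borel_measurable borel"
  shows "wedge g \<in> borel_measurable borel"
proof -
  have "(\<lambda>(r, s). ennreal (g s * max 0 (r - s)) * indicator {0..1} s) \<in> borel_measurable (borel \<Otimes>\<^sub>M borel)"
    by measurable
  hence "(\<lambda>(r, s). ennreal (g s * max 0 (r - s)) * indicator {0..1} s) \<in> borel_measurable (borel \<Otimes>\<^sub>M lborel)"
    using measurable_cong_sets[OF sets_pair_measure_cong[OF refl sets_lborel] refl] by blast
  from lborel.borel_measurable_nn_integral[OF this] show ?thesis
    unfolding wedge_def[abs_def] by simp
qed

text \<open>Tonelli, together with the fact that \<open>1 - s - \<phi>(s)\<close> is the \<open>\<mu>\<close>-mean of \<open>max 0 (r - s)\<close>.\<close>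

lemma nn_integral_wedge:
  assumes mu: "\<mu> \<in> Pr01" and [measurable]: "g \<in> borel_measurable borel"
  shows "(\<integral>\<^sup>+r. wedge g r \<partial>\<mu>) = (\<integral>\<^sup>+s\<in>{0..1}. ennreal (g s * (1 - s - cphi \<mu> s)) \<partial>lborel)"
proof -
  interpret prob_space \<mu> by (rule Pr01D[OF mu])
  note [measurable] = Pr01_measurable_id[OF mu]
  interpret P: pair_sigma_finite lborel \<mu> by unfold_locales
  have "(\<integral>\<^sup>+r. wedge g r \<partial>\<mu>) =
    (\<integral>\<^sup>+s. (\<integral>\<^sup>+r. ennreal (g s * max 0 (r - s)) * indicator {0..1} s \<partial>\<mu>) \<partial>lborel)"
    unfolding wedge_def by (rule P.Fubini') measurable
  also have "\<dots> = (\<integral>\<^sup>+s\<in>{0..1}. ennreal (g s * (1 - s - cphi \<mu> s)) \<partial>lborel)"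
  proof (rule nn_integral_cong)
    fix s
    have "(\<integral>\<^sup>+r. ennreal (g s * max 0 (r - s)) * indicator {0..1} s \<partial>\<mu>)
       = ennreal (g s) * (\<integral>\<^sup>+r. ennreal (max 0 (r - s)) \<partial>\<mu>) * indicator {0..1} s"
      by (simp add: nn_integral_multc nn_integral_cmult ennreal_mult'')
    also have "(\<integral>\<^sup>+r. ennreal (max 0 (r - s)) \<partial>\<mu>) = ennreal (1 - s - cphi \<mu> s)"
      unfolding cphi_complement[OF mu]
      by (rule nn_integral_eq_integral) (auto intro!: Pr01_integrable[OF mu, of _ "1 + \<bar>s\<bar>"])
    also have "ennreal (g s) * ennreal (1 - s - cphi \<mu> s) = ennreal (g s * (1 - s - cphi \<mu> s))"
      using cphi_le[OF mu, of s] by (simp add: ennreal_mult'')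
    finally show "(\<integral>\<^sup>+r. ennreal (g s * max 0 (r - s)) * indicator {0..1} s \<partial>\<mu>)
      = ennreal (g s * (1 - s - cphi \<mu> s)) * indicator {0..1} s" .
  qed
  finally show ?thesis .
qed

lemma wedge_eq:
  assumes [measurable]: "g \<in> borel_measurable borel" and gi: "set_integrable lborel {0..r} g"
    and nn: "AE s in lborel. s \<in> {0..1} \<longrightarrow> 0 \<le> g s" and r: "0 \<le> r" "r \<le> 1"
  shows "wedge g r = ennreal (LBINT s:{0..r}. (r - s) * g s)" "0 \<le> (LBINT s:{0..r}. (r - s) * g s)"
proof -
  have "integrable lborel (\<lambda>s. indicator {0..r} s *\<^sub>R ((r - s) * g s))"
  proof (rule Bochner_Integration.integrable_bound)
    show "integrable lborel (\<lambda>s. indicator {0..r} s *\<^sub>R g s)" using gi by (simp add: set_integrable_def)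
    show "AE s in lborel. norm (indicat_real {0..r} s *\<^sub>R ((r - s) * g s)) \<le> norm (indicat_real {0..r} s *\<^sub>R g s)"
      using r by (intro AE_I2) (auto simp: indicator_def abs_mult mult_left_le_one_le)
  qed simp
  note i = this
  have ae: "AE s in lborel. 0 \<le> indicator {0..r} s *\<^sub>R ((r - s) * g s)"
    using nn by eventually_elim (use r in \<open>auto simp: indicator_def\<close>)
  show "0 \<le> (LBINT s:{0..r}. (r - s) * g s)"
    unfolding set_lebesgue_integral_def by (rule integral_nonneg_AE[OF ae])
  have "wedge g r = (\<integral>\<^sup>+s. ennreal (indicator {0..r} s *\<^sub>R ((r - s) * g s)) \<partial>lborel)"
    unfolding wedge_def by (rule nn_integral_cong) (use r in \<open>auto simp: indicator_def max_def mult.commute\<close>)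
  also have "\<dots> = ennreal (LBINT s:{0..r}. (r - s) * g s)"
    unfolding set_lebesgue_integral_def by (rule nn_integral_eq_integral[OF i ae])
  finally show "wedge g r = ennreal (LBINT s:{0..r}. (r - s) * g s)" .
qed

lemma LambdaD:
  assumes "\<eta> \<in> Lambda \<xi> h"
  shows "\<eta> \<in> spaceX" "\<And>t. t \<in> {0..<1} \<Longrightarrow> \<xi> t \<le> \<eta> t" "deriv1 \<eta> 0 = - h\<^sup>2"
    "AE s in lborel. s \<in> {0..1} \<longrightarrow> 0 \<le> deriv2 \<eta> s" "deriv2 \<eta> \<in> borel_measurable borel"
    "\<And>r. r \<in> {0..<1} \<Longrightarrow> \<eta> r = \<eta> 0 - h\<^sup>2 * r + (LBINT s:{0..r}. (r - s) * deriv2 \<eta> s)"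
    "\<And>r. r \<in> {0..<1} \<Longrightarrow> wedge (deriv2 \<eta>) r = ennreal (\<eta> r - \<eta> 0 + h\<^sup>2 * r)"
    "\<And>r. r \<in> {0..<1} \<Longrightarrow> 0 \<le> \<eta> r - \<eta> 0 + h\<^sup>2 * r"
proof -
  show 1: "\<eta> \<in> spaceX" "\<And>t. t \<in> {0..<1} \<Longrightarrow> \<xi> t \<le> \<eta> t" "deriv1 \<eta> 0 = - h\<^sup>2"
    "AE s in lborel. s \<in> {0..1} \<longrightarrow> 0 \<le> deriv2 \<eta> s"
    using assms by (auto simp: Lambda_def)
  note x = spaceX_deriv2[OF 1(1)]
  show "deriv2 \<eta> \<in> borel_measurable borel" by (rule x)
  show 2: "\<eta> r = \<eta> 0 - h\<^sup>2 * r + (LBINT s:{0..r}. (r - s) * deriv2 \<eta> s)" if "r \<in> {0..<1}" for r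
    using x(3)[OF that] 1(3) by simp
  show "wedge (deriv2 \<eta>) r = ennreal (\<eta> r - \<eta> 0 + h\<^sup>2 * r)" "0 \<le> \<eta> r - \<eta> 0 + h\<^sup>2 * r" if r: "r \<in> {0..<1}" for r
  proof -
    have "set_integrable lborel {0..r} (deriv2 \<eta>)"
      by (rule set_integrable_locally_ess_bounded[OF x(1,2), of r]) (use r in auto)
    note w = wedge_eq[OF x(1) this 1(4)]
    show "wedge (deriv2 \<eta>) r = ennreal (\<eta> r - \<eta> 0 + h\<^sup>2 * r)" "0 \<le> \<eta> r - \<eta> 0 + h\<^sup>2 * r"
      using w r 2[OF r] by auto
  qed
qed

section \<open>Entropy, dual loss and their sum\<close>

text \<open>Writing \<open>g = q\<^sup>2\<close>, both sides are \<open>1/p - 2 q + q\<^sup>2 (1 - s)\<close>. All four terms are nonnegative, which is what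
makes the identity meaningful in the extended nonnegative reals.\<close>

lemma ennreal_amgm_split:
  fixes g p s :: real
  assumes "0 < p" "p \<le> 1 - s" "0 \<le> g"
  shows "(1 / ennreal p - 1 / ennreal (1 - s)) + ennreal (- (2 * sqrt g - g * (1 - s) - 1 / (1 - s)))
    = ennreal (g * (1 - s - p)) + ennreal ((1 - sqrt g * p)\<^sup>2 / p)"
proof -
  define u where "u = 1 - s"
  have u: "u > 0" "p \<le> u" using assms by (auto simp: u_def)
  define q where "q = sqrt g"
  have q: "q \<ge> 0" "g = q\<^sup>2" using assms by (auto simp: q_def)
  have 1: "1 / ennreal p - 1 / ennreal u = ennreal (1 / p - 1 / u)"
    using assms u by (simp add: divide_ennreal ennreal_minus flip: ennreal_1)
  have p1: "1 / p - 1 / u \<ge> 0" using assms u by (simp add: frac_le)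
  have "- (2 * q - q\<^sup>2 * u - 1 / u) = (q * u - 1)\<^sup>2 / u" using u by (simp add: field_simps power2_eq_square)
  hence p2: "- (2 * q - q\<^sup>2 * u - 1 / u) \<ge> 0" using u by simp
  have "1 / p - 1 / u + - (2 * q - q\<^sup>2 * u - 1 / u) = q\<^sup>2 * (u - p) + (1 - q * p)\<^sup>2 / p"
    using assms u by (simp add: field_simps power2_eq_square)
  hence "ennreal (1 / p - 1 / u) + ennreal (- (2 * q - q\<^sup>2 * u - 1 / u)) = ennreal (q\<^sup>2 * (u - p)) + ennreal ((1 - q * p)\<^sup>2 / p)"
    using p1 p2 u assms by (subst (1 2) ennreal_plus[symmetric]) auto
  moreover have "sqrt (q\<^sup>2) = q" using q by simp
  ultimately show ?thesis unfolding u_def[symmetric] 1 q(2) by (simp only:)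
qed

text \<open>The entropy and the dual loss are the nonlinear integrals of the two functionals; the slack measures
the failure of \<open>g \<phi>\<^sup>2 = 1\<close>.\<close>

definition cs_entropy :: "real measure \<Rightarrow> ennreal" where
  "cs_entropy \<mu> = (\<integral>\<^sup>+s\<in>{0..1}. (1 / ennreal (cphi \<mu> s) - 1 / ennreal (1 - s)) \<partial>lborel)"

definition dual_loss :: "(real \<Rightarrow> real) \<Rightarrow> ennreal" where
  "dual_loss g = (\<integral>\<^sup>+s\<in>{0..1}. ennreal (- (2 * sqrt (g s) - g s * (1 - s) - 1 / (1 - s))) \<partial>lborel)"

definition slack :: "real measure \<Rightarrow> (real \<Rightarrow> real) \<Rightarrow> ennreal" where
  "slack \<mu> g = (\<integral>\<^sup>+s\<in>{0..1}. ennreal ((1 - sqrt (g s) * cphi \<mu> s)\<^sup>2 / cphi \<mu> s) \<partial>lborel)"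

lemma cs_entropy_eq: "\<mu> \<in> Pr01 \<Longrightarrow> cs_entropy \<mu> = (\<integral>\<^sup>+s\<in>{0..1}. (1 / ennreal (phi \<mu> s) - 1 / ennreal (1 - s)) \<partial>lborel)"
  unfolding cs_entropy_def by (rule nn_integral_cong) (auto simp: phi_eq_cphi indicator_def)

lemma cs_entropy_plus_dual_loss:
  assumes mu: "\<mu> \<in> Pr01" and pos: "\<And>s. s \<in> {0..<1} \<Longrightarrow> 0 < cphi \<mu> s"
    and g[measurable]: "g \<in> borel_measurable borel" and nn: "AE s in lborel. s \<in> {0..1} \<longrightarrow> 0 \<le> g s"
  shows "cs_entropy \<mu> + dual_loss g = (\<integral>\<^sup>+r. wedge g r \<partial>\<mu>) + slack \<mu> g"
proof -
  note [measurable] = cphi_measurable[OF mu]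
  have "cs_entropy \<mu> + dual_loss g = (\<integral>\<^sup>+s\<in>{0..1}. ((1 / ennreal (cphi \<mu> s) - 1 / ennreal (1 - s))
      + ennreal (- (2 * sqrt (g s) - g s * (1 - s) - 1 / (1 - s)))) \<partial>lborel)"
    unfolding cs_entropy_def dual_loss_def by (subst nn_set_integral_add) auto
  also have "\<dots> = (\<integral>\<^sup>+s\<in>{0..1}. (ennreal (g s * (1 - s - cphi \<mu> s)) + ennreal ((1 - sqrt (g s) * cphi \<mu> s)\<^sup>2 / cphi \<mu> s)) \<partial>lborel)"
  proof (rule nn_integral_cong_AE)
    show "AE s in lborel. ((1 / ennreal (cphi \<mu> s) - 1 / ennreal (1 - s))
      + ennreal (- (2 * sqrt (g s) - g s * (1 - s) - 1 / (1 - s)))) * indicator {0..1} s =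
      (ennreal (g s * (1 - s - cphi \<mu> s)) + ennreal ((1 - sqrt (g s) * cphi \<mu> s)\<^sup>2 / cphi \<mu> s)) * indicator {0..1} s"
      using nn AE_lborel_singleton[of 1]
    proof eventually_elim
      case (elim s)
      show ?case
      proof (cases "s \<in> {0..1}")
        case True
        thus ?thesis using elim pos[of s] cphi_le[OF mu, of s] by (subst ennreal_amgm_split) auto
      qed simp
    qed
  qed
  also have "\<dots> = (\<integral>\<^sup>+r. wedge g r \<partial>\<mu>) + slack \<mu> g"
    unfolding slack_def nn_integral_wedge[OF mu g] by (subst nn_set_integral_add) auto
  finally show ?thesis .
qed

lemma nn_integral_inverse_one_minus:
  assumes c: "0 < c"
  shows "(\<integral>\<^sup>+s\<in>{0..1}. ennreal (c / (1 - s)) \<partial>lborel) = \<infinity>" (is "?I = _")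
proof -
  have ge: "ennreal (c * ln (real n + 1)) \<le> ?I" for n :: nat
  proof -
    define b where "b = 1 - 1 / (real n + 1)"
    have b: "0 \<le> b" "b < 1" by (auto simp: b_def divide_simps)
    have F: "((\<lambda>s. - c * ln (1 - s)) has_vector_derivative c / (1 - s)) (at s within {0..b})" if "0 \<le> s" "s \<le> b" for s
      unfolding has_real_derivative_iff_has_vector_derivative[symmetric]
      using that b by (auto intro!: derivative_eq_intros simp: field_simps)
    have cont: "continuous_on {0..b} (\<lambda>s. c / (1 - s))" using b by (auto intro!: continuous_intros)
    have i: "integrable lborel (\<lambda>s. indicator {0..b} s *\<^sub>R (c / (1 - s)))"
      using borel_integrable_atLeastAtMost'[OF cont] by (simp add: set_integrable_def)
    have "(\<integral>\<^sup>+s. ennreal (indicator {0..b} s *\<^sub>R (c / (1 - s))) \<partial>lborel)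
      = ennreal (LBINT s. indicator {0..b} s *\<^sub>R (c / (1 - s)))"
      by (rule nn_integral_eq_integral[OF i]) (use b c in \<open>auto simp: indicator_def\<close>)
    also have "(LBINT s. indicator {0..b} s *\<^sub>R (c / (1 - s))) = - c * ln (1 - b) - - c * ln (1 - 0)"
      by (rule integral_FTC_atLeastAtMost[OF b(1) F cont])
    also have "\<dots> = c * ln (real n + 1)" by (simp add: b_def ln_div)
    finally have "ennreal (c * ln (real n + 1)) = (\<integral>\<^sup>+s. ennreal (indicator {0..b} s *\<^sub>R (c / (1 - s))) \<partial>lborel)" by simp
    also have "\<dots> \<le> ?I"
      by (rule nn_integral_mono) (use b in \<open>auto simp: indicator_def\<close>)
    finally show ?thesis .
  qed
  show ?thesis
  proof (rule ccontr)
    assume "?I \<noteq> \<infinity>"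
    then obtain d where d: "?I = ennreal d" "0 \<le> d" by (cases ?I) auto
    have "filterlim (\<lambda>n. c * ln (real n + 1)) at_top sequentially" using c by real_asymp
    hence "eventually (\<lambda>n. c * ln (real n + 1) > d) sequentially" by (simp add: filterlim_at_top_dense)
    then obtain n where "c * ln (real n + 1) > d" by (auto simp: eventually_sequentially)
    thus False using ge[of n] d by (simp add: ennreal_le_iff)
  qed
qed

text \<open>If \<open>\<phi>\<close> vanishes at some \<open>t < 1\<close>, it vanishes on \<open>[t, 1]\<close>, where the integrand is then infinite. If
\<open>\<mu>\<close> has an atom of mass \<open>m\<close> at \<open>1\<close>, then \<open>\<phi>(s) \<le> (1 - m) (1 - s)\<close> and the integrand is at least
\<open>m / (1 - s)\<close>, which is not integrable.\<close>

lemma cs_entropy_finite_imp: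
  assumes mu: "\<mu> \<in> Pr01" and fin: "cs_entropy \<mu> < \<infinity>"
  shows "measure \<mu> {1} = 0" "\<And>s. s \<in> {0..<1} \<Longrightarrow> 0 < cphi \<mu> s"
proof -
  interpret prob_space \<mu> by (rule Pr01D[OF mu])
  show pos: "0 < cphi \<mu> t" if t: "t \<in> {0..<1}" for t
  proof (rule ccontr)
    assume "\<not> 0 < cphi \<mu> t"
    hence z: "cphi \<mu> s = 0" if "s \<in> {t..1}" for s
      using cphi_antimono[OF mu, of t s] cphi_nonneg[OF mu, of s] that by auto
    have "\<infinity> = (\<integral>\<^sup>+s\<in>{t..1}. \<infinity> \<partial>lborel)" 
      using t by (subst nn_integral_cmult_indicator) (auto simp: ennreal_top_mult)
    also have "\<dots> \<le> cs_entropy \<mu>"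
      unfolding cs_entropy_def
    proof (rule nn_integral_mono_AE)
      show "AE s in lborel. \<infinity> * indicator {t..1} s \<le> (1 / ennreal (cphi \<mu> s) - 1 / ennreal (1 - s)) * indicator {0..1} s"
        using AE_lborel_singleton[of 1]
      proof eventually_elim
        case (elim s)
        show ?case
        proof (cases "s \<in> {t..1}")
          case True
          hence "ennreal (1 - s) \<noteq> 0" using elim by (auto simp: ennreal_eq_0_iff)
          hence "1 / ennreal (cphi \<mu> s) - 1 / ennreal (1 - s) = \<infinity>"
            using z[OF True] by (simp add: ennreal_divide_eq_top_iff)
          thus ?thesis using True t by simp
        qed simp
      qed
    qed
    finally show False using fin by simp
  qed
  define m where "m = measure \<mu> {1}"
  show "measure \<mu> {1} = 0"
  proof (rule ccontr)
    assume "measure \<mu> {1} \<noteq> 0"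
    hence m: "m > 0" by (simp add: m_def zero_less_measure_iff)
    have s1: "{1} \<in> sets \<mu>" by (rule Pr01_in_sets[OF mu]) auto
    have i1: "integrable \<mu> (indicat_real {1})"
      by (rule Pr01_integrable[OF mu, of _ 1]) (auto simp: indicator_def)
    have le: "cphi \<mu> s \<le> (1 - m) * (1 - s)" if s: "s \<le> 1" for s
    proof -
      have "cphi \<mu> s \<le> (LINT r|\<mu>. (1 - s) - (1 - s) * indicator {1} r)"
        unfolding cphi_def
      proof (rule integral_mono[OF cphi_integrable[OF mu]])
        show "integrable \<mu> (\<lambda>r. (1 - s) - (1 - s) * indicator {1} r)"
          by (rule Pr01_integrable[OF mu, of _ "2 * (1 - s)"]) (use s in \<open>auto simp: indicator_def\<close>)
        show "1 - max r s \<le> (1 - s) - (1 - s) * indicator {1} r" if "r \<in> space \<mu>" for r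
          using s by (auto simp: indicator_def)
      qed
      also have "\<dots> = (1 - s) - (1 - s) * m" 
        using s1 by (subst Bochner_Integration.integral_diff) (auto simp: prob_space m_def i1)
      finally show ?thesis by (simp add: algebra_simps)
    qed
    have m1: "m < 1" using le[of 0] pos[of 0] by auto
    have "\<infinity> = (\<integral>\<^sup>+s\<in>{0..1}. ennreal (m / (1 - s)) \<partial>lborel)"
      using nn_integral_inverse_one_minus[OF m] by simp
    also have "\<dots> \<le> cs_entropy \<mu>"
      unfolding cs_entropy_def
    proof (rule nn_integral_mono_AE)
      show "AE s in lborel. ennreal (m / (1 - s)) * indicator {0..1} s \<le> (1 / ennreal (cphi \<mu> s) - 1 / ennreal (1 - s)) * indicator {0..1} s"
        using AE_lborel_singleton[of 1]
      proof eventually_elim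
        case (elim s)
        show ?case
        proof (cases "s \<in> {0..1}")
          case True
          hence p: "0 < cphi \<mu> s" "s < 1" using pos elim by auto
          have "1 / ennreal (cphi \<mu> s) - 1 / ennreal (1 - s) = ennreal (1 / cphi \<mu> s - 1 / (1 - s))"
            using p by (simp add: divide_ennreal ennreal_minus flip: ennreal_1)
          moreover have "m / (1 - s) \<le> 1 / cphi \<mu> s - 1 / (1 - s)"
          proof -
            have "1 / ((1 - m) * (1 - s)) \<le> 1 / cphi \<mu> s" using le[of s] p by (intro divide_left_mono) auto
            moreover have "(1 + m) / (1 - s) \<le> 1 / ((1 - m) * (1 - s))"
            proof -
              have "(1 + m) * (1 - m) \<le> 1" by (simp add: algebra_simps)
              hence "1 + m \<le> 1 / (1 - m)" using m1 by (simp add: field_simps)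
              hence "(1 + m) / (1 - s) \<le> 1 / (1 - m) / (1 - s)" using p by (intro divide_right_mono) auto
              thus ?thesis by simp
            qed
            ultimately show ?thesis by (simp add: add_divide_distrib)
          qed
          ultimately show ?thesis using True by (simp add: ennreal_leI)
        qed simp
      qed
    qed
    finally show False using fin by simp
  qed
qed

section \<open>The covariance function\<close>

lemma summable_diffs_mult_power:
  fixes c :: "nat \<Rightarrow> real"
  assumes "summable (\<lambda>n. c n * K ^ n)" "\<bar>x\<bar> < \<bar>K\<bar>"
  shows "summable (\<lambda>n. diffs c n * x ^ n)"
proof -
  have "summable (\<lambda>n. c n * z ^ n)" if "norm z < \<bar>K\<bar>" for z
    by (rule powser_inside[OF assms(1)]) (use that in simp)
  thus ?thesis using assms(2) by (intro termdiff_converges[of x "\<bar>K\<bar>" c]) auto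
qed

text \<open>The properties of \<open>\<xi>\<close> that the duality argument relies on: it is a double integral of a continuous
nonnegative function. In particular \<open>\<xi>(0) = \<xi>'(0) = 0\<close>.\<close>

locale cs_model =
  fixes \<xi> :: "real \<Rightarrow> real" and h :: real
  assumes xi_cont: "continuous_on {0..1} \<xi>"
    and xi2_cont: "continuous_on {0..1} (deriv (deriv \<xi>))"
    and xi2_nonneg: "\<And>s. s \<in> {0..1} \<Longrightarrow> 0 \<le> deriv (deriv \<xi>) s"
    and xi_rep: "\<And>r. r \<in> {0..1} \<Longrightarrow> \<xi> r = (LBINT s:{0..r}. (r - s) * deriv (deriv \<xi>) s)"

text \<open>The series converges beyond \<open>1\<close>, so it may be differentiated termwise twice on a neighbourhood of the
unit interval; its coefficients are nonnegative and start at degree two.\<close>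

lemma cs_xi_model:
  fixes \<beta> \<epsilon> :: real and b :: "nat \<Rightarrow> real"
  assumes eps: "\<epsilon> > 0"
    and fin: "summable (\<lambda>p. \<beta>\<^sup>2 * ((b (p + 2))\<^sup>2 * (1 + \<epsilon>) ^ (p + 2)))"
  shows "cs_model (cs_xi \<beta> b)"
proof -
  define c where "c = (\<lambda>n. if n < 2 then 0 else \<beta>\<^sup>2 * (b n)\<^sup>2)"
  define K where "K = 1 + \<epsilon>"
  have K: "K > 1" using eps by (simp add: K_def)
  have c0: "0 \<le> c n" for n by (simp add: c_def)
  have sK: "summable (\<lambda>n. c n * K ^ n)"
    using fin summable_iff_shift[of "\<lambda>n. c n * K ^ n" 2]
    by (simp add: c_def K_def mult.assoc)
  define f0 where "f0 = (\<lambda>t. \<Sum>n. c n * t ^ n)"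
  define f1 where "f1 = (\<lambda>t. \<Sum>n. diffs c n * t ^ n)"
  define f2 where "f2 = (\<lambda>t. \<Sum>n. diffs (diffs c) n * t ^ n)"
  define M where "M = (1 + K) / 2"
  have M: "1 < M" "M < K" using K by (auto simp: M_def)
  have sM: "summable (\<lambda>n. diffs c n * M ^ n)" by (rule summable_diffs_mult_power[OF sK]) (use M in auto)
  define M' where "M' = (1 + M) / 2"
  have M': "1 < M'" "M' < M" using M by (auto simp: M'_def)
  have sM': "summable (\<lambda>n. diffs (diffs c) n * M' ^ n)" by (rule summable_diffs_mult_power[OF sM]) (use M' in auto)
  have xi: "cs_xi \<beta> b t = f0 t" if t: "\<bar>t\<bar> < K" for t
  proof -
    have s: "summable (\<lambda>n. c n * t ^ n)" by (rule powser_inside[OF sK]) (use t in simp)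
    have "f0 t = (\<Sum>n. c (n + 2) * t ^ (n + 2))"
      unfolding f0_def by (subst suminf_split_initial_segment[OF s, of 2]) (simp add: c_def numeral_2_eq_2)
    also have "\<dots> = (\<Sum>n. \<beta>\<^sup>2 * ((b (n + 2))\<^sup>2 * t ^ (n + 2)))" by (simp add: c_def mult.assoc)
    also have "\<dots> = cs_xi \<beta> b t"
    proof (cases "\<beta> = 0")
      case False
      have "summable (\<lambda>n. \<beta>\<^sup>2 * ((b (n + 2))\<^sup>2 * t ^ (n + 2)))"
        using summable_iff_shift[of "\<lambda>n. c n * t ^ n" 2] s by (simp add: c_def mult.assoc)
      hence "summable (\<lambda>n. inverse (\<beta>\<^sup>2) * (\<beta>\<^sup>2 * ((b (n + 2))\<^sup>2 * t ^ (n + 2))))"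
        by (rule summable_mult)
      hence "summable (\<lambda>n. (b (n + 2))\<^sup>2 * t ^ (n + 2))" using False by (simp add: mult.assoc[symmetric])
      thus ?thesis unfolding cs_xi_def by (rule suminf_mult)
    qed (simp add: cs_xi_def)
    finally show ?thesis by simp
  qed
  have d0: "(f0 has_real_derivative f1 t) (at t)" if "\<bar>t\<bar> < K" for t
    unfolding f0_def f1_def by (rule termdiffs_strong[OF sK]) (use that in simp)
  have d1: "(f1 has_real_derivative f2 t) (at t)" if "\<bar>t\<bar> < M" for t
    unfolding f1_def f2_def by (rule termdiffs_strong[OF sM]) (use that M in simp)
  have c2: "isCont f2 t" if "\<bar>t\<bar> < M'" for t
    unfolding f2_def by (rule isCont_powser[OF sM']) (use that M' in simp)
  have D0: "(cs_xi \<beta> b has_real_derivative f1 t) (at t)" if "\<bar>t\<bar> < K" for t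
    by (rule has_field_derivative_transform_within_open[OF d0[OF that], of "{-K<..<K}"])
      (use that xi in auto)
  hence E1: "deriv (cs_xi \<beta> b) t = f1 t" if "\<bar>t\<bar> < K" for t using that by (intro DERIV_imp_deriv)
  have D1: "(deriv (cs_xi \<beta> b) has_real_derivative f2 t) (at t)" if "\<bar>t\<bar> < M" for t
    by (rule has_field_derivative_transform_within_open[OF d1[OF that], of "{-M<..<M}"])
      (use that M E1 in auto)
  hence E2: "deriv (deriv (cs_xi \<beta> b)) t = f2 t" if "\<bar>t\<bar> < M" for t using that by (intro DERIV_imp_deriv)
  have f20: "0 \<le> f2 s" if "s \<in> {0..1}" for s
    unfolding f2_def
  proof (rule suminf_nonneg)
    show "summable (\<lambda>n. diffs (diffs c) n * s ^ n)"
      by (rule powser_inside[OF sM']) (use that M' in auto)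
    show "0 \<le> diffs (diffs c) n * s ^ n" for n using c0 that by (auto simp: diffs_def)
  qed
  have z: "f0 0 = 0" "f1 0 = 0"
    unfolding f0_def f1_def by (subst powser_zero; simp add: c_def diffs_def)+
  have cf2: "continuous_on {0..r} f2" if "r \<le> 1" for r
    by (intro continuous_at_imp_continuous_on ballI c2) (use that M' in auto)
  have rep: "f0 r = (LBINT s:{0..r}. (r - s) * f2 s)" if r: "r \<in> {0..1}" for r
  proof -
    have "(LBINT s:{0..r}. (r - s) * f2 s) = ((r - r) * f1 r + f0 r) - ((r - 0) * f1 0 + f0 0)"
      unfolding set_lebesgue_integral_def
    proof (rule integral_FTC_atLeastAtMost)
      fix x assume x: "0 \<le> x" "x \<le> r"
      note d = d0[THEN has_field_derivative_at_within] d1[THEN has_field_derivative_at_within]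
      show "((\<lambda>x. (r - x) * f1 x + f0 x) has_vector_derivative (r - x) * f2 x) (at x within {0..r})"
        unfolding has_real_derivative_iff_has_vector_derivative[symmetric]
        using x r M by (auto intro!: derivative_eq_intros d)
    qed (use r in \<open>auto intro!: continuous_intros cf2\<close>)
    thus ?thesis using z by simp
  qed
  have in01: "\<bar>s\<bar> < M \<and> \<bar>s\<bar> < K" if "s \<in> {0..1}" for s using that M by auto
  show ?thesis
  proof
    show "continuous_on {0..1} (cs_xi \<beta> b)"
      by (intro continuous_at_imp_continuous_on ballI DERIV_isCont[OF D0]) (use in01 in blast)
    show "continuous_on {0..1} (deriv (deriv (cs_xi \<beta> b)))"
      using cf2[of 1] by (subst continuous_on_cong[OF refl E2]) (use in01 in auto)
    show "0 \<le> deriv (deriv (cs_xi \<beta> b)) s" if "s \<in> {0..1}" for s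
      using f20[OF that] E2[of s] in01[OF that] by simp
    show "cs_xi \<beta> b r = (LBINT s:{0..r}. (r - s) * deriv (deriv (cs_xi \<beta> b)) s)" if r: "r \<in> {0..1}" for r
    proof -
      have "(LBINT s:{0..r}. (r - s) * deriv (deriv (cs_xi \<beta> b)) s) = (LBINT s:{0..r}. (r - s) * f2 s)"
        by (rule set_lebesgue_integral_cong) (use E2 in01 r in auto)
      thus ?thesis using rep[OF r] xi[of r] in01[OF r] by simp
    qed
  qed
qed

section \<open>The duality gap\<close>

lemma Pr01_measurable_continuous_on:
  "\<mu> \<in> Pr01 \<Longrightarrow> continuous_on {0..1} f \<Longrightarrow> f \<in> borel_measurable \<mu>" for f :: "real \<Rightarrow> real"
  using borel_measurable_continuous_on_restrict[of "{0..1}" f] measurable_cong_sets[OF Pr01D(2) refl] by blast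

lemma Pr01_integrable_continuous_on:
  fixes f :: "real \<Rightarrow> real"
  assumes mu: "\<mu> \<in> Pr01" and f: "continuous_on {0..1} f"
  shows "integrable \<mu> f"
proof -
  interpret prob_space \<mu> by (rule Pr01D[OF mu])
  obtain B where "\<And>r. r \<in> {0..1} \<Longrightarrow> \<bar>f r\<bar> \<le> B"
    using compact_continuous_image[OF f compact_Icc] compact_imp_bounded bounded_iff
    by (metis imageI real_norm_def)
  thus ?thesis
    by (intro integrable_const_bound[of _ B] Pr01_measurable_continuous_on[OF mu f])
      (use Pr01D(3)[OF mu] in auto)
qed

context cs_model
begin

abbreviation "xi2 \<equiv> deriv (deriv \<xi>)"

definition "mean_xi \<mu> = (LINT r|\<mu>. \<xi> r)"

lemma xi_nonneg: "r \<in> {0..1} \<Longrightarrow> 0 \<le> \<xi> r"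
  unfolding xi_rep set_lebesgue_integral_def
  by (rule Bochner_Integration.integral_nonneg) (use xi2_nonneg in \<open>auto simp: indicator_def\<close>)

text \<open>This is the pairing of \<open>\<eta>''\<close> with \<open>1 - s - \<phi>(s)\<close> once more, now for \<open>\<xi>''\<close>, subtracted from
\<open>\<integral> (1 - s) \<xi>''(s) ds = \<xi>(1)\<close>.\<close>

lemma xi2_phi_integral:
  assumes mu: "\<mu> \<in> Pr01"
  shows "set_integrable lborel {0..1} (\<lambda>s. xi2 s * cphi \<mu> s)"
    "(LBINT s:{0..1}. xi2 s * cphi \<mu> s) = \<xi> 1 - mean_xi \<mu>"
proof -
  note cphi_continuous[OF mu, of "{0..1}"]
  note c = continuous_intros this xi2_cont
  show i: "set_integrable lborel {0..1} (\<lambda>s. xi2 s * cphi \<mu> s)"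
    by (intro borel_integrable_atLeastAtMost' c)
  have j: "set_integrable lborel {0..1} (\<lambda>s. (1 - s) * xi2 s)"
    by (intro borel_integrable_atLeastAtMost' c)
  have l: "set_integrable lborel {0..1} (\<lambda>s. xi2 s * (1 - s - cphi \<mu> s))"
    by (intro borel_integrable_atLeastAtMost' c)
  \<comment> \<open>The cut-off makes \<open>\<xi>''\<close> measurable on the whole line.\<close>
  define k where "k = (\<lambda>s. indicator {0..1} s *\<^sub>R xi2 s)"
  have km[measurable]: "k \<in> borel_measurable borel"
    unfolding k_def by (rule borel_measurable_continuous_on_indicator[OF _ xi2_cont]) simp
  have w: "wedge k r = ennreal (\<xi> r)" if r: "r \<in> {0..1}" for r
  proof -
    have "wedge k r = ennreal (LBINT s:{0..r}. (r - s) * k s)"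
    proof (rule wedge_eq(1)[OF km])
      have "set_integrable lborel {0..r} xi2"
        by (rule borel_integrable_atLeastAtMost'[OF continuous_on_subset[OF xi2_cont]]) (use r in auto)
      moreover have "(\<lambda>x. indicator {0..r} x *\<^sub>R k x) = (\<lambda>x. indicator {0..r} x *\<^sub>R xi2 x)"
        using r by (auto simp: k_def indicator_def)
      ultimately show "set_integrable lborel {0..r} k" by (simp add: set_integrable_def)
    qed (use r xi2_nonneg km in \<open>auto simp: k_def\<close>)
    also have "(LBINT s:{0..r}. (r - s) * k s) = \<xi> r"
      unfolding xi_rep[OF r] by (rule set_lebesgue_integral_cong) (use r in \<open>auto simp: k_def\<close>)
    finally show ?thesis .
  qed
  have "ennreal (mean_xi \<mu>) = (\<integral>\<^sup>+r. ennreal (\<xi> r) \<partial>\<mu>)"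
    unfolding mean_xi_def
    by (rule nn_integral_eq_integral[symmetric])
      (use Pr01_integrable_continuous_on[OF mu xi_cont] xi_nonneg Pr01D(3)[OF mu] in auto)
  also have "\<dots> = (\<integral>\<^sup>+r. wedge k r \<partial>\<mu>)"
    by (rule nn_integral_cong) (use w Pr01D(3)[OF mu] in auto)
  also have "\<dots> = (\<integral>\<^sup>+s. ennreal (indicator {0..1} s *\<^sub>R (xi2 s * (1 - s - cphi \<mu> s))) \<partial>lborel)"
    unfolding nn_integral_wedge[OF mu km] by (rule nn_integral_cong) (auto simp: k_def indicator_def)
  also have "\<dots> = ennreal (LBINT s:{0..1}. xi2 s * (1 - s - cphi \<mu> s))"
    unfolding set_lebesgue_integral_def
    by (rule nn_integral_eq_integral) (use l xi2_nonneg cphi_le[OF mu] in \<open>auto simp: set_integrable_def indicator_def\<close>)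
  finally have "mean_xi \<mu> = (LBINT s:{0..1}. xi2 s * (1 - s - cphi \<mu> s))"
  proof (subst (asm) ennreal_inj)
    show "0 \<le> mean_xi \<mu>" unfolding mean_xi_def
      by (rule Bochner_Integration.integral_nonneg) (use xi_nonneg Pr01D(3)[OF mu] in auto)
    show "0 \<le> (LBINT s:{0..1}. xi2 s * (1 - s - cphi \<mu> s))"
      unfolding set_lebesgue_integral_def
      by (rule Bochner_Integration.integral_nonneg) (use xi2_nonneg cphi_le[OF mu] in \<open>auto simp: indicator_def\<close>)
  qed
  also have "\<dots> = (LBINT s:{0..1}. (1 - s) * xi2 s - xi2 s * cphi \<mu> s)"
    by (simp add: algebra_simps)
  also have "\<dots> = \<xi> 1 - (LBINT s:{0..1}. xi2 s * cphi \<mu> s)"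
    using xi_rep[of 1] by (subst set_integral_diff[OF j i]) simp
  finally show "(LBINT s:{0..1}. xi2 s * cphi \<mu> s) = \<xi> 1 - mean_xi \<mu>" by simp
qed

lemma cs_primal_eq:
  assumes mu: "\<mu> \<in> Pr01"
  shows "cs_primal \<xi> h \<mu> = ereal (1 / 2) * (enn2ereal (cs_entropy \<mu>) + ereal (\<xi> 1 - mean_xi \<mu> + h\<^sup>2 * cphi \<mu> 0))"
proof -
  have "(LBINT s:{0..1}. xi2 s * phi \<mu> s) = (LBINT s:{0..1}. xi2 s * cphi \<mu> s)"
    by (rule set_lebesgue_integral_cong) (auto simp: phi_eq_cphi[OF mu])
  thus ?thesis unfolding cs_primal_def cs_entropy_eq[OF mu, symmetric]
    using phi_eq_cphi[OF mu, of 0] xi2_phi_integral(2)[OF mu]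
    by (cases "cs_entropy \<mu>") (auto simp: algebra_simps)
qed

lemma cs_dual_eq:
  "cs_dual \<xi> h \<eta> = ereal (1 / 2) * (- enn2ereal (dual_loss (deriv2 \<eta>)) + ereal (- \<eta> 0 + h\<^sup>2 + \<xi> 1))"
  by (simp add: cs_dual_def dual_loss_def)

lemma spaceX_measurable:
  assumes mu: "\<mu> \<in> Pr01" and eta: "\<eta> \<in> spaceX"
  shows "\<eta> \<in> borel_measurable \<mu>"
proof -
  have "continuous_on {0..<1} \<eta>"
    using eta unfolding spaceX_def by (auto intro: differentiable_imp_continuous_on)
  hence "(\<lambda>r. indicator {0..<1} r *\<^sub>R \<eta> r) \<in> borel_measurable borel"
    by (intro borel_measurable_continuous_on_indicator) auto
  hence "(\<lambda>r. indicator {0..<1} r *\<^sub>R \<eta> r + indicator {1} r * \<eta> 1) \<in> borel_measurable borel" by simp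
  from Pr01_measurable[OF mu this] show ?thesis
    by (rule measurable_cong[THEN iffD1, rotated]) (auto simp: Pr01D(3)[OF mu] indicator_def)
qed

definition "contact_loss \<mu> \<eta> = (\<integral>\<^sup>+r. ennreal (\<eta> r - \<xi> r) \<partial>\<mu>)"

lemma Pr01_AE_less_1: "\<mu> \<in> Pr01 \<Longrightarrow> measure \<mu> {1} = 0 \<Longrightarrow> AE r in \<mu>. r \<in> {0..<1}"
proof -
  assume mu: "\<mu> \<in> Pr01" and 0: "measure \<mu> {1} = 0"
  interpret prob_space \<mu> by (rule Pr01D[OF mu])
  have "{1} \<in> null_sets \<mu>"
    using 0 Pr01_in_sets[OF mu, of "{1}"] by (auto simp: null_sets_def emeasure_eq_measure)
  from AE_not_in[OF this] AE_space[of \<mu>] show ?thesis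
    by eventually_elim (auto simp: Pr01D(3)[OF mu])
qed

text \<open>The identity behind the duality, with every term moved to the side where it is nonnegative. The value \<open>\<eta>(0) \<ge> \<xi>(0) = 0\<close> is added on both sides so that
\<open>\<eta>(r) + h\<^sup>2 r\<close> splits into the nonnegative parts \<open>\<eta>(r) - \<xi>(r)\<close> and \<open>\<xi>(r) + h\<^sup>2 r\<close>.\<close>

lemma duality_identity:
  assumes mu: "\<mu> \<in> Pr01" and eta: "\<eta> \<in> Lambda \<xi> h"
    and m1: "measure \<mu> {1} = 0" and pos: "\<And>s. s \<in> {0..<1} \<Longrightarrow> 0 < cphi \<mu> s"
  shows "cs_entropy \<mu> + dual_loss (deriv2 \<eta>) + ennreal (\<eta> 0) =
    contact_loss \<mu> \<eta> + slack \<mu> (deriv2 \<eta>) + ennreal (mean_xi \<mu> + h\<^sup>2 * (1 - cphi \<mu> 0))"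
proof -
  interpret prob_space \<mu> by (rule Pr01D[OF mu])
  note L = LambdaD[OF eta]
  have [measurable]: "\<eta> \<in> borel_measurable \<mu>" "\<xi> \<in> borel_measurable \<mu>" "(\<lambda>r. r) \<in> borel_measurable \<mu>"
    "wedge (deriv2 \<eta>) \<in> borel_measurable \<mu>"
    using spaceX_measurable[OF mu L(1)] Pr01_measurable_continuous_on[OF mu xi_cont] Pr01_measurable_id[OF mu]
      Pr01_measurable[OF mu wedge_measurable[OF L(5)]] by auto
  have eta0: "0 \<le> \<eta> 0" using L(2)[of 0] xi_nonneg[of 0] by simp
  have "(\<integral>\<^sup>+r. wedge (deriv2 \<eta>) r \<partial>\<mu>) + ennreal (\<eta> 0) = (\<integral>\<^sup>+r. (wedge (deriv2 \<eta>) r + ennreal (\<eta> 0)) \<partial>\<mu>)"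
    by (simp add: nn_integral_add emeasure_space_1)
  also have "\<dots> = (\<integral>\<^sup>+r. (ennreal (\<eta> r - \<xi> r) + ennreal (\<xi> r + h\<^sup>2 * r)) \<partial>\<mu>)"
  proof (rule nn_integral_cong_AE)
    show "AE r in \<mu>. wedge (deriv2 \<eta>) r + ennreal (\<eta> 0) = ennreal (\<eta> r - \<xi> r) + ennreal (\<xi> r + h\<^sup>2 * r)"
      using Pr01_AE_less_1[OF mu m1]
    proof eventually_elim
      case (elim r)
      thus ?case using L(2,7,8)[of r] eta0 xi_nonneg[of r] by (simp add: ennreal_plus[symmetric] del: ennreal_plus)
    qed
  qed
  also have "\<dots> = contact_loss \<mu> \<eta> + (\<integral>\<^sup>+r. ennreal (\<xi> r + h\<^sup>2 * r) \<partial>\<mu>)"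
    unfolding contact_loss_def by (rule nn_integral_add) auto
  also have "(\<integral>\<^sup>+r. ennreal (\<xi> r + h\<^sup>2 * r) \<partial>\<mu>) = ennreal (LINT r|\<mu>. \<xi> r + h\<^sup>2 * r)"
    by (rule nn_integral_eq_integral)
      (use Pr01_integrable_continuous_on[OF mu] xi_cont xi_nonneg Pr01D(3)[OF mu] in \<open>auto intro!: continuous_intros AE_I2\<close>)
  also have "(LINT r|\<mu>. \<xi> r + h\<^sup>2 * r) = mean_xi \<mu> + h\<^sup>2 * (1 - cphi \<mu> 0)"
    unfolding cphi_0[OF mu, symmetric] mean_xi_def
    using Pr01_integrable_continuous_on[OF mu xi_cont] Pr01_integrable_continuous_on[OF mu continuous_on_id]
    by (subst Bochner_Integration.integral_add) auto
  finally have *: "(\<integral>\<^sup>+r. wedge (deriv2 \<eta>) r \<partial>\<mu>) + ennreal (\<eta> 0) =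
    contact_loss \<mu> \<eta> + ennreal (mean_xi \<mu> + h\<^sup>2 * (1 - cphi \<mu> 0))" .
  have "cs_entropy \<mu> + dual_loss (deriv2 \<eta>) + ennreal (\<eta> 0) =
    ((\<integral>\<^sup>+r. wedge (deriv2 \<eta>) r \<partial>\<mu>) + ennreal (\<eta> 0)) + slack \<mu> (deriv2 \<eta>)"
    using cs_entropy_plus_dual_loss[OF mu pos L(5,4)] by (simp add: ac_simps)
  thus ?thesis unfolding * by (simp add: ac_simps)
qed

lemma mean_xi_nonneg: "\<mu> \<in> Pr01 \<Longrightarrow> 0 \<le> mean_xi \<mu>"
  unfolding mean_xi_def
  by (rule Bochner_Integration.integral_nonneg) (use xi_nonneg Pr01D(3) in auto)

text \<open>When the entropy and the dual loss are finite, the identity can be rearranged among real numbers: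
half the sum of the contact loss and the slack is the gap between the two functionals.\<close>

lemma duality_gap:
  assumes mu: "\<mu> \<in> Pr01" and eta: "\<eta> \<in> Lambda \<xi> h"
    and m1: "measure \<mu> {1} = 0" and pos: "\<And>s. s \<in> {0..<1} \<Longrightarrow> 0 < cphi \<mu> s"
    and fin: "cs_entropy \<mu> < \<infinity>" "dual_loss (deriv2 \<eta>) < \<infinity>"
  obtains G R where "0 \<le> G" "0 \<le> R" "contact_loss \<mu> \<eta> = ennreal G" "slack \<mu> (deriv2 \<eta>) = ennreal R"
    "\<exists>d. cs_dual \<xi> h \<eta> = ereal d \<and> cs_primal \<xi> h \<mu> = ereal (d + (G + R) / 2)"
proof -
  have id: "cs_entropy \<mu> + dual_loss (deriv2 \<eta>) + ennreal (\<eta> 0) =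
    contact_loss \<mu> \<eta> + slack \<mu> (deriv2 \<eta>) + ennreal (mean_xi \<mu> + h\<^sup>2 * (1 - cphi \<mu> 0))"
    by (rule duality_identity[OF mu eta m1 pos])
  have eta0: "0 \<le> \<eta> 0" using LambdaD(2)[OF eta, of 0] xi_nonneg[of 0] by simp
  have X0: "0 \<le> mean_xi \<mu> + h\<^sup>2 * (1 - cphi \<mu> 0)"
    using mean_xi_nonneg[OF mu] cphi_le[OF mu, of 0] by simp
  obtain a where a: "cs_entropy \<mu> = ennreal a" "0 \<le> a" using fin by (cases "cs_entropy \<mu>") auto
  obtain c where c: "dual_loss (deriv2 \<eta>) = ennreal c" "0 \<le> c" using fin by (cases "dual_loss (deriv2 \<eta>)") auto
  have "contact_loss \<mu> \<eta> + slack \<mu> (deriv2 \<eta>) + ennreal (mean_xi \<mu> + h\<^sup>2 * (1 - cphi \<mu> 0)) < \<infinity>"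
    unfolding id[symmetric] a c by simp
  then obtain G R where G: "contact_loss \<mu> \<eta> = ennreal G" "0 \<le> G" and R: "slack \<mu> (deriv2 \<eta>) = ennreal R" "0 \<le> R"
    by (cases "contact_loss \<mu> \<eta>"; cases "slack \<mu> (deriv2 \<eta>)") auto
  have "ennreal (a + c + \<eta> 0) = ennreal (G + R + (mean_xi \<mu> + h\<^sup>2 * (1 - cphi \<mu> 0)))"
    using id eta0 X0 a c G R by simp
  hence e: "a + c + \<eta> 0 = G + R + (mean_xi \<mu> + h\<^sup>2 * (1 - cphi \<mu> 0))"
    by (subst (asm) ennreal_inj) (use eta0 X0 a c G R in auto)
  have "cs_dual \<xi> h \<eta> = ereal ((- c + (- \<eta> 0 + h\<^sup>2 + \<xi> 1)) / 2)"
    unfolding cs_dual_eq c using c by simp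
  moreover have "cs_primal \<xi> h \<mu> = ereal ((a + (\<xi> 1 - mean_xi \<mu> + h\<^sup>2 * cphi \<mu> 0)) / 2)"
    unfolding cs_primal_eq[OF mu] a using a by simp
  moreover have "(a + (\<xi> 1 - mean_xi \<mu> + h\<^sup>2 * cphi \<mu> 0)) / 2 = (- c + (- \<eta> 0 + h\<^sup>2 + \<xi> 1)) / 2 + (G + R) / 2"
    using e by (simp add: field_simps)
  ultimately have "\<exists>d. cs_dual \<xi> h \<eta> = ereal d \<and> cs_primal \<xi> h \<mu> = ereal (d + (G + R) / 2)"
    by (intro exI[of _ "(- c + (- \<eta> 0 + h\<^sup>2 + \<xi> 1)) / 2"]) (simp only:)
  thus thesis by (rule that[OF G(2) R(2) G(1) R(1)])
qed

lemma cs_primal_finite_iff: "\<mu> \<in> Pr01 \<Longrightarrow> cs_primal \<xi> h \<mu> < \<infinity> \<longleftrightarrow> cs_entropy \<mu> < \<infinity>"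
  unfolding cs_primal_eq by (cases "cs_entropy \<mu>") auto

lemma cs_dual_finite_iff: "- \<infinity> < cs_dual \<xi> h \<eta> \<longleftrightarrow> dual_loss (deriv2 \<eta>) < \<infinity>"
  unfolding cs_dual_eq by (cases "dual_loss (deriv2 \<eta>)") auto

lemma weak_duality:
  assumes mu: "\<mu> \<in> Pr01" and eta: "\<eta> \<in> Lambda \<xi> h"
  shows "cs_dual \<xi> h \<eta> \<le> cs_primal \<xi> h \<mu>"
proof (cases "cs_entropy \<mu> < \<infinity> \<and> dual_loss (deriv2 \<eta>) < \<infinity>")
  case True
  from duality_gap[OF mu eta cs_entropy_finite_imp[OF mu]] True
  obtain G R where GR: "0 \<le> G" "0 \<le> R"
    and "\<exists>d. cs_dual \<xi> h \<eta> = ereal d \<and> cs_primal \<xi> h \<mu> = ereal (d + (G + R) / 2)" by metis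
  thus ?thesis by auto
next
  case False
  thus ?thesis
    using cs_primal_finite_iff[OF mu] cs_dual_finite_iff[of \<eta>] by (auto simp: not_less)
qed

definition "complementary \<mu> \<eta> \<longleftrightarrow> measure \<mu> {s\<in>{0..<1}. \<eta> s = \<xi> s} = 1 \<and>
  (AE s in lborel. s \<in> {0..1} \<longrightarrow> deriv2 \<eta> s * (phi \<mu> s)\<^sup>2 = 1)"

lemma contact_measure_iff:
  assumes mu: "\<mu> \<in> Pr01" and eta: "\<eta> \<in> spaceX"
  shows "measure \<mu> {s\<in>{0..<1}. \<eta> s = \<xi> s} = 1 \<longleftrightarrow> (AE s in \<mu>. s \<in> {0..<1} \<and> \<eta> s = \<xi> s)"
proof -
  interpret prob_space \<mu> by (rule Pr01D[OF mu])
  have [measurable]: "\<eta> \<in> borel_measurable \<mu>" "\<xi> \<in> borel_measurable \<mu>"  "(\<lambda>r. r) \<in> borel_measurable \<mu>"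
    using spaceX_measurable[OF mu eta] Pr01_measurable_continuous_on[OF mu xi_cont] Pr01_measurable_id[OF mu] by auto
  have "{s \<in> space \<mu>. s \<in> {0..<1} \<and> \<eta> s = \<xi> s} \<in> sets \<mu>" by measurable
  moreover have "{s \<in> space \<mu>. s \<in> {0..<1} \<and> \<eta> s = \<xi> s} = {s\<in>{0..<1}. \<eta> s = \<xi> s}"
    using Pr01D(3)[OF mu] by auto
  ultimately have "{s\<in>{0..<1}. \<eta> s = \<xi> s} \<in> sets \<mu>" by (simp only:)
  from prob_eq_1[OF this] show ?thesis by simp
qed

text \<open>Equal values are finite, since the primal functional never takes the value \<open>-\<infinity>\<close> and the dual never
\<open>\<infinity>\<close>. So the gap formula applies, and both of its nonnegative terms vanish.\<close>

lemma complementary_if_equal: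
  assumes mu: "\<mu> \<in> Pr01" and eta: "\<eta> \<in> Lambda \<xi> h" and eq: "cs_primal \<xi> h \<mu> = cs_dual \<xi> h \<eta>"
  shows "complementary \<mu> \<eta>"
proof -
  note L = LambdaD[OF eta]
  have "cs_dual \<xi> h \<eta> < \<infinity>" unfolding cs_dual_eq by (cases "dual_loss (deriv2 \<eta>)") auto
  moreover have "- \<infinity> < cs_primal \<xi> h \<mu>" unfolding cs_primal_eq[OF mu] by (cases "cs_entropy \<mu>") auto
  ultimately have fin: "cs_entropy \<mu> < \<infinity>" "dual_loss (deriv2 \<eta>) < \<infinity>"
    using eq cs_primal_finite_iff[OF mu] cs_dual_finite_iff by auto
  note pos = cs_entropy_finite_imp[OF mu fin(1)]
  from duality_gap[OF mu eta pos fin]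
  obtain G R where GR: "0 \<le> G" "0 \<le> R" "contact_loss \<mu> \<eta> = ennreal G" "slack \<mu> (deriv2 \<eta>) = ennreal R"
    and "\<exists>d. cs_dual \<xi> h \<eta> = ereal d \<and> cs_primal \<xi> h \<mu> = ereal (d + (G + R) / 2)" by metis
  hence "G = 0" "R = 0" using eq by auto
  hence z: "contact_loss \<mu> \<eta> = 0" "slack \<mu> (deriv2 \<eta>) = 0" using GR by auto
  have [measurable]: "\<eta> \<in> borel_measurable \<mu>" "\<xi> \<in> borel_measurable \<mu>"
    using spaceX_measurable[OF mu L(1)] Pr01_measurable_continuous_on[OF mu xi_cont] by auto
  note [measurable] = cphi_measurable[OF mu] L(5)
  have "AE r in \<mu>. ennreal (\<eta> r - \<xi> r) = 0"
    using z(1) unfolding contact_loss_def by (subst (asm) nn_integral_0_iff_AE) auto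
  hence 1: "AE r in \<mu>. r \<in> {0..<1} \<and> \<eta> r = \<xi> r"
    using Pr01_AE_less_1[OF mu pos(1)]
  proof eventually_elim
    case (elim r) thus ?case using L(2)[of r] by (simp add: ennreal_eq_0_iff)
  qed
  have "AE s in lborel. ennreal ((1 - sqrt (deriv2 \<eta> s) * cphi \<mu> s)\<^sup>2 / cphi \<mu> s) * indicator {0..1} s = 0"
    using z(2) unfolding slack_def by (subst (asm) nn_integral_0_iff_AE) auto
  hence "AE s in lborel. s \<in> {0..1} \<longrightarrow> deriv2 \<eta> s * (phi \<mu> s)\<^sup>2 = 1"
    using L(4) AE_lborel_singleton[of 1]
  proof eventually_elim
    case (elim s)
    show ?case
    proof
      assume s: "s \<in> {0..1}"
      hence p: "0 < cphi \<mu> s" using pos(2)[of s] elim by auto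
      have "(1 - sqrt (deriv2 \<eta> s) * cphi \<mu> s)\<^sup>2 / cphi \<mu> s \<le> 0" using elim(1) s by (simp add: ennreal_eq_0_iff)
      hence "(1 - sqrt (deriv2 \<eta> s) * cphi \<mu> s)\<^sup>2 \<le> 0" using p by (simp add: divide_le_0_iff)
      hence "sqrt (deriv2 \<eta> s) * cphi \<mu> s = 1" by simp
      hence "(sqrt (deriv2 \<eta> s))\<^sup>2 * (cphi \<mu> s)\<^sup>2 = 1" by (metis power_mult_distrib power_one)
      thus "deriv2 \<eta> s * (phi \<mu> s)\<^sup>2 = 1" using elim(2) s by (simp add: phi_eq_cphi[OF mu])
    qed
  qed
  thus ?thesis unfolding complementary_def using 1 contact_measure_iff[OF mu L(1)] by blast
qed

text \<open>Under the two relations the right-hand side of \<open>duality_identity\<close> is finite, hence so are the entropy and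
the dual loss. The relation \<open>\<eta>'' \<phi>\<^sup>2 = 1\<close> forces \<open>\<phi> > 0\<close>
on \<open>[0, 1)\<close> because \<open>\<phi>\<close> is nonincreasing.\<close>

lemma equal_if_complementary:
  assumes mu: "\<mu> \<in> Pr01" and eta: "\<eta> \<in> Lambda \<xi> h" and comp: "complementary \<mu> \<eta>"
  shows "\<exists>d. cs_primal \<xi> h \<mu> = ereal d \<and> cs_dual \<xi> h \<eta> = ereal d"
proof -
  interpret prob_space \<mu> by (rule Pr01D[OF mu])
  note L = LambdaD[OF eta]
  have ct: "AE s in \<mu>. s \<in> {0..<1} \<and> \<eta> s = \<xi> s"
    using comp contact_measure_iff[OF mu L(1)] by (simp add: complementary_def)
  have ae: "AE s in lborel. s \<in> {0..1} \<longrightarrow> deriv2 \<eta> s * (cphi \<mu> s)\<^sup>2 = 1"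
    using comp unfolding complementary_def by (auto simp: phi_eq_cphi[OF mu] cong: conj_cong imp_cong)
  have "{1} \<in> sets \<mu>" by (rule Pr01_in_sets[OF mu]) auto
  hence m1: "measure \<mu> {1} = 0"
    using ct by (subst prob_eq_0) (auto elim: eventually_mono)
  have pos: "0 < cphi \<mu> t" if t: "t \<in> {0..<1}" for t
  proof (rule ccontr)
    assume n: "\<not> 0 < cphi \<mu> t"
    have "AE s in lborel. s \<notin> {t..1}"
      using ae
    proof eventually_elim
      case (elim s)
      show ?case
      proof
        assume s: "s \<in> {t..1}"
        hence "cphi \<mu> s = 0" using n cphi_antimono[OF mu, of t s] cphi_nonneg[OF mu, of s] by auto
        thus False using elim s t by auto
      qed
    qed
    hence "{t..1} \<in> null_sets lborel" by (subst AE_iff_null_sets) auto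
    hence "emeasure lborel {t..1} = 0" by (rule null_setsD1)
    thus False using t by (simp add: ennreal_eq_0_iff)
  qed
  have G: "contact_loss \<mu> \<eta> = 0"
    unfolding contact_loss_def
    by (rule nn_integral_zero') (use ct in \<open>auto elim: eventually_mono\<close>)
  have S: "slack \<mu> (deriv2 \<eta>) = 0"
    unfolding slack_def
  proof (rule nn_integral_zero')
    show "AE s in lborel. ennreal ((1 - sqrt (deriv2 \<eta> s) * cphi \<mu> s)\<^sup>2 / cphi \<mu> s) * indicator {0..1} s = 0"
      using ae
    proof eventually_elim
      case (elim s)
      show ?case
      proof (cases "s \<in> {0..1}")
        case True
        have "sqrt (deriv2 \<eta> s * (cphi \<mu> s)\<^sup>2) = sqrt (deriv2 \<eta> s) * cphi \<mu> s"
          using cphi_nonneg[OF mu, of s] True by (simp add: real_sqrt_mult)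
        thus ?thesis using elim True by simp
      qed simp
    qed
  qed
  have "cs_entropy \<mu> + dual_loss (deriv2 \<eta>) + ennreal (\<eta> 0) < \<infinity>"
    by (subst duality_identity[OF mu eta m1 pos]) (simp_all add: G S)
  hence fin: "cs_entropy \<mu> < \<infinity>" "dual_loss (deriv2 \<eta>) < \<infinity>" by auto
  from duality_gap[OF mu eta m1 pos fin]
  obtain G R where GR: "0 \<le> G" "0 \<le> R" "contact_loss \<mu> \<eta> = ennreal G" "slack \<mu> (deriv2 \<eta>) = ennreal R"
    and d: "\<exists>d. cs_dual \<xi> h \<eta> = ereal d \<and> cs_primal \<xi> h \<mu> = ereal (d + (G + R) / 2)" by metis
  have "G = 0" "R = 0" using GR \<open>contact_loss \<mu> \<eta> = 0\<close> S by (auto simp: ennreal_eq_0_iff)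
  thus ?thesis using d by auto
qed

end

section \<open>Existence of a primal minimizer\<close>

text \<open>The images of the measures on the real line are tight. A weak limit is concentrated on the unit
interval, as one sees by integrating the distance to the interval, so it restricts to the interval.\<close>

lemma Pr01_sequentially_compact:
  assumes nu: "\<And>n :: nat. \<nu> n \<in> Pr01"
  obtains \<mu> r where "\<mu> \<in> Pr01" "strict_mono (r :: nat \<Rightarrow> nat)"
    "\<And>f :: real \<Rightarrow> real. continuous_on {0..1} f \<Longrightarrow> (\<lambda>n. LINT x|\<nu> (r n). f x) \<longlonglongrightarrow> (LINT x|\<mu>. f x)"
proof -
  define N where "N = (\<lambda>n. distr (\<nu> n) borel (\<lambda>x. x))"
  have idm: "(\<lambda>x. x) \<in> borel_measurable (\<nu> n)" for n by (rule Pr01_measurable_id[OF nu])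
  have rd: "real_distribution (N n)" for n
  proof -
    interpret prob_space "\<nu> n" by (rule Pr01D[OF nu])
    show ?thesis unfolding N_def by (intro real_distribution_distr idm)
  qed
  have meas1: "measure (N n) {-1<..1} = 1" for n
  proof -
    interpret prob_space "\<nu> n" by (rule Pr01D[OF nu])
    have "(\<lambda>x. x) -` {-1<..1} \<inter> space (\<nu> n) = space (\<nu> n)" using Pr01D(3)[OF nu, of n] by auto
    thus ?thesis unfolding N_def by (subst measure_distr[OF idm]) (auto simp: prob_space)
  qed
  have "tight N"
    unfolding tight_def using rd meas1 by (intro conjI allI impI exI[of _ "-1"] exI[of _ 1]) auto
  from tight_imp_convergent_subsubsequence[OF this strict_mono_id]
  obtain r M where r: "strict_mono (r :: nat \<Rightarrow> nat)" and M: "real_distribution M" and wc: "weak_conv_m (N \<circ> id \<circ> r) M"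
    by blast
  have lim: "(\<lambda>n. LINT x|\<nu> (r n). f x) \<longlonglongrightarrow> (LINT x|M. f x)"
    if c: "\<And>x. isCont f x" and B: "\<And>x. norm (f x) \<le> B" for f :: "real \<Rightarrow> real" and B
  proof -
    have fm: "f \<in> borel_measurable borel"
      using c by (intro borel_measurable_continuous_onI continuous_at_imp_continuous_on) auto
    have "(\<lambda>n. integral\<^sup>L ((N \<circ> id \<circ> r) n) f) \<longlonglongrightarrow> integral\<^sup>L M f"
      by (rule weak_conv_imp_integral_bdd_continuous_conv[OF _ M wc c B]) (simp add: rd)
    thus ?thesis by (simp add: N_def integral_distr[OF idm fm])
  qed
  interpret M: real_distribution M by fact
  define cl where "cl = (\<lambda>x::real. max 0 (min 1 x))"
  have cl: "cl x \<in> {0..1}" "x \<in> {0..1} \<Longrightarrow> cl x = x" for x by (auto simp: cl_def)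
  have clc: "continuous_on UNIV cl" unfolding cl_def by (intro continuous_intros)
  have AE: "AE x in M. x \<in> {0..1}"
  proof -
    define u where "u = (\<lambda>x. min 1 \<bar>x - cl x\<bar>)"
    have uc: "isCont u x" for x
    proof -
      have "continuous_on UNIV u" unfolding u_def by (intro continuous_intros clc)
      thus ?thesis by (simp add: continuous_on_eq_continuous_at)
    qed
    have "(\<lambda>n. LINT x|\<nu> (r n). u x) \<longlonglongrightarrow> (LINT x|M. u x)" by (rule lim[OF uc, of 1]) (auto simp: u_def)
    moreover have "(LINT x|\<nu> (r n). u x) = 0" for n
      by (rule integral_eq_zero_AE) (use Pr01D(3)[OF nu] cl in \<open>auto simp: u_def\<close>)
    ultimately have z: "(LINT x|M. u x) = 0" by (simp add: LIMSEQ_const_iff)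
    have um: "u \<in> borel_measurable borel"
      using uc by (intro borel_measurable_continuous_onI continuous_at_imp_continuous_on) auto
    have "integrable M u" by (rule M.integrable_const_bound[of _ 1]) (use um in \<open>auto simp: u_def\<close>)
    hence "AE x in M. u x = 0" using z by (subst (asm) integral_nonneg_eq_0_iff_AE) (auto simp: u_def)
    thus ?thesis
    proof eventually_elim
      case (elim x)
      hence "x = cl x" by (auto simp: u_def min_def split: if_splits)
      thus ?case using cl(1)[of x] by simp
    qed
  qed
  \<comment> \<open>The limit measure gives full mass to the unit interval.\<close>
  define \<mu> where "\<mu> = restrict_space M {0..1}"
  have s01: "{0..1} \<inter> space M \<in> sets M" by simp
  have "emeasure M {0..1} = 1" using AE by (subst M.emeasure_eq_1_AE) auto
  hence "prob_space \<mu>"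
    unfolding \<mu>_def by (intro prob_spaceI) (simp add: emeasure_restrict_space space_restrict_space)
  moreover have "sets \<mu> = sets (restrict_space borel {0..1})"
    unfolding \<mu>_def by (rule sets_restrict_space_cong) simp
  ultimately have mu: "\<mu> \<in> Pr01" by (simp add: Pr01_def)
  have "(\<lambda>n. LINT x|\<nu> (r n). f x) \<longlonglongrightarrow> (LINT x|\<mu>. f x)" if f: "continuous_on {0..1} f" for f :: "real \<Rightarrow> real"
  proof -
    define F where "F = (\<lambda>x. f (cl x))"
    have FC: "continuous_on UNIV F"
      unfolding F_def by (rule continuous_on_compose2[OF f clc]) (use cl in auto)
    hence Fm: "F \<in> borel_measurable borel" by (rule borel_measurable_continuous_onI)
    obtain B where "\<And>r. r \<in> {0..1} \<Longrightarrow> \<bar>f r\<bar> \<le> B"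
      using compact_continuous_image[OF f compact_Icc] compact_imp_bounded bounded_iff
      by (metis imageI real_norm_def)
    hence "(\<lambda>n. LINT x|\<nu> (r n). F x) \<longlonglongrightarrow> (LINT x|M. F x)"
      using FC cl by (intro lim[of F B]) (auto simp: F_def continuous_on_eq_continuous_at)
    moreover have "(LINT x|\<nu> (r n). F x) = (LINT x|\<nu> (r n). f x)" for n
      by (rule Bochner_Integration.integral_cong) (use Pr01D(3)[OF nu] cl in \<open>auto simp: F_def\<close>)
    moreover have "(LINT x|M. F x) = (LINT x|\<mu>. F x)"
      unfolding \<mu>_def integral_restrict_space[OF s01]
    proof (rule integral_cong_AE)
      show "AE x in M. F x = indicat_real {0..1} x *\<^sub>R F x"
        using AE by (rule eventually_mono) simp
    qed (use Fm in simp_all)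
    moreover have "(LINT x|\<mu>. F x) = (LINT x|\<mu>. f x)"
      by (rule Bochner_Integration.integral_cong) (use Pr01D(3)[OF mu] cl in \<open>auto simp: F_def\<close>)
    ultimately show ?thesis by simp
  qed
  thus thesis using that mu r by blast
qed

text \<open>Writing the difference as \<open>(u - x) / (x u)\<close> makes the limit a limit of products also at \<open>x = 0\<close>, where
the value is infinite.\<close>

lemma entropy_integrand_tendsto:
  fixes p :: real
  assumes lim: "pn \<longlonglongrightarrow> p" and p: "0 \<le> p" "p \<le> u" and pn: "\<And>n. 0 \<le> pn n" "\<And>n. pn n \<le> u" and u: "0 < u"
  shows "(\<lambda>n. 1 / ennreal (pn n) - 1 / ennreal u) \<longlonglongrightarrow> 1 / ennreal p - 1 / ennreal u"
proof -
  have form: "1 / ennreal x - 1 / ennreal u = ennreal (u - x) * inverse (ennreal (x * u))"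
    if x: "0 \<le> x" "x \<le> u" for x
  proof (cases "x = 0")
    case True
    have "1 / ennreal u < top" using u by (simp add: divide_ennreal flip: ennreal_1)
    thus ?thesis using True u by (simp add: ennreal_mult_top ennreal_eq_0_iff)
  next
    case False
    hence "1 / ennreal x - 1 / ennreal u = ennreal (1 / x - 1 / u)"
      using x u by (simp add: divide_ennreal ennreal_minus flip: ennreal_1)
    also have "1 / x - 1 / u = (u - x) * inverse (x * u)" using False u by (simp add: field_simps)
    also have "ennreal \<dots> = ennreal (u - x) * ennreal (inverse (x * u))"
      using x u by (intro ennreal_mult) auto
    also have "ennreal (inverse (x * u)) = inverse (ennreal (x * u))"
      using x u False by (intro inverse_ennreal[symmetric]) auto
    finally show ?thesis .
  qed
  have "(\<lambda>n. ennreal (u - pn n) * inverse (ennreal (pn n * u))) \<longlonglongrightarrow> ennreal (u - p) * inverse (ennreal (p * u))"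
  proof (rule tendsto_mult_ennreal)
    show "(\<lambda>n. ennreal (u - pn n)) \<longlonglongrightarrow> ennreal (u - p)" by (intro tendsto_intros lim)
    have "(\<lambda>n. ennreal (pn n * u)) \<longlonglongrightarrow> ennreal (p * u)" by (intro tendsto_intros lim)
    moreover have "continuous_on UNIV (\<lambda>x::ennreal. inverse x)" by (intro continuous_on_inverse_ennreal continuous_on_id)
    ultimately show "(\<lambda>n. inverse (ennreal (pn n * u))) \<longlonglongrightarrow> inverse (ennreal (p * u))"
      using continuous_on_tendsto_compose[of UNIV "\<lambda>x::ennreal. inverse x"] by auto
    show "\<not> (ennreal (u - p) = 0 \<and> inverse (ennreal (p * u)) = \<infinity> \<or> ennreal (u - p) = \<infinity> \<and> inverse (ennreal (p * u)) = 0)"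
      using p u by (cases "p = 0") (auto simp: ennreal_eq_0_iff mult_le_0_iff)
  qed
  thus ?thesis using form p pn by simp
qed

context cs_model
begin

text \<open>Twice the primal functional. The finite part is put under the integral over the unit interval so
that Fatou's lemma applies to the whole functional at once.\<close>

definition "primal_total \<mu> = (\<integral>\<^sup>+s\<in>{0..1}. ((1 / ennreal (cphi \<mu> s) - 1 / ennreal (1 - s))
   + ennreal (\<xi> 1 - mean_xi \<mu> + h\<^sup>2 * cphi \<mu> 0)) \<partial>lborel)"

lemma mean_xi_le: "\<mu> \<in> Pr01 \<Longrightarrow> mean_xi \<mu> \<le> \<xi> 1"
proof -
  assume mu: "\<mu> \<in> Pr01"
  have "0 \<le> (LBINT s:{0..1}. xi2 s * cphi \<mu> s)"
    unfolding set_lebesgue_integral_def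
    by (rule Bochner_Integration.integral_nonneg) (use xi2_nonneg cphi_nonneg[OF mu] in \<open>auto simp: indicator_def\<close>)
  thus ?thesis using xi2_phi_integral(2)[OF mu] by simp
qed

lemma primal_total_eq:
  assumes mu: "\<mu> \<in> Pr01"
  shows "primal_total \<mu> = cs_entropy \<mu> + ennreal (\<xi> 1 - mean_xi \<mu> + h\<^sup>2 * cphi \<mu> 0)"
proof -
  note [measurable] = cphi_measurable[OF mu]
  show ?thesis unfolding primal_total_def cs_entropy_def
    by (subst nn_set_integral_add) (auto simp: nn_integral_cmult_indicator)
qed

lemma dirac_0_finite_entropy:
  defines "\<delta> \<equiv> return (restrict_space borel {0..1::real}) 0"
  shows "\<delta> \<in> Pr01" "cs_entropy \<delta> < \<infinity>"
proof -
  show d: "\<delta> \<in> Pr01" unfolding Pr01_def \<delta>_def by (auto intro!: prob_space_return simp: space_restrict_space)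
  have c: "cphi \<delta> s = 1 - s" if "s \<in> {0..1}" for s
    unfolding cphi_def \<delta>_def using that
    by (subst integral_return) (auto simp: space_restrict_space intro!: measurable_restrict_space1)
  have "cs_entropy \<delta> = 0"
    unfolding cs_entropy_def
  proof (rule nn_integral_zero')
    show "AE s in lborel. (1 / ennreal (cphi \<delta> s) - 1 / ennreal (1 - s)) * indicator {0..1} s = 0"
      using AE_lborel_singleton[of 1]
    proof eventually_elim
      case (elim s)
      have "1 / ennreal (1 - s) \<noteq> top" if "s < 1"
        using that by (simp add: divide_ennreal flip: ennreal_1)
      thus ?case using elim c[of s] by (cases "s \<in> {0..1}") auto
    qed
  qed
  thus "cs_entropy \<delta> < \<infinity>" by simp
qed

lemma exists_primal_minimizer:
  obtains \<mu> where "\<mu> \<in> Pr01" "cs_entropy \<mu> < \<infinity>" "\<And>\<nu>. \<nu> \<in> Pr01 \<Longrightarrow> primal_total \<mu> \<le> primal_total \<nu>"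
proof -
  have ne: "primal_total ` Pr01 \<noteq> {}" using dirac_0_finite_entropy(1) by auto
  obtain F where F: "decseq F" "range F \<subseteq> primal_total ` Pr01" "Inf (primal_total ` Pr01) = (INF i. F i)"
    using ennreal_Inf_countable_INF[OF ne] by blast
  have "\<forall>n. \<exists>\<nu>\<in>Pr01. F n = primal_total \<nu>" using F(2) by (auto simp: image_iff subset_eq)
  then obtain \<nu> where nu: "\<And>n. \<nu> n \<in> Pr01" and Fn: "\<And>n. F n = primal_total (\<nu> n)" by metis
  have Flim: "F \<longlonglongrightarrow> Inf (primal_total ` Pr01)" unfolding F(3) by (rule LIMSEQ_INF[OF F(1)])
  obtain \<mu> r where mu: "\<mu> \<in> Pr01" and r: "strict_mono (r :: nat \<Rightarrow> nat)"
    and lim: "\<And>f :: real \<Rightarrow> real. continuous_on {0..1} f \<Longrightarrow> (\<lambda>n. LINT x|\<nu> (r n). f x) \<longlonglongrightarrow> (LINT x|\<mu>. f x)"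
    by (rule Pr01_sequentially_compact[of \<nu>, OF nu]) (rule that)
  have phil: "(\<lambda>n. cphi (\<nu> (r n)) s) \<longlonglongrightarrow> cphi \<mu> s" for s
    unfolding cphi_def by (intro lim continuous_intros)
  have xil: "(\<lambda>n. mean_xi (\<nu> (r n))) \<longlonglongrightarrow> mean_xi \<mu>"
    unfolding mean_xi_def by (intro lim xi_cont)
  define I where "I = (\<lambda>\<mu> s. ((1 / ennreal (cphi \<mu> s) - 1 / ennreal (1 - s))
     + ennreal (\<xi> 1 - mean_xi \<mu> + h\<^sup>2 * cphi \<mu> 0)) * indicator {0..1} s)"
  have Im: "I (\<nu> n) \<in> borel_measurable lborel" for n
    using cphi_measurable[OF nu[of n]] unfolding I_def by measurable
  have "primal_total \<mu> = (\<integral>\<^sup>+s. I \<mu> s \<partial>lborel)" by (simp add: primal_total_def I_def)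
  also have "\<dots> = (\<integral>\<^sup>+s. liminf (\<lambda>n. I (\<nu> (r n)) s) \<partial>lborel)"
  proof (rule nn_integral_cong_AE)
    show "AE s in lborel. I \<mu> s = liminf (\<lambda>n. I (\<nu> (r n)) s)"
      using AE_lborel_singleton[of 1]
    proof eventually_elim
      case (elim s)
      have "(\<lambda>n. I (\<nu> (r n)) s) \<longlonglongrightarrow> I \<mu> s"
      proof (cases "s \<in> {0..1}")
        case True
        have "(\<lambda>n. (1 / ennreal (cphi (\<nu> (r n)) s) - 1 / ennreal (1 - s))
             + ennreal (\<xi> 1 - mean_xi (\<nu> (r n)) + h\<^sup>2 * cphi (\<nu> (r n)) 0))
          \<longlonglongrightarrow> (1 / ennreal (cphi \<mu> s) - 1 / ennreal (1 - s)) + ennreal (\<xi> 1 - mean_xi \<mu> + h\<^sup>2 * cphi \<mu> 0)"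
          by (intro tendsto_add entropy_integrand_tendsto phil tendsto_ennrealI tendsto_diff tendsto_mult tendsto_const xil)
            (use True elim cphi_nonneg[OF mu] cphi_nonneg[OF nu] cphi_le[OF mu] cphi_le[OF nu] in auto)
        thus ?thesis using True by (simp add: I_def)
      qed (simp add: I_def)
      thus ?case using lim_imp_Liminf[OF trivial_limit_sequentially] by metis
    qed
  qed
  also have "\<dots> \<le> liminf (\<lambda>n. \<integral>\<^sup>+s. I (\<nu> (r n)) s \<partial>lborel)" by (rule nn_integral_liminf[OF Im])
  also have "\<dots> = liminf (F \<circ> r)" by (simp add: Fn primal_total_def I_def comp_def)
  also have "\<dots> = Inf (primal_total ` Pr01)"
    by (rule lim_imp_Liminf[OF trivial_limit_sequentially LIMSEQ_subseq_LIMSEQ[OF Flim r]])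
  finally have le: "primal_total \<mu> \<le> primal_total \<nu>" if "\<nu> \<in> Pr01" for \<nu>
    using that by (meson INF_lower order_trans)
  have "primal_total \<mu> < \<infinity>"
    using le[OF dirac_0_finite_entropy(1)] dirac_0_finite_entropy(2) by (simp add: primal_total_eq[OF dirac_0_finite_entropy(1)] le_less_trans)
  hence "cs_entropy \<mu> < \<infinity>" by (simp add: primal_total_eq[OF mu])
  thus thesis using that mu le by blast
qed

end

section \<open>The first-order condition\<close>

text \<open>The mixture \<open>(1 - l) \<mu> + l \<delta>\<^sub>r\<close>, realized by a Bernoulli variable that decides between \<open>r\<close> and a
sample of \<open>\<mu>\<close>.\<close>

lemma Pr01_mix_dirac:
  assumes mu: "\<mu> \<in> Pr01" and r: "r \<in> {0..1}" and l: "0 \<le> l" "l \<le> 1"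
  obtains \<nu> where "\<nu> \<in> Pr01"
    "\<And>f :: real \<Rightarrow> real. continuous_on {0..1} f \<Longrightarrow> (LINT x|\<nu>. f x) = (1 - l) * (LINT x|\<mu>. f x) + l * f r"
proof -
  interpret mu: prob_space \<mu> by (rule Pr01D[OF mu])
  define B where "B = measure_pmf (bernoulli_pmf l)"
  interpret B: prob_space B unfolding B_def by (rule prob_space_measure_pmf)
  interpret P: pair_prob_space B \<mu> by unfold_locales
  define X where "X = (\<lambda>(b, x). if b then r else x)"
  have XR: "X \<in> B \<Otimes>\<^sub>M \<mu> \<rightarrow>\<^sub>M restrict_space borel {0..1}"
  proof (rule measurable_restrict_space2)
    show "X \<in> space (B \<Otimes>\<^sub>M \<mu>) \<rightarrow> {0..1}"
      using r by (auto simp: X_def space_pair_measure Pr01D(3)[OF mu])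
    have [measurable]: "(\<lambda>x. x) \<in> borel_measurable \<mu>" by (rule Pr01_measurable_id[OF mu])
    have [measurable]: "Measurable.pred B (\<lambda>b. b)" by (simp add: B_def)
    show "X \<in> borel_measurable (B \<Otimes>\<^sub>M \<mu>)" unfolding X_def by measurable
  qed
  define \<nu> where "\<nu> = distr (B \<Otimes>\<^sub>M \<mu>) (restrict_space borel {0..1}) X"
  have nu: "\<nu> \<in> Pr01" unfolding Pr01_def \<nu>_def by (auto intro!: P.prob_space_distr XR)
  have "(LINT x|\<nu>. f x) = (1 - l) * (LINT x|\<mu>. f x) + l * f r" if f: "continuous_on {0..1} f" for f :: "real \<Rightarrow> real"
  proof -
    have fm: "f \<in> borel_measurable (restrict_space borel {0..1})"
      by (rule borel_measurable_continuous_on_restrict[OF f])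
    have "integrable \<nu> f" by (rule Pr01_integrable_continuous_on[OF nu f])
    hence i: "integrable (B \<Otimes>\<^sub>M \<mu>) (\<lambda>x. f (X x))"
      unfolding \<nu>_def by (subst (asm) integrable_distr_eq[OF XR fm])
    have "(LINT x|\<nu>. f x) = (LINT x|(B \<Otimes>\<^sub>M \<mu>). f (X x))"
      unfolding \<nu>_def by (rule integral_distr[OF XR fm])
    also have "\<dots> = (LINT b|B. (LINT x|\<mu>. f (X (b, x))))"
      by (rule P.integral_fst'[OF i, symmetric])
    also have "\<dots> = (1 - l) * (LINT x|\<mu>. f x) + l * f r"
      unfolding B_def using l by (simp add: X_def mu.prob_space)
    finally show ?thesis .
  qed
  thus thesis using that nu by blast
qed

lemma ennreal_inverse_diff: "0 < p \<Longrightarrow> 0 < u \<Longrightarrow> 1 / ennreal p - 1 / ennreal u = ennreal (1 / p - 1 / u)"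
  by (simp add: divide_ennreal ennreal_minus flip: ennreal_1)

lemma variation_quotient:
  fixes p q u l :: real
  assumes p: "0 < p" "p \<le> u" and q: "0 \<le> q" "q \<le> u" and l: "0 < l" "l \<le> 1 / 2"
  defines "pl \<equiv> p + l * (q - p)"
  shows "p / 2 \<le> pl" "pl \<le> u" "- (2 / p) \<le> (q - p) / (p * pl)" "p \<le> q \<Longrightarrow> 0 \<le> (q - p) / (p * pl)"
    "1 / p - 1 / pl = l * ((q - p) / (p * pl))"
proof -
  have e: "pl = (1 - l) * p + l * q" by (simp add: pl_def algebra_simps)
  have "(1 / 2) * p \<le> (1 - l) * p" using p l by (intro mult_right_mono) auto
  moreover have "0 \<le> l * q" using l q by simp
  ultimately show pl: "p / 2 \<le> pl" unfolding e by linarith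
  hence pl0: "pl > 0" using p by simp
  have "(1 - l) * p + l * q \<le> (1 - l) * u + l * u" using p q l by (intro add_mono mult_left_mono) auto
  thus "pl \<le> u" unfolding e by (simp add: algebra_simps)
  have "- (2 / p) \<le> - (1 / pl)" using pl pl0 p by (simp add: field_simps)
  also have "- (1 / pl) = - p / (p * pl)" using p by simp
  also have "\<dots> \<le> (q - p) / (p * pl)" using q p pl0 by (intro divide_right_mono) auto
  finally show "- (2 / p) \<le> (q - p) / (p * pl)" .
  show "p \<le> q \<Longrightarrow> 0 \<le> (q - p) / (p * pl)" using p pl0 by simp
  have "1 / p - 1 / pl = (pl - p) / (p * pl)" using p pl0 by (simp add: field_simps)
  thus "1 / p - 1 / pl = l * ((q - p) / (p * pl))" by (simp add: pl_def)
qed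

context cs_model
begin

text \<open>The derivative at \<open>0\<close> of the affine part of twice the primal functional when \<open>\<mu>\<close> moves towards \<open>\<delta>\<^sub>r\<close>.\<close>

definition energy_variation :: "real measure \<Rightarrow> real \<Rightarrow> real" where
  "energy_variation \<mu> r = mean_xi \<mu> - \<xi> r + h\<^sup>2 * ((1 - r) - cphi \<mu> 0)"

context
  fixes \<mu> :: "real measure" and r :: real
  assumes mu: "\<mu> \<in> Pr01" and ent: "cs_entropy \<mu> < \<infinity>"
    and mini: "\<And>\<nu>. \<nu> \<in> Pr01 \<Longrightarrow> primal_total \<mu> \<le> primal_total \<nu>"
    and r: "r \<in> {0..<1}"
begin

text \<open>Minimality of \<open>\<mu>\<close> against the mixture with \<open>\<delta>\<^sub>r\<close>. The difference of the entropies is \<open>l\<close> times the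
integral of a difference quotient which is bounded below by \<open>- 2 / \<phi>(r)\<close>: for \<open>s < r\<close> because \<open>\<phi>\<close> is
nonincreasing, and for \<open>s \<ge> r\<close> because there \<open>\<phi>\<close> is at most the function \<open>1 - s\<close> of \<open>\<delta>\<^sub>r\<close>. Adding this
constant keeps all integrands nonnegative, uniformly in \<open>l\<close>.\<close>

lemma variation_bound:
  assumes l: "0 < l" "l \<le> 1 / 2"
  shows "(\<integral>\<^sup>+s\<in>{0..1}. ennreal (((1 - max r s) - cphi \<mu> s) / (cphi \<mu> s * (cphi \<mu> s + l * ((1 - max r s) - cphi \<mu> s)))
      + 2 / cphi \<mu> r) \<partial>lborel) \<le> ennreal (energy_variation \<mu> r + 2 / cphi \<mu> r)"
proof -
  note pos = cs_entropy_finite_imp(2)[OF mu ent]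
  note [measurable] = cphi_measurable[OF mu]
  obtain \<nu> where nu: "\<nu> \<in> Pr01"
    and int: "\<And>f :: real \<Rightarrow> real. continuous_on {0..1} f \<Longrightarrow> (LINT x|\<nu>. f x) = (1 - l) * (LINT x|\<mu>. f x) + l * f r"
    by (rule Pr01_mix_dirac[OF mu, of r l]) (use r l in auto)
  note [measurable] = cphi_measurable[OF nu]
  have cnu: "cphi \<nu> s = cphi \<mu> s + l * ((1 - max r s) - cphi \<mu> s)" for s
    unfolding cphi_def by (subst int) (auto intro!: continuous_intros simp: algebra_simps)
  have xnu: "mean_xi \<nu> = mean_xi \<mu> + l * (\<xi> r - mean_xi \<mu>)"
    unfolding mean_xi_def by (subst int[OF xi_cont]) (simp add: algebra_simps)
  \<comment> \<open>The constant that makes the difference quotient \<open>T\<close> nonnegative for every \<open>l \<le> 1/2\<close>.\<close>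
  define K where "K = 2 / cphi \<mu> r"
  have K: "K > 0" using pos[OF r] by (simp add: K_def)
  define T where "T = (\<lambda>s. ((1 - max r s) - cphi \<mu> s) / (cphi \<mu> s * cphi \<nu> s))"
  define J where "J = (\<integral>\<^sup>+s\<in>{0..1}. ennreal (T s + K) \<partial>lborel)"
  have T: "0 \<le> T s + K" "0 < cphi \<nu> s" "cphi \<nu> s \<le> 1 - s" "1 / cphi \<mu> s - 1 / cphi \<nu> s = l * T s"
    if s: "s \<in> {0..<1}" for s
  proof -
    have b: "0 < cphi \<mu> s" "cphi \<mu> s \<le> 1 - s" "0 \<le> 1 - max r s" "1 - max r s \<le> 1 - s"
      using pos[OF s] cphi_le[OF mu] r s by auto
    note v = variation_quotient[OF b l, folded cnu]
    show "0 < cphi \<nu> s" "cphi \<nu> s \<le> 1 - s" "1 / cphi \<mu> s - 1 / cphi \<nu> s = l * T s"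
      using v(1,2,5) b unfolding T_def by auto
    show "0 \<le> T s + K"
    proof (cases "s < r")
      case True
      have "2 / cphi \<mu> s \<le> K"
        unfolding K_def using cphi_antimono[OF mu, of s r] True pos[OF r] by (intro divide_left_mono) auto
      thus ?thesis using v(3) unfolding T_def by linarith
    next
      case False
      hence "0 \<le> T s" unfolding T_def using b by (intro v(4)) (auto simp: max_def)
      thus ?thesis using K by simp
    qed
  qed
  have "cs_entropy \<mu> + ennreal (l * K) = (\<integral>\<^sup>+s\<in>{0..1}. ((1 / ennreal (cphi \<mu> s) - 1 / ennreal (1 - s)) + ennreal (l * K)) \<partial>lborel)"
    unfolding cs_entropy_def by (subst nn_set_integral_add) (auto simp: nn_integral_cmult_indicator)
  also have "\<dots> = (\<integral>\<^sup>+s\<in>{0..1}. ((1 / ennreal (cphi \<nu> s) - 1 / ennreal (1 - s)) + ennreal l * ennreal (T s + K)) \<partial>lborel)"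
  proof (rule nn_integral_cong_AE)
    show "AE s in lborel. ((1 / ennreal (cphi \<mu> s) - 1 / ennreal (1 - s)) + ennreal (l * K)) * indicator {0..1} s
      = ((1 / ennreal (cphi \<nu> s) - 1 / ennreal (1 - s)) + ennreal l * ennreal (T s + K)) * indicator {0..1} s"
      using AE_lborel_singleton[of 1]
    proof eventually_elim
      case (elim s)
      show ?case
      proof (cases "s \<in> {0..1}")
        case True
        hence s: "s \<in> {0..<1}" using elim by auto
        note Ts = T[OF s] and ps = pos[OF s]
        have "0 \<le> 1 / cphi \<mu> s - 1 / (1 - s)" "0 \<le> 1 / cphi \<nu> s - 1 / (1 - s)"
          using Ts ps cphi_le[OF mu, of s] by (auto intro!: divide_left_mono)
        note nonneg = this
        have "ennreal (1 / cphi \<mu> s - 1 / (1 - s)) + ennreal (l * K) = ennreal (1 / cphi \<mu> s - 1 / (1 - s) + l * K)"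
          using nonneg K l by (intro ennreal_plus[symmetric]) auto
        also have "1 / cphi \<mu> s - 1 / (1 - s) + l * K = 1 / cphi \<nu> s - 1 / (1 - s) + l * (T s + K)"
          using Ts(4) by (simp add: algebra_simps)
        also have "ennreal \<dots> = ennreal (1 / cphi \<nu> s - 1 / (1 - s)) + ennreal (l * (T s + K))"
          using nonneg Ts(1) l by (intro ennreal_plus) auto
        finally have "ennreal (1 / cphi \<mu> s - 1 / (1 - s)) + ennreal (l * K) =
          ennreal (1 / cphi \<nu> s - 1 / (1 - s)) + ennreal (l * (T s + K))" .
        thus ?thesis using s Ts(1,2) ps l K by (simp add: ennreal_inverse_diff ennreal_mult)
      qed simp
    qed
  qed
  also have "\<dots> = cs_entropy \<nu> + ennreal l * J"
    unfolding cs_entropy_def J_def T_def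
    by (subst nn_set_integral_add) (auto simp: nn_integral_cmult[symmetric] mult.assoc)
  finally have eq: "cs_entropy \<mu> + ennreal (l * K) = cs_entropy \<nu> + ennreal l * J" .
  obtain a where a: "cs_entropy \<mu> = ennreal a" "0 \<le> a" using ent by (cases "cs_entropy \<mu>") auto
  have "cs_entropy \<nu> + ennreal l * J < \<infinity>" unfolding eq[symmetric] a by simp
  hence fin: "cs_entropy \<nu> < \<infinity>" "ennreal l * J < \<infinity>" by auto
  obtain a' where a': "cs_entropy \<nu> = ennreal a'" "0 \<le> a'" using fin(1) by (cases "cs_entropy \<nu>") auto
  obtain j where j: "J = ennreal j" "0 \<le> j" using fin(2) l by (cases J) (auto simp: ennreal_mult_top)
  have "ennreal (a + l * K) = ennreal (a' + l * j)"
    using eq a a' j l K by (simp add: ennreal_mult)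
  hence e1: "a + l * K = a' + l * j" by (subst (asm) ennreal_inj) (use a a' j l K in auto)
  have n: "0 \<le> \<xi> 1 - mean_xi \<rho> + h\<^sup>2 * cphi \<rho> 0" if "\<rho> \<in> Pr01" for \<rho>
    using mean_xi_le[OF that] cphi_nonneg[OF that, of 0] by simp
  have "ennreal (a + (\<xi> 1 - mean_xi \<mu> + h\<^sup>2 * cphi \<mu> 0)) \<le> ennreal (a' + (\<xi> 1 - mean_xi \<nu> + h\<^sup>2 * cphi \<nu> 0))"
    using mini[OF nu] n[OF mu] n[OF nu] a a' unfolding primal_total_eq[OF mu] primal_total_eq[OF nu] by simp
  hence "a + (\<xi> 1 - mean_xi \<mu> + h\<^sup>2 * cphi \<mu> 0) \<le> a' + (\<xi> 1 - mean_xi \<nu> + h\<^sup>2 * cphi \<nu> 0)"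
    by (subst (asm) ennreal_le_iff) (use a' n[OF nu] in auto)
  hence "l * j \<le> l * (energy_variation \<mu> r + K)"
    using e1 max_absorb1[of 0 r] r unfolding xnu cnu energy_variation_def by (simp add: algebra_simps)
  hence "j \<le> energy_variation \<mu> r + K" using l by simp
  thus ?thesis using j unfolding J_def T_def cnu K_def by (simp add: ennreal_leI)
qed

lemma variation_limit:
  "(\<integral>\<^sup>+s\<in>{0..1}. ennreal (((1 - max r s) - cphi \<mu> s) / (cphi \<mu> s)\<^sup>2 + 2 / cphi \<mu> r) \<partial>lborel)
    \<le> ennreal (energy_variation \<mu> r + 2 / cphi \<mu> r)"
proof -
  note pos = cs_entropy_finite_imp(2)[OF mu ent]
  note [measurable] = cphi_measurable[OF mu]
  define I where "I = (\<lambda>l s. ennreal (((1 - max r s) - cphi \<mu> s) / (cphi \<mu> s * (cphi \<mu> s + l * ((1 - max r s) - cphi \<mu> s)))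
      + 2 / cphi \<mu> r) * indicator {0..1} s)"
  have Im: "I l \<in> borel_measurable lborel" for l unfolding I_def by measurable
  define l where "l = (\<lambda>n. 1 / (real n + 2))"
  have "(\<integral>\<^sup>+s\<in>{0..1}. ennreal (((1 - max r s) - cphi \<mu> s) / (cphi \<mu> s)\<^sup>2 + 2 / cphi \<mu> r) \<partial>lborel)
    = (\<integral>\<^sup>+s. liminf (\<lambda>n. I (l n) s) \<partial>lborel)"
  proof (rule nn_integral_cong_AE)
    show "AE s in lborel. ennreal (((1 - max r s) - cphi \<mu> s) / (cphi \<mu> s)\<^sup>2 + 2 / cphi \<mu> r) * indicator {0..1} s
      = liminf (\<lambda>n. I (l n) s)"
      using AE_lborel_singleton[of 1]
    proof eventually_elim
      case (elim s)
      define X where "X = ennreal (((1 - max r s) - cphi \<mu> s) / (cphi \<mu> s)\<^sup>2 + 2 / cphi \<mu> r) * indicator {0..1} s"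
      have "(\<lambda>n. I (l n) s) \<longlonglongrightarrow> X"
      proof (cases "s \<in> {0..1}")
        case True
        hence p: "0 < cphi \<mu> s" using pos[of s] elim by auto
        have "l \<longlonglongrightarrow> 0" unfolding l_def by real_asymp
        hence "(\<lambda>n. ennreal (((1 - max r s) - cphi \<mu> s) / (cphi \<mu> s * (cphi \<mu> s + l n * ((1 - max r s) - cphi \<mu> s))) + 2 / cphi \<mu> r))
          \<longlonglongrightarrow> ennreal (((1 - max r s) - cphi \<mu> s) / (cphi \<mu> s * (cphi \<mu> s + 0 * ((1 - max r s) - cphi \<mu> s))) + 2 / cphi \<mu> r)"
          by (intro tendsto_intros) (use p in auto)
        thus ?thesis using True by (simp add: I_def X_def power2_eq_square)
      qed (simp add: I_def X_def)
      thus ?case unfolding X_def[symmetric] using lim_imp_Liminf[OF trivial_limit_sequentially] by metis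
    qed
  qed
  also have "\<dots> \<le> liminf (\<lambda>n. \<integral>\<^sup>+s. I (l n) s \<partial>lborel)" by (rule nn_integral_liminf[OF Im])
  also have "\<dots> \<le> liminf (\<lambda>n::nat. ennreal (energy_variation \<mu> r + 2 / cphi \<mu> r))"
  proof (rule Liminf_mono, intro always_eventually allI)
    fix n show "(\<integral>\<^sup>+s. I (l n) s \<partial>lborel) \<le> ennreal (energy_variation \<mu> r + 2 / cphi \<mu> r)"
      unfolding I_def by (rule variation_bound) (auto simp: l_def field_simps)
  qed
  also have "\<dots> = ennreal (energy_variation \<mu> r + 2 / cphi \<mu> r)" by (simp add: Liminf_const)
  finally show ?thesis .
qed

end

text \<open>The second derivative \<open>1/\<phi>\<^sup>2\<close> that complementary slackness prescribes for the dual optimizer.\<close>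

definition opt_density :: "real measure \<Rightarrow> real \<Rightarrow> real" where
  "opt_density \<mu> s = (if s \<in> {0..<1} then 1 / (cphi \<mu> s)\<^sup>2 else 0)"

lemma opt_density_measurable: "\<mu> \<in> Pr01 \<Longrightarrow> opt_density \<mu> \<in> borel_measurable borel"
  using cphi_measurable unfolding opt_density_def[abs_def] by measurable

lemma opt_density_nonneg: "0 \<le> opt_density \<mu> s"
  by (simp add: opt_density_def)

lemma opt_density_continuous:
  assumes mu: "\<mu> \<in> Pr01" and ent: "cs_entropy \<mu> < \<infinity>" and b: "b < 1"
  shows "continuous_on {0..b} (opt_density \<mu>)"
proof -
  have "continuous_on {0..b} (\<lambda>s. 1 / (cphi \<mu> s)\<^sup>2)"
  proof (intro continuous_intros cphi_continuous[OF mu] ballI)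
    fix s assume "s \<in> {0..b}"
    hence "0 < cphi \<mu> s" using cs_entropy_finite_imp(2)[OF mu ent, of s] b by auto
    thus "(cphi \<mu> s)\<^sup>2 \<noteq> 0" by simp
  qed
  thus ?thesis by (rule continuous_on_cong[THEN iffD1, rotated 2]) (use b in \<open>auto simp: opt_density_def\<close>)
qed

lemma opt_density_le:
  assumes mu: "\<mu> \<in> Pr01" and ent: "cs_entropy \<mu> < \<infinity>" and b: "b \<in> {0..<1}" and s: "s \<le> b"
  shows "opt_density \<mu> s \<le> 1 / (cphi \<mu> b)\<^sup>2"
proof -
  have "0 < cphi \<mu> b" using cs_entropy_finite_imp(2)[OF mu ent b] .
  thus ?thesis unfolding opt_density_def using cphi_antimono[OF mu s]
    by (auto intro!: divide_left_mono power_mono mult_pos_pos)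
qed

text \<open>The real-valued form of \<open>wedge (opt_density \<mu>)\<close> on \<open>[0, 1)\<close>.\<close>

definition opt_wedge :: "real measure \<Rightarrow> real \<Rightarrow> real" where
  "opt_wedge \<mu> r = (LBINT s:{0..r}. (r - s) * opt_density \<mu> s)"

lemma opt_density_set_integrable:
  assumes mu: "\<mu> \<in> Pr01" and ent: "cs_entropy \<mu> < \<infinity>" and r: "r < 1"
  shows "set_integrable lborel {0..r} (opt_density \<mu>)"
  by (intro borel_integrable_atLeastAtMost' opt_density_continuous assms)

lemma wedge_opt_density:
  assumes mu: "\<mu> \<in> Pr01" and ent: "cs_entropy \<mu> < \<infinity>" and r: "r \<in> {0..<1}"
  shows "wedge (opt_density \<mu>) r = ennreal (opt_wedge \<mu> r)" "0 \<le> opt_wedge \<mu> r"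
proof -
  note w = wedge_eq[OF opt_density_measurable[OF mu] opt_density_set_integrable[OF mu ent, of r], folded opt_wedge_def]
  show "wedge (opt_density \<mu>) r = ennreal (opt_wedge \<mu> r)" "0 \<le> opt_wedge \<mu> r"
    by (rule w; use r opt_density_nonneg in auto)+
qed

text \<open>With \<open>g = 1/\<phi>\<^sup>2\<close>, the limiting variation integrates \<open>g\<close> against the difference of \<open>1 - s - \<phi>(s)\<close> and
\<open>max 0 (r - s)\<close>, that is, it compares the \<open>\<mu>\<close>-mean of the double integral \<open>w\<close> of \<open>g\<close> with \<open>w(r)\<close>. The
comparison also shows that this mean is finite. Subtracting the corresponding expressions
for \<open>\<xi>\<close> and \<open>h\<^sup>2\<close> shows that \<open>w(r) - h\<^sup>2 r - \<xi>(r)\<close> is at least its own mean \<open>m\<close>; a function that is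
nowhere below its mean is almost everywhere equal to it.\<close>

lemma first_order_condition:
  assumes mu: "\<mu> \<in> Pr01" and ent: "cs_entropy \<mu> < \<infinity>"
    and mini: "\<And>\<nu>. \<nu> \<in> Pr01 \<Longrightarrow> primal_total \<mu> \<le> primal_total \<nu>"
  obtains m where "\<And>r. r \<in> {0..<1} \<Longrightarrow> m \<le> opt_wedge \<mu> r - h\<^sup>2 * r - \<xi> r"
    "AE r in \<mu>. r \<in> {0..<1} \<and> opt_wedge \<mu> r - h\<^sup>2 * r - \<xi> r = m"
proof -
  interpret prob_space \<mu> by (rule Pr01D[OF mu])
  note pos = cs_entropy_finite_imp(2)[OF mu ent]
  note [measurable] = cphi_measurable[OF mu] opt_density_measurable[OF mu]
  define W where "W = (\<integral>\<^sup>+r. wedge (opt_density \<mu>) r \<partial>\<mu>)"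
  have le: "W + ennreal (2 / cphi \<mu> r) \<le> ennreal (opt_wedge \<mu> r) + ennreal (energy_variation \<mu> r + 2 / cphi \<mu> r)"
    if r: "r \<in> {0..<1}" for r
  proof -
    define K where "K = 2 / cphi \<mu> r"
    have K: "K > 0" using pos[OF r] by (simp add: K_def)
    have "W + ennreal K = (\<integral>\<^sup>+s\<in>{0..1}. (ennreal (opt_density \<mu> s * (1 - s - cphi \<mu> s)) + ennreal K) \<partial>lborel)"
      unfolding W_def nn_integral_wedge[OF mu opt_density_measurable[OF mu]]
      by (subst nn_set_integral_add) (auto simp: nn_integral_cmult_indicator)
    also have "\<dots> \<le> (\<integral>\<^sup>+s\<in>{0..1}. (ennreal (opt_density \<mu> s * max 0 (r - s)) + ennreal (((1 - max r s) - cphi \<mu> s) / (cphi \<mu> s)\<^sup>2 + K)) \<partial>lborel)"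
    proof (rule nn_integral_mono_AE)
      show "AE s in lborel. (ennreal (opt_density \<mu> s * (1 - s - cphi \<mu> s)) + ennreal K) * indicator {0..1} s
        \<le> (ennreal (opt_density \<mu> s * max 0 (r - s)) + ennreal (((1 - max r s) - cphi \<mu> s) / (cphi \<mu> s)\<^sup>2 + K)) * indicator {0..1} s"
        using AE_lborel_singleton[of 1]
      proof eventually_elim
        case (elim s)
        show ?case
        proof (cases "s \<in> {0..1}")
          case True
          hence s: "s \<in> {0..<1}" using elim by auto
          have d: "opt_density \<mu> s = 1 / (cphi \<mu> s)\<^sup>2" using s by (simp add: opt_density_def)
          have sub: "ennreal (x + y) \<le> ennreal x + ennreal y" for x y :: real
            by (auto simp: ennreal_plus_if intro: ennreal_leI)
          have "ennreal (opt_density \<mu> s * (1 - s - cphi \<mu> s)) + ennreal K = ennreal (opt_density \<mu> s * (1 - s - cphi \<mu> s) + K)"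
            using K cphi_le[OF mu, of s] opt_density_nonneg[of \<mu> s] by (intro ennreal_plus[symmetric]) auto
          also have "opt_density \<mu> s * (1 - s - cphi \<mu> s) + K
            = opt_density \<mu> s * max 0 (r - s) + (((1 - max r s) - cphi \<mu> s) / (cphi \<mu> s)\<^sup>2 + K)"
            unfolding d by (simp add: diff_divide_distrib[symmetric] add_divide_distrib[symmetric] max_def)
          also note sub
          finally show ?thesis using True by simp
        qed simp
      qed
    qed
    also have "\<dots> = wedge (opt_density \<mu>) r + (\<integral>\<^sup>+s\<in>{0..1}. ennreal (((1 - max r s) - cphi \<mu> s) / (cphi \<mu> s)\<^sup>2 + K) \<partial>lborel)"
      unfolding wedge_def by (subst nn_set_integral_add) auto
    also have "\<dots> \<le> ennreal (opt_wedge \<mu> r) + ennreal (energy_variation \<mu> r + K)"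
      unfolding K_def wedge_opt_density(1)[OF mu ent r]
      by (intro add_left_mono variation_limit[OF mu ent mini r])
    finally show ?thesis unfolding K_def .
  qed
  have "W + ennreal (2 / cphi \<mu> 0) < \<infinity>" by (rule le_less_trans[OF le[of 0]]) auto
  then obtain w where w: "W = ennreal w" "0 \<le> w" by (cases W) auto
  define m where "m = w - mean_xi \<mu> - h\<^sup>2 * (1 - cphi \<mu> 0)"
  have m: "m \<le> opt_wedge \<mu> r - h\<^sup>2 * r - \<xi> r" if r: "r \<in> {0..<1}" for r
  proof -
    define K where "K = 2 / cphi \<mu> r"
    have K: "K > 0" using pos[OF r] by (simp add: K_def)
    have ow: "0 \<le> opt_wedge \<mu> r" by (rule wedge_opt_density(2)[OF mu ent r])
    have l: "ennreal (w + K) \<le> ennreal (opt_wedge \<mu> r) + ennreal (energy_variation \<mu> r + K)"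
      using le[OF r] w K unfolding K_def[symmetric] by simp
    have "0 \<le> energy_variation \<mu> r + K"
    proof (rule ccontr)
        \<comment> \<open>Otherwise the integral bounded by \<open>variation_limit\<close> vanishes, but its integrand is at least \<open>K\<close> on \<open>(r, 1)\<close>.\<close>
    assume neg: "\<not> 0 \<le> energy_variation \<mu> r + K"
        hence "(\<integral>\<^sup>+s\<in>{0..1}. ennreal (((1 - max r s) - cphi \<mu> s) / (cphi \<mu> s)\<^sup>2 + K) \<partial>lborel) = 0"
          using variation_limit[OF mu ent mini r] unfolding K_def[symmetric] by (simp add: ennreal_neg)
        hence "AE s in lborel. ennreal (((1 - max r s) - cphi \<mu> s) / (cphi \<mu> s)\<^sup>2 + K) * indicator {0..1} s = 0"
          by (subst (asm) nn_integral_0_iff_AE) auto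
        hence "AE s in lborel. s \<notin> {r<..<1}"
        proof eventually_elim
          case (elim s)
          show ?case
          proof
            assume s: "s \<in> {r<..<1}"
            hence "0 \<le> ((1 - max r s) - cphi \<mu> s) / (cphi \<mu> s)\<^sup>2"
              using cphi_le[OF mu, of s] by (intro divide_nonneg_nonneg) (auto simp: max_def)
            thus False using elim s r K by (auto simp: ennreal_eq_0_iff)
          qed
        qed
        hence "{r<..<1} \<in> null_sets lborel" by (subst AE_iff_null_sets) auto
        hence "emeasure lborel {r<..<1} = 0" by (rule null_setsD1)
        thus False using r by (simp add: ennreal_eq_0_iff)
    qed
    hence "ennreal (w + K) \<le> ennreal (opt_wedge \<mu> r + (energy_variation \<mu> r + K))" using l ow by simp
    hence "w + K \<le> opt_wedge \<mu> r + (energy_variation \<mu> r + K)"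
      by (subst (asm) ennreal_le_iff) (use ow \<open>0 \<le> energy_variation \<mu> r + K\<close> in auto)
    thus ?thesis unfolding energy_variation_def m_def by (simp add: algebra_simps)
  qed
  have AE1: "AE r in \<mu>. r \<in> {0..<1}" by (rule Pr01_AE_less_1[OF mu cs_entropy_finite_imp(1)[OF mu ent]])
  \<comment> \<open>A version of \<open>opt_wedge \<mu>\<close> that is visibly measurable.\<close>
  define v where "v = (\<lambda>r. enn2real (wedge (opt_density \<mu>) r))"
  have wm[measurable]: "wedge (opt_density \<mu>) \<in> borel_measurable \<mu>"
    by (rule Pr01_measurable[OF mu wedge_measurable[OF opt_density_measurable[OF mu]]])
  have vm: "v \<in> borel_measurable \<mu>" unfolding v_def by measurable
  have AEv: "AE r in \<mu>. r \<in> {0..<1} \<and> v r = opt_wedge \<mu> r \<and> wedge (opt_density \<mu>) r = ennreal (v r)"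
    using AE1
  proof eventually_elim
    case (elim r) thus ?case using wedge_opt_density[OF mu ent elim] by (simp add: v_def)
  qed
  have nv: "(\<integral>\<^sup>+r. ennreal (v r) \<partial>\<mu>) = ennreal w"
    unfolding w(1)[symmetric] W_def by (rule nn_integral_cong_AE) (use AEv in \<open>auto elim: eventually_mono\<close>)
  have v0: "0 \<le> v r" for r by (simp add: v_def)
  have iv: "integrable \<mu> v" by (rule integrableI_nonneg[OF vm]) (use nv v0 in auto)
  have ev: "(LINT r|\<mu>. v r) = w"
    by (subst integral_eq_nn_integral[OF vm]) (use nv v0 w in auto)
  have ii: "integrable \<mu> (\<lambda>r. h\<^sup>2 * r)" by (rule Pr01_integrable_continuous_on[OF mu]) (intro continuous_intros)
  have ix: "integrable \<mu> \<xi>" by (rule Pr01_integrable_continuous_on[OF mu xi_cont])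
  have "(LINT r|\<mu>. v r - h\<^sup>2 * r - \<xi> r - m) = w - h\<^sup>2 * (1 - cphi \<mu> 0) - mean_xi \<mu> - m"
    using iv ii ix ev cphi_0[OF mu] by (simp add: mean_xi_def prob_space)
  hence z: "(LINT r|\<mu>. v r - h\<^sup>2 * r - \<xi> r - m) = 0" by (simp add: m_def)
  have "AE r in \<mu>. v r - h\<^sup>2 * r - \<xi> r - m = 0"
  proof (rule integral_nonneg_eq_0_iff_AE[THEN iffD1, OF _ _ z])
    show "integrable \<mu> (\<lambda>r. v r - h\<^sup>2 * r - \<xi> r - m)" using iv ii ix by auto
    show "AE r in \<mu>. 0 \<le> v r - h\<^sup>2 * r - \<xi> r - m"
      using AEv by eventually_elim (use m in fastforce)
  qed
  hence "AE r in \<mu>. r \<in> {0..<1} \<and> opt_wedge \<mu> r - h\<^sup>2 * r - \<xi> r = m"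
    using AEv by eventually_elim auto
  thus thesis using that m by blast
qed

end

context cs_model
begin

section \<open>The dual optimizer and uniqueness\<close>

definition opt_eta :: "real measure \<Rightarrow> real \<Rightarrow> real \<Rightarrow> real" where
  "opt_eta \<mu> m = restrict (\<lambda>r. opt_wedge \<mu> r - h\<^sup>2 * r - m) {0..<1}"

lemma opt_eta_deriv1:
  assumes mu: "\<mu> \<in> Pr01" and ent: "cs_entropy \<mu> < \<infinity>"
  defines "v \<equiv> \<lambda>t. integral {0..t} (opt_density \<mu>)"
  assumes x: "x \<in> {0..<1}"
  shows "(opt_eta \<mu> m has_vector_derivative v x - h\<^sup>2) (at x within {0..<1})"
    "(v has_vector_derivative opt_density \<mu> x) (at x within {0..<1})"
    "deriv1 (opt_eta \<mu> m) x = v x - h\<^sup>2"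
proof -
  define b where "b = (x + 1) / 2"
  have b: "0 \<le> x" "x < b" "b < 1" using x by (auto simp: b_def)
  have at: "at x within {0..<1} = at x within {0..b}"
    by (rule at_within_nhd[of x "{..<b}"]) (use b in auto)
  have gc: "continuous_on {0..b} (opt_density \<mu>)" by (rule opt_density_continuous[OF mu ent b(3)])
  have dv: "(v has_vector_derivative opt_density \<mu> y) (at y within {0..b})" if "y \<in> {0..b}" for y
    unfolding v_def by (rule integral_has_vector_derivative[OF gc that])
  show dv': "(v has_vector_derivative opt_density \<mu> x) (at x within {0..<1})"
    unfolding at by (rule dv) (use b in auto)
  have vc: "continuous_on {0..b} v"
    using dv by (intro continuous_on_vector_derivative) auto
  have ow: "opt_wedge \<mu> r = integral {0..r} v" if r: "r \<in> {0..b}" for r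
  proof -
    have i: "set_integrable lborel {0..t} (opt_density \<mu>)" if "t \<in> {0..r}" for t
      using opt_density_set_integrable[OF mu ent, of t] that r b by auto
    have "opt_wedge \<mu> r = (LBINT t:{0..r}. (LBINT s:{0..t}. opt_density \<mu> s))"
      unfolding opt_wedge_def
      by (rule iterated_integral_Icc(1)[symmetric, OF opt_density_measurable[OF mu] i]) (use r in auto)
    also have "\<dots> = (LBINT t:{0..r}. v t)"
      by (rule set_lebesgue_integral_cong) (use i in \<open>auto simp: v_def set_borel_integral_eq_integral(2)\<close>)
    also have "\<dots> = integral {0..r} v"
      by (intro set_borel_integral_eq_integral(2) borel_integrable_atLeastAtMost' continuous_on_subset[OF vc]) (use r in auto)
    finally show ?thesis .
  qed
  have "((\<lambda>r. integral {0..r} v) has_vector_derivative v x) (at x within {0..b})"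
    by (rule integral_has_vector_derivative[OF vc]) (use b in auto)
  moreover have "((\<lambda>r. h\<^sup>2 * r + m) has_vector_derivative h\<^sup>2) (at x within {0..b})"
    unfolding has_real_derivative_iff_has_vector_derivative[symmetric]
    by (auto intro!: derivative_eq_intros)
  ultimately have "((\<lambda>r. integral {0..r} v - (h\<^sup>2 * r + m)) has_vector_derivative v x - h\<^sup>2) (at x within {0..b})"
    by (rule has_vector_derivative_diff)
  hence "(opt_eta \<mu> m has_vector_derivative v x - h\<^sup>2) (at x within {0..b})"
    by (rule has_vector_derivative_transform[rotated 2]) (use b ow in \<open>auto simp: opt_eta_def\<close>)
  thus d: "(opt_eta \<mu> m has_vector_derivative v x - h\<^sup>2) (at x within {0..<1})" unfolding at .
  have "at x within {0..b} \<noteq> bot" using b by (simp add: at_within_Icc_at_right trivial_limit_within islimpt_Icc)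
  thus "deriv1 (opt_eta \<mu> m) x = v x - h\<^sup>2"
    unfolding deriv1_def using d at by (intro vector_derivative_within) auto
qed

lemma opt_eta_spaceX:
  assumes mu: "\<mu> \<in> Pr01" and ent: "cs_entropy \<mu> < \<infinity>"
  shows "opt_eta \<mu> m \<in> spaceX"
proof -
  define v where "v = (\<lambda>t. integral {0..t} (opt_density \<mu>))"
  note d = opt_eta_deriv1[OF mu ent, folded v_def]
  have dv: "(deriv1 (opt_eta \<mu> m) has_vector_derivative opt_density \<mu> x) (at x within {0..<1})" if x: "x \<in> {0..<1}" for x
  proof -
    have "((\<lambda>x. v x - h\<^sup>2) has_vector_derivative opt_density \<mu> x) (at x within {0..<1})"
      using has_vector_derivative_diff[OF d(2)[OF x] has_vector_derivative_const] by simp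
    thus ?thesis by (rule has_vector_derivative_transform[rotated 2]) (use x d(3) in \<open>auto simp: v_def\<close>)
  qed
  have "continuous_on {0..<1} (deriv1 (opt_eta \<mu> m))"
    using dv by (rule continuous_on_vector_derivative)
  moreover have "opt_eta \<mu> m differentiable_on {0..<1}"
    unfolding differentiable_on_def differentiable_def using d(1)[unfolded has_vector_derivative_def] by blast
  moreover have "locally_lipschitz_on {0..<1} (deriv1 (opt_eta \<mu> m))"
    unfolding locally_lipschitz_on_def
  proof
    fix t :: real assume t: "t \<in> {0..<1}"
    \<comment> \<open>Around \<open>t\<close> one can move by half the distance to \<open>1\<close>, where \<open>1/\<phi>\<^sup>2\<close> is still bounded.\<close>
    define u where "u = (1 - t) / 2"
    have u: "u > 0" "t + u \<in> {0..<1}" using t by (auto simp: u_def field_simps)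
    define C where "C = 1 / (cphi \<mu> (t + u))\<^sup>2"
    have "C-lipschitz_on (cball t u \<inter> {0..<1}) (deriv1 (opt_eta \<mu> m))"
    proof (rule bounded_derivative_imp_lipschitz)
      fix x assume x: "x \<in> cball t u \<inter> {0..<1}"
      show "(deriv1 (opt_eta \<mu> m) has_derivative (\<lambda>h. h *\<^sub>R opt_density \<mu> x)) (at x within cball t u \<inter> {0..<1})"
        using dv[of x] x unfolding has_vector_derivative_def by (auto intro: has_derivative_subset)
      have "opt_density \<mu> x \<le> C"
        unfolding C_def by (rule opt_density_le[OF mu ent u(2)]) (use x in \<open>auto simp: dist_real_def\<close>)
      hence "norm (y *\<^sub>R opt_density \<mu> x) \<le> C * norm y" for y
        using mult_right_mono[of "opt_density \<mu> x" C "\<bar>y\<bar>"]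
        by (simp add: abs_mult opt_density_nonneg mult.commute)
      thus "onorm (\<lambda>h. h *\<^sub>R opt_density \<mu> x) \<le> C" by (rule onorm_le)
    next
      show "convex (cball t u \<inter> {0..<1})" by (intro convex_Int) auto
      show "0 \<le> C" by (simp add: C_def)
    qed
    thus "\<exists>u>0. \<exists>L. L-lipschitz_on (cball t u \<inter> {0..<1}) (deriv1 (opt_eta \<mu> m))" using u by blast
  qed
  ultimately show ?thesis unfolding spaceX_def by (simp add: opt_eta_def)
qed

lemma opt_eta_deriv2:
  assumes mu: "\<mu> \<in> Pr01" and ent: "cs_entropy \<mu> < \<infinity>"
  shows "AE s in lborel. s \<in> {0..1} \<longrightarrow> deriv2 (opt_eta \<mu> m) s = opt_density \<mu> s"
proof (rule deriv2_is_distr_deriv2(2))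
  show "is_distr_deriv2 (opt_eta \<mu> m) (opt_density \<mu>)"
  proof (rule is_distr_deriv2I[OF opt_density_measurable[OF mu]])
    show "locally_ess_bounded (opt_density \<mu>)"
      unfolding locally_ess_bounded_def
    proof (intro allI impI)
      fix \<delta> :: real assume \<delta>: "\<delta> > 0"
      show "\<exists>C. AE s in lborel. s \<in> {0..1 - \<delta>} \<longrightarrow> \<bar>opt_density \<mu> s\<bar> \<le> C"
      proof (intro exI AE_I2 impI)
        fix s assume s: "s \<in> {0..1 - \<delta>}"
        show "\<bar>opt_density \<mu> s\<bar> \<le> 1 / (cphi \<mu> (1 - \<delta>))\<^sup>2"
          using opt_density_le[OF mu ent, of "1 - \<delta>" s] opt_density_nonneg[of \<mu> s] s \<delta> by auto
      qed
    qed
    show "opt_eta \<mu> m r = - m + (- h\<^sup>2) * r + (LBINT s:{0..r}. (r - s) * opt_density \<mu> s)" if "r \<in> {0..<1}" for r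
      using that by (simp add: opt_eta_def opt_wedge_def)
  qed
qed

lemma exists_complementary_pair:
  "\<exists>\<mu>\<in>Pr01. \<exists>\<eta>\<in>Lambda \<xi> h. complementary \<mu> \<eta>"
proof -
  obtain \<mu> where mu: "\<mu> \<in> Pr01" and ent: "cs_entropy \<mu> < \<infinity>"
    and mini: "\<And>\<nu>. \<nu> \<in> Pr01 \<Longrightarrow> primal_total \<mu> \<le> primal_total \<nu>"
    by (rule exists_primal_minimizer) (rule that)
  obtain m where m: "\<And>r. r \<in> {0..<1} \<Longrightarrow> m \<le> opt_wedge \<mu> r - h\<^sup>2 * r - \<xi> r"
    and AE: "AE r in \<mu>. r \<in> {0..<1} \<and> opt_wedge \<mu> r - h\<^sup>2 * r - \<xi> r = m"
    by (rule first_order_condition[OF mu ent]) (rule mini, assumption, rule that)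
  define \<eta> where "\<eta> = opt_eta \<mu> m"
  have X: "\<eta> \<in> spaceX" unfolding \<eta>_def by (rule opt_eta_spaceX[OF mu ent])
  note d2 = opt_eta_deriv2[OF mu ent, of m, folded \<eta>_def]
  have "AE s in lborel. s \<in> {0..1} \<longrightarrow> 0 \<le> deriv2 \<eta> s"
    using d2 by eventually_elim (use opt_density_nonneg in auto)
  moreover have "deriv1 \<eta> 0 = - h\<^sup>2" unfolding \<eta>_def using opt_eta_deriv1(3)[OF mu ent, of 0 m] by simp
  moreover have "\<xi> t \<le> \<eta> t" if "t \<in> {0..<1}" for t
    using m[OF that] that by (simp add: \<eta>_def opt_eta_def)
  ultimately have eta: "\<eta> \<in> Lambda \<xi> h" using X by (simp add: Lambda_def)
  have "measure \<mu> {s\<in>{0..<1}. \<eta> s = \<xi> s} = 1"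
    unfolding contact_measure_iff[OF mu X] using AE
    by eventually_elim (auto simp: \<eta>_def opt_eta_def)
  moreover have "AE s in lborel. s \<in> {0..1} \<longrightarrow> deriv2 \<eta> s * (phi \<mu> s)\<^sup>2 = 1"
    using d2 AE_lborel_singleton[of 1]
  proof eventually_elim
    case (elim s)
    show ?case
    proof
      assume s: "s \<in> {0..1}"
      hence "0 < cphi \<mu> s" using cs_entropy_finite_imp(2)[OF mu ent, of s] elim(2) by auto
      thus "deriv2 \<eta> s * (phi \<mu> s)\<^sup>2 = 1"
        using elim s by (simp add: phi_eq_cphi[OF mu] opt_density_def)
    qed
  qed
  ultimately show ?thesis using mu eta unfolding complementary_def by blast
qed

text \<open>The relation determines \<open>\<phi>\<close> almost everywhere, hence everywhere by continuity. The distribution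
function of \<open>\<mu>\<close> is minus the right derivative of \<open>\<phi>\<close>.\<close>

lemma complementary_unique_measure:
  assumes mu: "\<mu> \<in> Pr01" "\<nu> \<in> Pr01"
    and eq: "AE s in lborel. s \<in> {0..1} \<longrightarrow> deriv2 \<eta> s * (phi \<mu> s)\<^sup>2 = 1"
      "AE s in lborel. s \<in> {0..1} \<longrightarrow> deriv2 \<eta> s * (phi \<nu> s)\<^sup>2 = 1"
  shows "\<mu> = \<nu>"
proof -
  interpret mu: prob_space \<mu> by (rule Pr01D[OF mu(1)])
  interpret nu: prob_space \<nu> by (rule Pr01D[OF mu(2)])
  have "AE s in lborel. s \<in> {0..1} \<longrightarrow> cphi \<mu> s = cphi \<nu> s"
    using eq
  proof eventually_elim
    case (elim s)
    show ?case
    proof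
      assume s: "s \<in> {0..1}"
      hence "deriv2 \<eta> s * (cphi \<mu> s)\<^sup>2 = 1" "deriv2 \<eta> s * (cphi \<nu> s)\<^sup>2 = 1"
        using elim by (auto simp: phi_eq_cphi[OF mu(1)] phi_eq_cphi[OF mu(2)])
      hence "(cphi \<mu> s)\<^sup>2 = (cphi \<nu> s)\<^sup>2" by (metis mult_cancel_left mult_zero_left zero_neq_one)
      thus "cphi \<mu> s = cphi \<nu> s"
        using cphi_nonneg[OF mu(1), of s] cphi_nonneg[OF mu(2), of s] s by (simp add: power2_eq_iff_nonneg)
    qed
  qed
  hence ae: "AE s in lborel. s \<in> {0<..<1} \<longrightarrow> s \<in> {s. cphi \<mu> s = cphi \<nu> s}"
    by (rule eventually_mono) auto
  have cl: "closed {s. cphi \<mu> s = cphi \<nu> s}"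
    by (intro closed_Collect_eq cphi_continuous mu)
  have "{0<..<1} \<subseteq> {s. cphi \<mu> s = cphi \<nu> s}"
  proof
    fix s :: real assume "s \<in> {0<..<1}"
    thus "s \<in> {s. cphi \<mu> s = cphi \<nu> s}"
      by (intro mem_closed_if_AE_lebesgue_open[OF open_greaterThanLessThan cl AE_completion[OF ae]])
  qed
  hence "closure {0<..<1::real} \<subseteq> {s. cphi \<mu> s = cphi \<nu> s}" by (rule closure_minimal[OF _ cl])
  hence phieq: "cphi \<mu> s = cphi \<nu> s" if "s \<in> {0..1}" for s
    using that by (auto simp: closure_greaterThanLessThan)
  define step where "step = (\<lambda>s r::real. if r \<le> s then 1 else 0 :: real)"
  \<comment> \<open>Difference quotients of \<open>\<phi>\<close> along increments that stay inside the unit interval.\<close>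
  have lim: "(\<lambda>n. (cphi \<rho> s - cphi \<rho> (s + (1 - s) / (real n + 1))) / ((1 - s) / (real n + 1)))
      \<longlonglongrightarrow> (LINT r|\<rho>. step s r)" if rho: "\<rho> \<in> Pr01" and s: "s \<in> {0..<1}" for \<rho> s
  proof -
    interpret rho: prob_space \<rho> by (rule Pr01D[OF rho])
    define e where "e = (\<lambda>n. (1 - s) / (real n + 1))"
    have e0: "e n > 0" for n using s by (simp add: e_def)
    have elim0: "e \<longlonglongrightarrow> 0" unfolding e_def by real_asymp
    have "(cphi \<rho> s - cphi \<rho> (s + e n)) / e n = (LINT r|\<rho>. (max r (s + e n) - max r s) / e n)" for n
    proof -
      have "cphi \<rho> s - cphi \<rho> (s + e n) = (LINT r|\<rho>. (1 - max r s) - (1 - max r (s + e n)))"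
        unfolding cphi_def by (rule Bochner_Integration.integral_diff[symmetric]; rule cphi_integrable[OF rho])
      thus ?thesis by simp
    qed
    moreover have "(\<lambda>n. LINT r|\<rho>. (max r (s + e n) - max r s) / e n) \<longlonglongrightarrow> (LINT r|\<rho>. step s r)"
    proof (rule integral_dominated_convergence[where w = "\<lambda>_. 1"])
      note [measurable] = Pr01_measurable_id[OF rho]
      show "step s \<in> borel_measurable \<rho>" unfolding step_def by measurable
      show "(\<lambda>r. (max r (s + e n) - max r s) / e n) \<in> borel_measurable \<rho>" for n by measurable
      show "AE r in \<rho>. norm ((max r (s + e n) - max r s) / e n) \<le> 1" for n
        using e0[of n] by (intro AE_I2) (auto simp: max_def divide_le_eq)
      show "AE r in \<rho>. (\<lambda>n. (max r (s + e n) - max r s) / e n) \<longlonglongrightarrow> step s r"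
      proof (intro AE_I2)
        fix r
        show "(\<lambda>n. (max r (s + e n) - max r s) / e n) \<longlonglongrightarrow> step s r"
        proof (cases "r \<le> s")
          case True
          have "(max r (s + e n) - max r s) / e n = step s r" for n
            using True e0[of n] by (simp add: step_def max_def)
          thus ?thesis by simp
        next
          case False
          have "eventually (\<lambda>n. e n < r - s) sequentially"
            using elim0 False by (intro order_tendstoD(2)) auto
          hence "eventually (\<lambda>n. (max r (s + e n) - max r s) / e n = step s r) sequentially"
            by eventually_elim (use False in \<open>simp add: step_def max_def\<close>)
          thus ?thesis by (rule tendsto_eventually)
        qed
      qed
    qed simp
    ultimately show ?thesis unfolding e_def by (simp only:)
  qed
  have steq: "(LINT r|\<mu>. step s r) = (LINT r|\<nu>. step s r)" for s
  proof -
    consider "s < 0" | "s \<in> {0..<1}" | "1 \<le> s" by fastforce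
    thus ?thesis
    proof cases
      case 1
      have "(LINT r|\<rho>. step s r) = (LINT r|\<rho>. 0)" if "\<rho> \<in> Pr01" for \<rho>
        by (rule Bochner_Integration.integral_cong) (use 1 Pr01D(3)[OF that] in \<open>auto simp: step_def\<close>)
      thus ?thesis using mu by simp
    next
      case 2
      have "(1 - s) / (real n + 1) \<le> 1 - s" for n using 2 by (simp add: divide_le_eq mult_left_mono)
      hence "s + (1 - s) / (real n + 1) \<in> {0..1}" for n using 2 by (simp add: le_diff_eq add.commute)
      hence eq: "(\<lambda>n. (cphi \<mu> s - cphi \<mu> (s + (1 - s) / (real n + 1))) / ((1 - s) / (real n + 1)))
        = (\<lambda>n. (cphi \<nu> s - cphi \<nu> (s + (1 - s) / (real n + 1))) / ((1 - s) / (real n + 1)))"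
        using phieq 2 by auto
      show ?thesis by (rule LIMSEQ_unique[OF lim[OF mu(1) 2, unfolded eq] lim[OF mu(2) 2]])
    next
      case 3
      have "(LINT r|\<rho>. step s r) = (LINT r|\<rho>. 1)" if "\<rho> \<in> Pr01" for \<rho>
        by (rule Bochner_Integration.integral_cong) (use 3 Pr01D(3)[OF that] in \<open>auto simp: step_def\<close>)
      thus ?thesis using mu by (simp add: mu.prob_space nu.prob_space)
    qed
  qed
  have cdfs: "cdf (distr \<rho> borel (\<lambda>x. x)) s = (LINT r|\<rho>. step s r)" if rho: "\<rho> \<in> Pr01" for \<rho> s
  proof -
    interpret rho: prob_space \<rho> by (rule Pr01D[OF rho])
    note id = Pr01_measurable_id[OF rho]
    have sm: "step s \<in> borel_measurable borel" unfolding step_def by measurable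
    interpret D: prob_space "distr \<rho> borel (\<lambda>x. x)" by (rule rho.prob_space_distr[OF id])
    have "cdf (distr \<rho> borel (\<lambda>x. x)) s = (LINT r|distr \<rho> borel (\<lambda>x. x). indicator {..s} r)"
      by (simp add: cdf_def)
    also have "\<dots> = (LINT r|distr \<rho> borel (\<lambda>x. x). step s r)"
      by (rule Bochner_Integration.integral_cong) (auto simp: step_def indicator_def)
    also have "\<dots> = (LINT r|\<rho>. step s r)" by (rule integral_distr[OF id sm])
    finally show ?thesis .
  qed
  have "distr \<mu> borel (\<lambda>x. x) = distr \<nu> borel (\<lambda>x. x)"
  proof (rule cdf_unique)
    show "real_distribution (distr \<mu> borel (\<lambda>x. x))" "real_distribution (distr \<nu> borel (\<lambda>x. x))"
      by (intro mu.real_distribution_distr nu.real_distribution_distr Pr01_measurable_id mu)+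
    show "cdf (distr \<mu> borel (\<lambda>x. x)) = cdf (distr \<nu> borel (\<lambda>x. x))"
      using cdfs[OF mu(1)] cdfs[OF mu(2)] steq by auto
  qed
  moreover have "emeasure \<rho> A = emeasure (distr \<rho> borel (\<lambda>x. x)) A" if rho: "\<rho> \<in> Pr01" and A: "A \<in> sets \<rho>" for \<rho> A
  proof -
    have "A \<in> sets borel" "A \<subseteq> {0..1}"
      using A unfolding Pr01D(2)[OF rho] by (auto simp: sets_restrict_space_iff)
    thus ?thesis using Pr01D(3)[OF rho]
      by (subst emeasure_distr[OF Pr01_measurable_id[OF rho]]) (auto intro!: arg_cong[where f = "emeasure \<rho>"])
  qed
  ultimately show ?thesis
    using mu Pr01D(2)[OF mu(1)] Pr01D(2)[OF mu(2)] by (intro measure_eqI) auto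
qed

text \<open>Equal second derivatives and equal slopes at \<open>0\<close> leave a constant. Each function touches \<open>\<xi>\<close>
somewhere while the other stays above, so the constant is both nonnegative and nonpositive.\<close>

lemma complementary_unique_dual:
  assumes mu: "\<mu> \<in> Pr01" and eta: "\<eta> \<in> Lambda \<xi> h" "\<theta> \<in> Lambda \<xi> h"
    and comp: "complementary \<mu> \<eta>" "complementary \<mu> \<theta>"
  shows "\<eta> = \<theta>"
proof -
  interpret prob_space \<mu> by (rule Pr01D[OF mu])
  note L = LambdaD[OF eta(1)] and M = LambdaD[OF eta(2)]
  have ae: "AE s in lborel. s \<in> {0..1} \<longrightarrow> deriv2 \<eta> s = deriv2 \<theta> s"
  proof -
    have "AE s in lborel. s \<in> {0..1} \<longrightarrow> deriv2 \<eta> s * (phi \<mu> s)\<^sup>2 = 1"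
      "AE s in lborel. s \<in> {0..1} \<longrightarrow> deriv2 \<theta> s * (phi \<mu> s)\<^sup>2 = 1"
      using comp by (auto simp: complementary_def)
    thus ?thesis
      by eventually_elim (metis mult_cancel_right mult_zero_right zero_neq_one)
  qed
  have shift: "\<eta> r - \<eta> 0 = \<theta> r - \<theta> 0" if r: "r \<in> {0..<1}" for r
  proof -
    have "(LBINT s:{0..r}. (r - s) * deriv2 \<eta> s) = (LBINT s:{0..r}. (r - s) * deriv2 \<theta> s)"
    proof (rule set_lebesgue_integral_cong_AE)
      show "AE s\<in>{0..r} in lborel. (r - s) * deriv2 \<eta> s = (r - s) * deriv2 \<theta> s"
        using ae by eventually_elim (use r in auto)
    qed (use L(5) M(5) in simp_all)
    thus ?thesis using L(6)[OF r] M(6)[OF r] by simp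
  qed
  have contact: "\<exists>s\<in>{0..<1}. \<zeta> s = \<xi> s" if z: "\<zeta> \<in> Lambda \<xi> h" "complementary \<mu> \<zeta>" for \<zeta>
  proof -
    have "AE s in \<mu>. s \<in> {0..<1} \<and> \<zeta> s = \<xi> s"
      using z contact_measure_iff[OF mu LambdaD(1)[OF z(1)]] by (simp add: complementary_def)
    from eventually_happens'[OF ae_filter_bot this] show ?thesis by blast
  qed
  obtain s where s: "s \<in> {0..<1}" "\<eta> s = \<xi> s" using contact[OF eta(1) comp(1)] by blast
  obtain t where t: "t \<in> {0..<1}" "\<theta> t = \<xi> t" using contact[OF eta(2) comp(2)] by blast
  have "\<eta> 0 = \<theta> 0" using shift[OF s(1)] shift[OF t(1)] M(2)[OF s(1)] L(2)[OF t(1)] s(2) t(2) by simp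
  hence "\<eta> r = \<theta> r" if "r \<in> {0..<1}" for r using shift[OF that] by simp
  thus ?thesis
    using L(1) M(1) unfolding spaceX_def by (intro extensionalityI[of _ "{0..<1}"]) auto
qed

end

theorem theorem1p1:
  fixes \<beta> \<epsilon> h :: real and b :: "nat \<Rightarrow> real" and \<xi> :: "real \<Rightarrow> real"
  assumes xi: "\<xi> = cs_xi \<beta> b"
    and eps: "\<epsilon> > 0"
    and fin: "summable (\<lambda>p. \<beta>\<^sup>2 * ((b (p + 2))\<^sup>2 * (1 + \<epsilon>) ^ (p + 2)))"
    and h: "h \<ge> 0"
  shows "(\<exists>\<mu> \<eta>.
            is_arg_min (cs_primal \<xi> h) (\<lambda>\<nu>. \<nu> \<in> Pr01) \<mu> \<and>
            is_arg_max (cs_dual \<xi> h) (\<lambda>\<theta>. \<theta> \<in> Lambda \<xi> h) \<eta> \<and>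
            cs_primal \<xi> h \<mu> = cs_dual \<xi> h \<eta>) \<and>
         (\<exists>!x. case x of (\<mu>, \<eta>) \<Rightarrow> optimal_pair \<xi> h \<mu> \<eta>) \<and>
         (\<forall>\<mu>\<in>Pr01. \<forall>\<eta>\<in>Lambda \<xi> h.
            optimal_pair \<xi> h \<mu> \<eta> \<longleftrightarrow>
              measure \<mu> {s\<in>{0..<1}. \<eta> s = \<xi> s} = 1 \<and>
              (AE s in lborel. s \<in> {0..1} \<longrightarrow> deriv2 \<eta> s * (phi \<mu> s)\<^sup>2 = 1))"
proof -
  interpret cs_model \<xi> h unfolding xi by (rule cs_xi_model[OF eps fin])
  have opt: "optimal_pair \<xi> h \<mu> \<eta>" if "\<mu> \<in> Pr01" "\<eta> \<in> Lambda \<xi> h" "complementary \<mu> \<eta>" for \<mu> \<eta>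
  proof -
    have "cs_primal \<xi> h \<mu> = cs_dual \<xi> h \<eta>" using equal_if_complementary[OF that] by auto
    thus ?thesis unfolding optimal_pair_def is_arg_min_def is_arg_max_def
      using weak_duality that by (metis not_less)
  qed
  obtain \<mu>0 \<eta>0 where p0: "\<mu>0 \<in> Pr01" "\<eta>0 \<in> Lambda \<xi> h" "complementary \<mu>0 \<eta>0"
    using exists_complementary_pair by blast
  note o0 = opt[OF p0]
  have e0: "cs_primal \<xi> h \<mu>0 = cs_dual \<xi> h \<eta>0" using equal_if_complementary[OF p0] by auto
  have comp: "\<mu> \<in> Pr01 \<and> \<eta> \<in> Lambda \<xi> h \<and> complementary \<mu> \<eta>" if o: "optimal_pair \<xi> h \<mu> \<eta>" for \<mu> \<eta>
  proof -
    have in': "\<mu> \<in> Pr01" "\<eta> \<in> Lambda \<xi> h" using o by (auto simp: optimal_pair_def is_arg_min_def is_arg_max_def)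
    have "cs_primal \<xi> h \<mu> \<le> cs_primal \<xi> h \<mu>0" "cs_dual \<xi> h \<eta>0 \<le> cs_dual \<xi> h \<eta>"
      using o p0 by (auto simp: optimal_pair_def is_arg_min_def is_arg_max_def not_less)
    hence "cs_primal \<xi> h \<mu> = cs_dual \<xi> h \<eta>" using e0 weak_duality[OF in'] by simp
    thus ?thesis using complementary_if_equal[OF in'] in' by blast
  qed
  have uniq: "\<mu> = \<nu> \<and> \<eta> = \<theta>" if "optimal_pair \<xi> h \<mu> \<eta>" "optimal_pair \<xi> h \<nu> \<theta>" for \<mu> \<eta> \<nu> \<theta>
  proof -
    have "optimal_pair \<xi> h \<mu> \<theta>" using that unfolding optimal_pair_def by blast
    note c = comp[OF that(1)] comp[OF that(2)] comp[OF this]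
    show ?thesis
      using complementary_unique_measure[of \<mu> \<nu> \<theta>] complementary_unique_dual[of \<mu> \<eta> \<theta>] c
      unfolding complementary_def by blast
  qed
  show ?thesis
  proof (intro conjI ballI)
    show "\<exists>\<mu> \<eta>. is_arg_min (cs_primal \<xi> h) (\<lambda>\<nu>. \<nu> \<in> Pr01) \<mu> \<and>
            is_arg_max (cs_dual \<xi> h) (\<lambda>\<theta>. \<theta> \<in> Lambda \<xi> h) \<eta> \<and> cs_primal \<xi> h \<mu> = cs_dual \<xi> h \<eta>"
      using o0 e0 unfolding optimal_pair_def by blast
    show "\<exists>!x. case x of (\<mu>, \<eta>) \<Rightarrow> optimal_pair \<xi> h \<mu> \<eta>"
      by (rule ex1I[of _ "(\<mu>0, \<eta>0)"]) (use o0 uniq in auto)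
    show "optimal_pair \<xi> h \<mu> \<eta> \<longleftrightarrow> measure \<mu> {s\<in>{0..<1}. \<eta> s = \<xi> s} = 1 \<and>
              (AE s in lborel. s \<in> {0..1} \<longrightarrow> deriv2 \<eta> s * (phi \<mu> s)\<^sup>2 = 1)"
      if "\<mu> \<in> Pr01" "\<eta> \<in> Lambda \<xi> h" for \<mu> \<eta>
      using opt[OF that] comp[of \<mu> \<eta>] unfolding complementary_def by blast
  qed
qed

end
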